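(* Let $1\le m'\le m\le r$ be integers, let $n=mr$, $k=m'r$, let $u=(s_1s_2\cdots s_r)^{m}$ and let $\mathbf i=(1,\dots,r,\,1,\dots,r,\,\dots,\,1,\dots,r)$ ($m$ cycles) be its reduced word, so that $i_k=i_n=r$ and the $k$-th letter belongs to the $m'$-th cycle. Let $\mathbf Y=(Y_{1,1},\dots,Y_{1,r},\dots,Y_{m,1},\dots,Y_{m,r})\in(\mathbb C^\times)^n$. Then $$\Delta^L(k;\mathbf i)(\mathbf Y)=\sum_{( * )}\ \prod_{i=1}^{m'+1}\Bigl[B(t_i-1,\overline{k^{(t_i-1)}_i})B(t_i-2,\overline{k^{(t_i-2)}_i})\cdots B(m'-i+1,\overline{k^{(m'-i+1)}_i})\cdot B(t_{i-1}-1,r+1)B(t_{i-1}-2,r+1)\cdots B(t_i+1,r+1)\Bigr],$$ where the sum runs over all integers $t_1,\dots,t_{m'}$ and $k^{(s)}_i$ ($1\le i\le m'$, $m'-i+1\le s\le t_i-1$) satisfying the following conditions $( * )$: 1. $1\le t_{m'}<t_{m'-1}<\cdots<t_1\le m$, and $t_0:=m+1$, $t_{m'+1}:=0$; 2. $i\le k^{(m'-i+1)}_i\le\cdots\le k^{(t_i-2)}_i\le k^{(t_i-1)}_i\le r$ for $1\le i\le m'$; 3. $k^{(s-1)}_i\le k^{(s)}_i<k^{(s-1)}_{i+1}$ for $1\le s\le t_i-1$, where $k^{(s)}_i:=i$ for $0\le s\le m'-i$, and the inequality $k^{(s)}_i<k^{(s-1)}_{i+1}$ is imposed only when $k^{(s-1)}_{i+1}$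 is present, i.e. when $i+1\le m'$ and $s-1\le t_{i+1}-1$. In each product of $B$'s the first argument decreases by one from factor to factor, and a product whose first argument would have to increase (in particular the first product for $i=m'+1$) is empty and equals $1$.
   Context: Let $G$ be the simply connected simple algebraic group over $\mathbb C$ of type $\mathrm B_r$, $B,B_-$ opposite Borel subgroups, $N\subset B$, $N_-\subset B_-$ their unipotent radicals, $H=B\cap B_-$, $W=\mathrm{Norm}_G(H)/H$ the Weyl group with simple reflections $s_1,\dots,s_r$. Chevalley generators $e_i,f_i$ and simple coroots $h_i$ ($1\le i\le r$) of $\mathrm{Lie}(G)$ are taken for the Cartan matrix $a_{ij}=\alpha_j(h_i)$ with $a_{ii}=2$, $a_{ij}=-1$ if $|i-j|=1$ and $(i,j)\ne(r,r-1)$, $a_{r,r-1}=-2$, and $a_{ij}=0$ otherwise ($\alpha_r$ is the short simple root). $\Lambda_i$ is the $i$-th fundamental weight. Put $x_i(t)=\exp(te_i)$, $y_i(t)=\exp(tf_i)$, $\alpha_i^\vee(t)=t^{h_i}$, $x_{-i}(t)=y_i(t)\alpha_i^\vee(t^{-1})$ and $\overline{s_i}=x_i(-1)y_i(1)x_i(-1)$; for a reduced expression $w=s_{j_1}\cdots s_{j_p}$ put $\overline w=\overline{s_{j_1}}\cdots\overline{s_{j_p}}$. Generalized minor: for $x\in G_0=N_-HN$ write $x=[x]_-[x]_0[x]_+$ with $[x]_-\in N_-$, $[x]_0\in H$, $[x]_+\in N$. For $w\in W$, $\Delta_{w\Lambda_i,\Lambda_i}$ is the regular function on $G$ whose restriction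 to $\overline wG_0$ is $x\mapsto([\overline w^{-1}x]_0)^{\Lambda_i}$. For a reduced word $\mathbf i=(i_1,\dots,i_n)$ and $1\le k\le n$ put $u_{\le k}=s_{i_1}\cdots s_{i_k}$, $\Delta(k;\mathbf i)=\Delta_{u_{\le k}\Lambda_{i_k},\Lambda_{i_k}}$, and $x^L_{\mathbf i}(t_1,\dots,t_n)=x_{-i_1}(t_1)\cdots x_{-i_n}(t_n)$. Define $\Delta^L(k;\mathbf i)(\mathbf Y)=\Delta(k;\mathbf i)(x^L_{\mathbf i}(\mathbf Y))$, where the entries of $\mathbf Y$ are inserted in the listed order as $t_1,\dots,t_n$. Laurent monomials: for $1\le j\le r-1$, $B(l,\overline j)=\frac{Y_{l,j}}{Y_{l+1,j-1}}$; $B(l,\overline r)=\frac{Y_{l,r}^2}{Y_{l+1,r-1}}$; and $B(l,r+1)=\frac1{Y_{l,r}}$; with the convention $Y_{s,0}=1$. *)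

theory Defs
  imports
    "HOL-Algebra.Algebra"
    "Jordan_Normal_Form.Matrix"
begin

text \<open>
  The simply connected group of type \<open>B\<^sub>r\<close> over the complex numbers is \<open>Spin(2r+1)\<close>. It is
  realised as a Chevalley group, namely as the subgroup of \<open>GL(2^r)\<close> generated by the
  one-parameter subgroups of the Chevalley generators in the spin representation. The weights of
  this representation, \<open>(\<plusminus>\<epsilon>\<^sub>1 \<plusminus> ... \<plusminus> \<epsilon>\<^sub>r)/2\<close>, generate the full weight lattice, so the
  representation is faithful on the simply connected group. The representation is minuscule:
  all weights have multiplicity one, and in a suitable weight basis \<open>e\<^sub>i\<close> sends the vector of
  weight \<open>\<mu>\<close> to the vector of weight \<open>\<mu> + \<alpha>\<^sub>i\<close>, or to 0 if that is not a weight.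
\<close>

section \<open>Chevalley generators in the spin representation\<close>

text \<open>
  The basis vector with index \<open>a < 2^r\<close> has weight with \<open>\<epsilon>\<^sub>j\<close>-coordinate
  \<open>spin_sign r a j / 2\<close>, for \<open>1 \<le> j \<le> r\<close>. Index 0 is the highest weight.
\<close>

definition spin_sign :: "nat \<Rightarrow> nat \<Rightarrow> nat \<Rightarrow> int" where
  "spin_sign r a j = (if bit a (r - j) then -1 else 1)"

text \<open>
  The \<open>\<epsilon>\<^sub>j\<close>-coordinate of \<open>\<alpha>\<^sub>i\<close>, where \<open>\<alpha>\<^sub>i = \<epsilon>\<^sub>i - \<epsilon>\<^bsub>i+1\<^esub>\<close> for \<open>i < r\<close> and \<open>\<alpha>\<^sub>r = \<epsilon>\<^sub>r\<close>;
  only \<open>j\<close> in \<open>{1..r}\<close> is ever used.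
\<close>

definition simple_root :: "nat \<Rightarrow> nat \<Rightarrow> int" where
  "simple_root i j = (if j = i then 1 else if j = Suc i then -1 else 0)"

text \<open>Since \<open>spin_sign\<close> is twice the weight, the root enters the next definition doubled.\<close>

definition chev_e :: "nat \<Rightarrow> nat \<Rightarrow> complex mat" where
  "chev_e r i = mat (2 ^ r) (2 ^ r) (\<lambda>(a, b).
     if \<forall>j\<in>{1..r}. spin_sign r a j = spin_sign r b j + 2 * simple_root i j then 1 else 0)"

definition chev_f :: "nat \<Rightarrow> nat \<Rightarrow> complex mat" where
  "chev_f r i = transpose_mat (chev_e r i)"

text \<open>
  The eigenvalue of the simple coroot \<open>h\<^sub>i\<close> on the basis vector \<open>a\<close>: in the coordinates dual to
  the \<open>\<epsilon>\<^sub>j\<close>, \<open>h\<^sub>i\<close> is the difference of the coordinates \<open>i\<close> and \<open>i+1\<close> for \<open>i < r\<close>, and \<open>h\<^sub>r\<close> is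
  twice the coordinate \<open>r\<close>. This gives \<open>\<alpha>\<^bsub>r-1\<^esub>(h\<^sub>r) = -2\<close> and \<open>\<alpha>\<^sub>r(h\<^bsub>r-1\<^esub>) = -1\<close>.
\<close>

definition coroot_val :: "nat \<Rightarrow> nat \<Rightarrow> nat \<Rightarrow> int" where
  "coroot_val r i a =
     (if i < r then (spin_sign r a i - spin_sign r a (Suc i)) div 2 else spin_sign r a r)"

section \<open>The group and its subgroups\<close>

definition mat_exp :: "nat \<Rightarrow> complex mat \<Rightarrow> complex mat" where
  "mat_exp n A = mat n n (\<lambda>(a, b). suminf (\<lambda>k. (A ^\<^sub>m k) $$ (a, b) / fact k))"

definition x_pos :: "nat \<Rightarrow> nat \<Rightarrow> complex \<Rightarrow> complex mat" where
  "x_pos r i t = mat_exp (2 ^ r) (t \<cdot>\<^sub>m chev_e r i)"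

definition y_neg :: "nat \<Rightarrow> nat \<Rightarrow> complex \<Rightarrow> complex mat" where
  "y_neg r i t = mat_exp (2 ^ r) (t \<cdot>\<^sub>m chev_f r i)"

definition coroot_elt :: "nat \<Rightarrow> nat \<Rightarrow> complex \<Rightarrow> complex mat" where
  "coroot_elt r i t = mat_diag (2 ^ r) (\<lambda>a. t powi coroot_val r i a)"

definition gl :: "nat \<Rightarrow> complex mat monoid" where
  "gl n = units_of (ring_mat TYPE(complex) n ())"

definition spin :: "nat \<Rightarrow> complex mat monoid" where
  "spin r = (gl (2 ^ r))\<lparr>carrier := generate (gl (2 ^ r))
     ({x_pos r i t | i t. i \<in> {1..r}} \<union> {y_neg r i t | i t. i \<in> {1..r}})\<rparr>"

definition gprod :: "('a, 'b) monoid_scheme \<Rightarrow> 'a list \<Rightarrow> 'a" where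
  "gprod G xs = foldr (\<lambda>x y. x \<otimes>\<^bsub>G\<^esub> y) xs \<one>\<^bsub>G\<^esub>"

definition N_pos :: "nat \<Rightarrow> complex mat set" where
  "N_pos r = generate (spin r) {x_pos r i t | i t. i \<in> {1..r}}"

definition N_neg :: "nat \<Rightarrow> complex mat set" where
  "N_neg r = generate (spin r) {y_neg r i t | i t. i \<in> {1..r}}"

text \<open>
  The torus \<open>H = B \<inter> B\<^sub>-\<close>. As the group is simply connected,
  \<open>t \<mapsto> \<Prod>\<^sub>j \<alpha>\<^sub>j\<^sup>\<or>(t\<^sub>j)\<close> is an isomorphism from the \<open>r\<close>-fold product of the multiplicative
  group onto \<open>H\<close>, and the character \<open>h \<mapsto> h\<^sup>\<Lambda>\<close> for \<open>\<Lambda> = \<Lambda>\<^sub>i\<close> reads off the coordinate \<open>t\<^sub>i\<close>.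
\<close>

definition torus_elt :: "nat \<Rightarrow> (nat \<Rightarrow> complex) \<Rightarrow> complex mat" where
  "torus_elt r t = gprod (spin r) (map (\<lambda>j. coroot_elt r j (t j)) [1..<Suc r])"

definition torus :: "nat \<Rightarrow> complex mat set" where
  "torus r = torus_elt r ` {t. \<forall>j. t j \<noteq> 0}"

definition fund_char :: "nat \<Rightarrow> nat \<Rightarrow> complex mat \<Rightarrow> complex" where
  "fund_char r i h = (THE c. \<exists>t. (\<forall>j. t j \<noteq> 0) \<and> h = torus_elt r t \<and> c = t i)"

definition G0 :: "nat \<Rightarrow> complex mat set" where
  "G0 r = N_neg r <#>\<^bsub>spin r\<^esub> torus r <#>\<^bsub>spin r\<^esub> N_pos r"

definition torus_part :: "nat \<Rightarrow> complex mat \<Rightarrow> complex mat" where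
  "torus_part r x = (THE h. h \<in> torus r \<and>
     (\<exists>a\<in>N_neg r. \<exists>b\<in>N_pos r. x = a \<otimes>\<^bsub>spin r\<^esub> h \<otimes>\<^bsub>spin r\<^esub> b))"

section \<open>The Weyl group and its lifts\<close>

definition weyl :: "nat \<Rightarrow> complex mat set monoid" where
  "weyl r = (spin r)\<lparr>carrier := normalizer (spin r) (torus r)\<rparr> Mod torus r"

definition s_bar :: "nat \<Rightarrow> nat \<Rightarrow> complex mat" where
  "s_bar r i = x_pos r i (-1) \<otimes>\<^bsub>spin r\<^esub> y_neg r i 1 \<otimes>\<^bsub>spin r\<^esub> x_pos r i (-1)"

definition simple_refl :: "nat \<Rightarrow> nat \<Rightarrow> complex mat set" where
  "simple_refl r i = torus r #>\<^bsub>spin r\<^esub> s_bar r i"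

definition weyl_word :: "nat \<Rightarrow> nat list \<Rightarrow> complex mat set" where
  "weyl_word r js = gprod (weyl r) (map (simple_refl r) js)"

definition reduced_expr :: "nat \<Rightarrow> complex mat set \<Rightarrow> nat list \<Rightarrow> bool" where
  "reduced_expr r w js \<longleftrightarrow> set js \<subseteq> {1..r} \<and> weyl_word r js = w \<and>
     (\<forall>ks. set ks \<subseteq> {1..r} \<and> weyl_word r ks = w \<longrightarrow> length js \<le> length ks)"

text \<open>The lift does not depend on the reduced expression, because the \<open>s_bar r i\<close> satisfy the
  braid relations.\<close>

definition w_bar :: "nat \<Rightarrow> complex mat set \<Rightarrow> complex mat" where
  "w_bar r w = gprod (spin r) (map (s_bar r) (SOME js. reduced_expr r w js))"

section \<open>Generalized minors\<close>

inductive_set mat_poly_fun :: "nat \<Rightarrow> (complex mat \<Rightarrow> complex) set" for n :: nat where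
  const: "(\<lambda>x. c) \<in> mat_poly_fun n"
| entry: "a < n \<Longrightarrow> b < n \<Longrightarrow> (\<lambda>x. x $$ (a, b)) \<in> mat_poly_fun n"
| add: "p \<in> mat_poly_fun n \<Longrightarrow> q \<in> mat_poly_fun n \<Longrightarrow> (\<lambda>x. p x + q x) \<in> mat_poly_fun n"
| mult: "p \<in> mat_poly_fun n \<Longrightarrow> q \<in> mat_poly_fun n \<Longrightarrow> (\<lambda>x. p x * q x) \<in> mat_poly_fun n"

text \<open>
  The group is a closed subset of the matrix space contained in \<open>SL(2^r)\<close>, so that its regular
  functions are the restrictions of polynomials in the matrix entries; the inverse of the
  determinant need not be adjoined.
\<close>

definition regular_fun :: "nat \<Rightarrow> (complex mat \<Rightarrow> complex) set" where
  "regular_fun r = (\<lambda>p. restrict p (carrier (spin r))) ` mat_poly_fun (2 ^ r)"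

text \<open>\<open>gen_minor r w i\<close> is the generalized minor with indices \<open>w\<Lambda>\<^sub>i\<close> and \<open>\<Lambda>\<^sub>i\<close>.\<close>

definition gen_minor :: "nat \<Rightarrow> complex mat set \<Rightarrow> nat \<Rightarrow> complex mat \<Rightarrow> complex" where
  "gen_minor r w i = (THE f. f \<in> regular_fun r \<and>
     (\<forall>x \<in> w_bar r w <#\<^bsub>spin r\<^esub> G0 r.
        f x = fund_char r i (torus_part r (inv\<^bsub>spin r\<^esub> (w_bar r w) \<otimes>\<^bsub>spin r\<^esub> x))))"

text \<open>The \<open>k\<close>-th letter of a word \<open>js\<close> is \<open>js ! (k - 1)\<close>.\<close>

definition minor_word :: "nat \<Rightarrow> nat \<Rightarrow> nat list \<Rightarrow> complex mat \<Rightarrow> complex" where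
  "minor_word r k js = gen_minor r (weyl_word r (take k js)) (js ! (k - 1))"

definition x_minus :: "nat \<Rightarrow> nat \<Rightarrow> complex \<Rightarrow> complex mat" where
  "x_minus r i t = y_neg r i t \<otimes>\<^bsub>spin r\<^esub> coroot_elt r i (inverse t)"

definition xL :: "nat \<Rightarrow> nat list \<Rightarrow> complex list \<Rightarrow> complex mat" where
  "xL r js ts = gprod (spin r) (map2 (x_minus r) js ts)"

definition DeltaL :: "nat \<Rightarrow> nat \<Rightarrow> nat list \<Rightarrow> complex list \<Rightarrow> complex" where
  "DeltaL r k js ts = minor_word r k js (xL r js ts)"

definition cyclic_word :: "nat \<Rightarrow> nat \<Rightarrow> nat list" where
  "cyclic_word r m = concat (replicate m [1..<Suc r])"

definition Y_list :: "nat \<Rightarrow> nat \<Rightarrow> (nat \<Rightarrow> nat \<Rightarrow> complex) \<Rightarrow> complex list" where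
  "Y_list r m Y = concat (map (\<lambda>s. map (Y s) [1..<Suc r]) [1..<Suc m])"

section \<open>Laurent monomials and summation indices\<close>

definition Y_ext :: "(nat \<Rightarrow> nat \<Rightarrow> complex) \<Rightarrow> nat \<Rightarrow> nat \<Rightarrow> complex" where
  "Y_ext Y s j = (if j = 0 then 1 else Y s j)"

text \<open>\<open>B_bar r Y l j\<close> is \<open>B\<close> at \<open>l\<close> and the barred letter \<open>j\<close>, for \<open>1 \<le> j \<le> r\<close>;
  \<open>B_last r Y l\<close> is \<open>B\<close> at \<open>l\<close> and the unbarred letter \<open>r + 1\<close>.\<close>

definition B_bar :: "nat \<Rightarrow> (nat \<Rightarrow> nat \<Rightarrow> complex) \<Rightarrow> nat \<Rightarrow> nat \<Rightarrow> complex" where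
  "B_bar r Y l j = (if j = r then (Y l r)\<^sup>2 else Y l j) / Y_ext Y (l + 1) (j - 1)"

definition B_last :: "nat \<Rightarrow> (nat \<Rightarrow> nat \<Rightarrow> complex) \<Rightarrow> nat \<Rightarrow> complex" where
  "B_last r Y l = 1 / Y l r"

text \<open>
  The summation indices are pairs \<open>(t, k)\<close>, where \<open>k i s\<close> is the number with lower index \<open>i\<close> and
  upper index \<open>s\<close>. The two functions are total; the first and second line fix
  \<open>t 0 = m + 1\<close> and \<open>t (m' + 1) = 0\<close>, the third one gives the conventional values \<open>k i s = i\<close>,
  and all values that do not belong to the data are set to 0, so that
  distinct pairs are distinct choices of the summation variables. The number \<open>k i s\<close> is a genuine
  variable for \<open>m' + 1 - i \<le> s < t i\<close>. No subtraction truncates, and \<open>s < t i\<close> stands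
  for \<open>s \<le> t i - 1\<close>.
\<close>

definition index_pairs :: "nat \<Rightarrow> nat \<Rightarrow> nat \<Rightarrow> ((nat \<Rightarrow> nat) \<times> (nat \<Rightarrow> nat \<Rightarrow> nat)) set" where
  "index_pairs r m m' = {(t, k).
     t 0 = m + 1 \<and>
     (\<forall>i>m'. t i = 0) \<and>
     (\<forall>i\<in>{1..m'}. \<forall>s\<le>m' - i. k i s = i) \<and>
     (\<forall>i s. i \<notin> {1..m'} \<or> (m' + 1 - i \<le> s \<and> t i \<le> s) \<longrightarrow> k i s = 0) \<and>
     (\<forall>i\<in>{1..m'}. 1 \<le> t i \<and> t i \<le> m) \<and>
     (\<forall>i\<in>{1..<m'}. t (i + 1) < t i) \<and>
     (\<forall>i\<in>{1..m'}. \<forall>s. m' + 1 - i \<le> s \<and> s < t i \<longrightarrow> i \<le> k i s \<and> k i s \<le> r) \<and>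
     (\<forall>i\<in>{1..m'}. \<forall>s. m' + 1 - i \<le> s \<and> s + 1 < t i \<longrightarrow> k i s \<le> k i (s + 1)) \<and>
     (\<forall>i\<in>{1..m'}. \<forall>s. 1 \<le> s \<and> s < t i \<longrightarrow>
        k i (s - 1) \<le> k i s \<and>
        (i + 1 \<le> m' \<and> s - 1 < t (i + 1) \<longrightarrow> k i s < k (i + 1) (s - 1)))}"

end

theory Submission
  imports Defs "HOL-Computational_Algebra.Polynomial"
begin

text \<open>
The weight \<open>\<Lambda>\<^sub>r\<close> is the highest weight of the spin representation, so the minor in
question is a single matrix entry of that representation, and evaluating it on
\<open>x\<^bsub>-i\<^sub>1\<^esub>(t\<^sub>1) x\<^bsub>-i\<^sub>2\<^esub>(t\<^sub>2) ...\<close> is a sum over paths in the weight diagram. The theorem is a bookkeeping of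
these paths.

A weight \<open>(\<plusminus>\<epsilon>\<^sub>1 \<plusminus> ... \<plusminus> \<epsilon>\<^sub>r)/2\<close> is recorded by the set of its minus signs, a subset
of \<open>{1..r}\<close>, which is best viewed as a configuration of particles on the sites \<open>1, ..., r\<close>: the operator
\<open>f\<^sub>r\<close> creates a particle on site \<open>r\<close>, and \<open>f\<^sub>i\<close> with \<open>i < r\<close> moves a particle from \<open>i + 1\<close> to \<open>i\<close>.

With respect to the height grading, \<open>N\<^sub>-\<close> is lower and \<open>N\<close> upper
unitriangular, so \<open>([x]\<^sub>0)\<^bsup>\<Lambda>\<^sub>r\<^esup>\<close> is the corner entry of \<open>x\<close> (\<open>gauss_entry\<close>). On the translate of
\<open>G\<^sub>0\<close> the minor is therefore an entry of the matrix of \<open>x\<close> multiplied by the inverse lift of \<open>u\<close>, and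
density of \<open>G\<^sub>0\<close> (\<open>G0_dense\<close>) makes this the only regular extension. The lift is a signed permutation
matrix sending the highest weight vector to \<open>\<plusminus>\<close> the vector with minus signs on \<open>{1..m'}\<close>. The sign
is \<open>+\<close> because in a reduced word no simple reflection ever raises the weight it is applied to
(\<open>wprod_highest\<close>). Reduced words are recognised by an inversion count on the orbit of a regular
dominant vector: one letter changes it by one step, and the cyclic word gains a step with every
letter (\<open>wact_cyclic_word\<close>). A word of minimal length for the same element has to do the same, so
that its sign is \<open>+\<close> as well, whatever word the choice operator picks.

Within a cycle the letters act in the order \<open>r, ..., 1\<close>, so each site is visited
once and a particle travels down any distance as long as it stays above the old position of the one below it.
Between two given configurations there is at most one path, and it exists exactly when the
configurations interlace; its weight is a monomial that factors over the particles
(\<open>evolve_cycle\<close>, \<open>tail_weight_1\<close>). Hence the entry is a sum over chains of interlacing configurations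
from \<open>{1..m'}\<close> to the empty one (\<open>evolve_cycles\<close>).

In a chain, particle \<open>i\<close> is the \<open>i\<close>-th smallest element;
\<open>t\<^sub>i\<close> is the cycle that creates it, and \<open>k\<^sub>i\<^sup>(\<^sup>s\<^sup>)\<close> its site between the cycles \<open>s + 1\<close> and
\<open>s\<close>. Interlacing turns into the inequalities imposed on the summation indices
(\<open>interlaced_iff\<close>), which gives a bijection. In the product of the cycle weights the factors of
one particle combine to the monomials \<open>B(s, k)\<close>; cycles without creation contribute
\<open>B(s, r + 1)\<close>; and the factors at the forced sites \<open>k\<^sub>i\<^sup>(\<^sup>s\<^sup>) = i\<close>, which are absent from
the formula, cancel between neighbouring particles (\<open>prod_rearrange\<close>, \<open>chain_weight_to_chain\<close>).
\<close>

section \<open>Matrices indexed by sets of minus signs\<close>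

text \<open>
Matrices are handled through the subsets of \<open>{1..r}\<close>: a set \<open>A\<close> stands for the basis vector whose
weight has its minus signs exactly at \<open>A\<close>. The highest weight vector is \<open>{}\<close>.
\<close>

definition minus_set :: "nat \<Rightarrow> nat \<Rightarrow> nat set" where
  "minus_set r a = {j\<in>{1..r}. bit a (r - j)}"

lemma bij_minus_set: "bij_betw (minus_set r) {..<2 ^ r} (Pow {1..r})"
proof -
  have inj: "inj_on (minus_set r) {..<2 ^ r}"
  proof (rule inj_onI)
    fix a b :: nat
    assume a: "a \<in> {..<2 ^ r}" and b: "b \<in> {..<2 ^ r}" and eq: "minus_set r a = minus_set r b"
    have ta: "take_bit r a = a" and tb: "take_bit r b = b"
      using a b by (simp_all add: take_bit_nat_eq_self)
    show "a = b"
    proof (rule bit_eqI)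
      fix n
      show "bit a n \<longleftrightarrow> bit b n"
      proof (cases "n < r")
        case True
        then have "r - n \<in> {1..r}" "r - (r - n) = n" by auto
        then show ?thesis using eq unfolding minus_set_def by (metis (mono_tags, lifting) mem_Collect_eq)
      next
        case False
        then show ?thesis using ta tb by (metis bit_take_bit_iff)
      qed
    qed
  qed
  have "minus_set r ` {..<2 ^ r} \<subseteq> Pow {1..r}" by (auto simp: minus_set_def)
  moreover have "card (minus_set r ` {..<2 ^ r}) = card (Pow {1..r})"
    using inj by (simp add: card_image card_Pow)
  ultimately have "minus_set r ` {..<2 ^ r} = Pow {1..r}"
    by (intro card_subset_eq) auto
  then show ?thesis using inj by (simp add: bij_betw_def)
qed

lemma minus_set_subset: "minus_set r a \<subseteq> {1..r}"
  by (auto simp: minus_set_def)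

lemma minus_set_0 [simp]: "minus_set r 0 = {}"
  by (simp add: minus_set_def)

definition idx :: "nat \<Rightarrow> nat set \<Rightarrow> nat" where
  "idx r = inv_into {..<2 ^ r} (minus_set r)"

lemma idx_less: "A \<subseteq> {1..r} \<Longrightarrow> idx r A < 2 ^ r"
  using bij_minus_set[of r] unfolding idx_def bij_betw_def
  by (metis PowI inv_into_into lessThan_iff)

lemma minus_set_idx [simp]: "A \<subseteq> {1..r} \<Longrightarrow> minus_set r (idx r A) = A"
  using bij_minus_set[of r] unfolding idx_def by (simp add: bij_betw_inv_into_right)

lemma idx_minus_set [simp]: "a < 2 ^ r \<Longrightarrow> idx r (minus_set r a) = a"
  using bij_minus_set[of r] unfolding idx_def by (simp add: bij_betw_inv_into_left)

lemma idx_empty [simp]: "idx r {} = 0"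
  using idx_minus_set[of 0 r] by simp

lemma sum_minus_set: "(\<Sum>a\<in>{0..<2 ^ r}. f (minus_set r a)) = (\<Sum>A\<in>Pow {1..r}. f A)"
  using sum.reindex_bij_betw[OF bij_minus_set, of f r] by (simp add: atLeast0LessThan)

definition ent :: "nat \<Rightarrow> complex mat \<Rightarrow> nat set \<Rightarrow> nat set \<Rightarrow> complex" where
  "ent r M A B = M $$ (idx r A, idx r B)"

definition set_mat :: "nat \<Rightarrow> (nat set \<Rightarrow> nat set \<Rightarrow> complex) \<Rightarrow> complex mat" where
  "set_mat r K = mat (2 ^ r) (2 ^ r) (\<lambda>(a, b). K (minus_set r a) (minus_set r b))"

abbreviation sq :: "nat \<Rightarrow> complex mat set" where
  "sq r \<equiv> carrier_mat (2 ^ r) (2 ^ r)"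

lemma set_mat_carrier [simp]: "set_mat r K \<in> sq r"
  by (simp add: set_mat_def)

lemma ent_set_mat [simp]: "A \<subseteq> {1..r} \<Longrightarrow> B \<subseteq> {1..r} \<Longrightarrow> ent r (set_mat r K) A B = K A B"
  by (simp add: ent_def set_mat_def idx_less)

lemma mat_eq_entI:
  assumes "M \<in> sq r" "N \<in> sq r"
    and "\<And>A B. A \<subseteq> {1..r} \<Longrightarrow> B \<subseteq> {1..r} \<Longrightarrow> ent r M A B = ent r N A B"
  shows "M = N"
proof (rule eq_matI)
  fix a b assume "a < dim_row N" "b < dim_col N"
  then have "a < 2 ^ r" "b < 2 ^ r" using assms(2) by auto
  then show "M $$ (a, b) = N $$ (a, b)"
    using assms(3)[of "minus_set r a" "minus_set r b"] minus_set_subset by (auto simp: ent_def)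
qed (use assms in auto)

lemma ent_mult:
  assumes "M \<in> sq r" "N \<in> sq r" "A \<subseteq> {1..r}" "B \<subseteq> {1..r}"
  shows "ent r (M * N) A B = (\<Sum>C\<in>Pow {1..r}. ent r M A C * ent r N C B)"
proof -
  have "ent r (M * N) A B = (\<Sum>c\<in>{0..<2 ^ r}. M $$ (idx r A, c) * N $$ (c, idx r B))"
    using assms idx_less[OF assms(3)] idx_less[OF assms(4)]
    by (auto simp: ent_def scalar_prod_def intro!: sum.cong)
  also have "\<dots> = (\<Sum>c\<in>{0..<2 ^ r}. ent r M A (minus_set r c) * ent r N (minus_set r c) B)"
    by (intro sum.cong) (auto simp: ent_def)
  also have "\<dots> = (\<Sum>C\<in>Pow {1..r}. ent r M A C * ent r N C B)"
    by (rule sum_minus_set)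
  finally show ?thesis .
qed

lemma ent_one:
  assumes "A \<subseteq> {1..r}" "B \<subseteq> {1..r}"
  shows "ent r (1\<^sub>m (2 ^ r)) A B = (if A = B then 1 else 0)"
proof -
  have "idx r A = idx r B \<longleftrightarrow> A = B"
    using assms by (metis minus_set_idx)
  then show ?thesis using assms by (simp add: ent_def idx_less)
qed

text \<open>
The \<open>i\<close>-string through a weight has at most two members, because the representation is minuscule.
The two predicates say that \<open>A\<close> is the upper, respectively lower, end of a string of length two:
the simple root \<open>\<alpha>\<^sub>i\<close> can be subtracted, respectively added.
\<close>

definition lowerable :: "nat \<Rightarrow> nat \<Rightarrow> nat set \<Rightarrow> bool" where
  "lowerable r i A \<longleftrightarrow> i \<notin> A \<and> (i = r \<or> Suc i \<in> A)"

definition raisable :: "nat \<Rightarrow> nat \<Rightarrow> nat set \<Rightarrow> bool" where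
  "raisable r i A \<longleftrightarrow> i \<in> A \<and> (i = r \<or> Suc i \<notin> A)"

text \<open>
For \<open>i < r\<close> subtracting \<open>\<alpha>\<^sub>i\<close> moves the minus sign from \<open>i + 1\<close> to \<open>i\<close>; for \<open>i = r\<close> it creates a minus
sign at \<open>r\<close>. One formula serves both cases, since \<open>Suc r\<close> is never a member.
\<close>

definition lowered :: "nat \<Rightarrow> nat set \<Rightarrow> nat set" where
  "lowered i A = insert i (A - {Suc i})"

definition raised :: "nat \<Rightarrow> nat \<Rightarrow> nat set \<Rightarrow> nat set" where
  "raised r i A = A - {i} \<union> (if i < r then {Suc i} else {})"

lemma lowered_subset: "i \<in> {1..r} \<Longrightarrow> A \<subseteq> {1..r} \<Longrightarrow> lowered i A \<subseteq> {1..r}"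
  by (auto simp: lowered_def)

lemma raised_subset: "i \<in> {1..r} \<Longrightarrow> A \<subseteq> {1..r} \<Longrightarrow> raised r i A \<subseteq> {1..r}"
  by (auto simp: raised_def)

lemma raisable_not_lowerable: "raisable r i A \<Longrightarrow> \<not> lowerable r i A"
  by (auto simp: raisable_def lowerable_def)

lemma raisable_lowered: "lowerable r i A \<Longrightarrow> raisable r i (lowered i A)"
  by (auto simp: raisable_def lowerable_def lowered_def)

lemma lowerable_raised: "i \<in> {1..r} \<Longrightarrow> raisable r i A \<Longrightarrow> lowerable r i (raised r i A)"
  by (auto simp: raisable_def lowerable_def raised_def)

lemma raised_lowered: "i \<in> {1..r} \<Longrightarrow> A \<subseteq> {1..r} \<Longrightarrow> lowerable r i A \<Longrightarrow> raised r i (lowered i A) = A"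
  by (auto simp: lowerable_def raised_def lowered_def)

lemma lowered_raised: "i \<in> {1..r} \<Longrightarrow> A \<subseteq> {1..r} \<Longrightarrow> raisable r i A \<Longrightarrow> lowered i (raised r i A) = A"
  by (auto simp: raisable_def raised_def lowered_def)

text \<open>
A 2 by 2 matrix with rows \<open>(p, q)\<close> and \<open>(u, v)\<close> acts on every \<open>i\<close>-string of length two, with the upper
end first, and trivially on the strings of length one. On matrices of determinant one this is the homomorphism
from \<open>SL\<^sub>2\<close> attached to \<open>\<alpha>\<^sub>i\<close>, so that rank one identities reduce to arithmetic with 2 by 2 matrices.
\<close>

definition sl2_act :: "nat \<Rightarrow> nat \<Rightarrow> complex \<Rightarrow> complex \<Rightarrow> complex \<Rightarrow> complex
    \<Rightarrow> (nat set \<Rightarrow> complex) \<Rightarrow> nat set \<Rightarrow> complex" where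
  "sl2_act r i p q u v f A =
     (if lowerable r i A then p * f A + q * f (lowered i A)
      else if raisable r i A then u * f (raised r i A) + v * f A
      else f A)"

lemma sl2_act_sl2_act:
  assumes "i \<in> {1..r}" "A \<subseteq> {1..r}"
  shows "sl2_act r i p q u v (sl2_act r i p' q' u' v' f) A =
    sl2_act r i (p * p' + q * u') (p * q' + q * v') (u * p' + v * u') (u * q' + v * v') f A"
  using assms raisable_lowered[of r i A] lowerable_raised[of i r A]
    raised_lowered[of i r A] lowered_raised[of i r A]
    raisable_not_lowerable[of r i "lowered i A"] raisable_not_lowerable[of r i A]
  by (simp add: sl2_act_def algebra_simps)

definition sl2_blk :: "nat \<Rightarrow> nat \<Rightarrow> complex \<Rightarrow> complex \<Rightarrow> complex \<Rightarrow> complex \<Rightarrow> complex mat" where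
  "sl2_blk r i p q u v = set_mat r (\<lambda>A B. sl2_act r i p q u v (\<lambda>C. if C = B then 1 else 0) A)"

lemma sl2_blk_carrier [simp]: "sl2_blk r i p q u v \<in> sq r"
  by (simp add: sl2_blk_def)

lemma ent_sl2_blk_mult:
  assumes "i \<in> {1..r}" "M \<in> sq r" "A \<subseteq> {1..r}" "B \<subseteq> {1..r}"
  shows "ent r (sl2_blk r i p q u v * M) A B = sl2_act r i p q u v (\<lambda>C. ent r M C B) A"
proof -
  have *: "(\<Sum>C\<in>Pow {1..r}. (if D = C then 1 else 0) * g C) = g D" if "D \<subseteq> {1..r}" for D and g :: "nat set \<Rightarrow> complex"
    using that by (simp add: if_distrib[of "\<lambda>x. x * _"] cong: if_cong)
  have "ent r (sl2_blk r i p q u v * M) A B =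
      (\<Sum>C\<in>Pow {1..r}. sl2_act r i p q u v (\<lambda>D. if D = C then 1 else 0) A * ent r M C B)"
    using assms by (subst ent_mult) (auto simp: sl2_blk_def intro!: sum.cong)
  also have "\<dots> = sl2_act r i p q u v (\<lambda>C. ent r M C B) A"
    using *[OF assms(3)] *[OF lowered_subset[OF assms(1,3)]] *[OF raised_subset[OF assms(1,3)]]
    by (simp add: sl2_act_def sum.distrib distrib_right mult.assoc flip: sum_distrib_left)
  finally show ?thesis .
qed

lemma sl2_blk_mult:
  assumes "i \<in> {1..r}"
  shows "sl2_blk r i p q u v * sl2_blk r i p' q' u' v' =
    sl2_blk r i (p * p' + q * u') (p * q' + q * v') (u * p' + v * u') (u * q' + v * v')"
proof (rule mat_eq_entI)
  fix A B assume AB: "A \<subseteq> {1..r}" "B \<subseteq> {1..r}"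
  let ?d = "\<lambda>C. if C = B then 1 else 0 :: complex"
  have "ent r (sl2_blk r i p q u v * sl2_blk r i p' q' u' v') A B
      = sl2_act r i p q u v (\<lambda>C. ent r (sl2_blk r i p' q' u' v') C B) A"
    using assms AB by (simp add: ent_sl2_blk_mult)
  also have "\<dots> = sl2_act r i p q u v (sl2_act r i p' q' u' v' ?d) A"
    using AB lowered_subset[OF assms AB(1)] raised_subset[OF assms AB(1)]
    by (simp add: sl2_act_def[of r i p q u v] sl2_blk_def)
  finally show "ent r (sl2_blk r i p q u v * sl2_blk r i p' q' u' v') A B =
      ent r (sl2_blk r i (p * p' + q * u') (p * q' + q * v') (u * p' + v * u') (u * q' + v * v')) A B"
    using assms AB by (simp add: sl2_act_sl2_act sl2_blk_def)
qed (auto intro: mult_carrier_mat[OF sl2_blk_carrier sl2_blk_carrier])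

lemma sl2_blk_one: "sl2_blk r i 1 0 0 1 = 1\<^sub>m (2 ^ r)"
  by (rule mat_eq_entI[of _ r]) (auto simp: sl2_blk_def ent_one sl2_act_def)

lemma spin_sign_minus_set: "j \<in> {1..r} \<Longrightarrow> spin_sign r a j = (if j \<in> minus_set r a then -1 else 1)"
  by (auto simp: spin_sign_def minus_set_def)

lemma chev_e_iff:
  assumes i: "i \<in> {1..r}"
  shows "(\<forall>j\<in>{1..r}. spin_sign r a j = spin_sign r b j + 2 * simple_root i j) \<longleftrightarrow>
     lowerable r i (minus_set r a) \<and> minus_set r b = lowered i (minus_set r a)" (is "?L \<longleftrightarrow> ?R")
proof -
  have sub: "minus_set r a \<subseteq> {1..r}" "minus_set r b \<subseteq> {1..r}" by (rule minus_set_subset)+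
  let ?K = "\<lambda>j. if j = i then j \<notin> minus_set r a \<and> j \<in> minus_set r b
       else if j = Suc i then j \<in> minus_set r a \<and> j \<notin> minus_set r b
       else (j \<in> minus_set r a \<longleftrightarrow> j \<in> minus_set r b)"
  have key: "(spin_sign r a j = spin_sign r b j + 2 * simple_root i j) \<longleftrightarrow> ?K j" if "j \<in> {1..r}" for j
    using that by (auto simp: spin_sign_minus_set simple_root_def)
  show ?thesis
  proof
    assume ?L
    then have k: "?K j" if "j \<in> {1..r}" for j using key that by blast
    have "lowerable r i (minus_set r a)"
      using k[of i] k[of "Suc i"] i by (cases "i = r") (auto simp: lowerable_def)
    moreover have "j \<in> minus_set r b \<longleftrightarrow> j \<in> lowered i (minus_set r a)" for j
    proof (cases "j \<in> {1..r}")
      case True then show ?thesis using k[of j] by (auto simp: lowered_def split: if_splits)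
    next
      case False then show ?thesis using sub i by (auto simp: lowered_def)
    qed
    ultimately show ?R by blast
  next
    assume R: ?R
    show ?L
    proof
      fix j assume j: "j \<in> {1..r}"
      show "spin_sign r a j = spin_sign r b j + 2 * simple_root i j"
        unfolding key[OF j] using R j by (auto simp: lowerable_def lowered_def)
    qed
  qed
qed

lemma chev_e_carrier [simp]: "chev_e r i \<in> sq r"
  by (simp add: chev_e_def)

lemma ent_chev_e:
  assumes "i \<in> {1..r}" "A \<subseteq> {1..r}" "B \<subseteq> {1..r}"
  shows "ent r (chev_e r i) A B = (if lowerable r i A \<and> B = lowered i A then 1 else 0)"
  using assms chev_e_iff[OF assms(1), of "idx r A" "idx r B"]
  by (simp add: ent_def chev_e_def idx_less)

lemma chev_f_carrier [simp]: "chev_f r i \<in> sq r"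
  by (simp add: chev_f_def)

lemma ent_chev_f:
  assumes "i \<in> {1..r}" "A \<subseteq> {1..r}" "B \<subseteq> {1..r}"
  shows "ent r (chev_f r i) A B = (if raisable r i A \<and> B = raised r i A then 1 else 0)"
proof -
  have dim: "dim_row (chev_e r i) = 2 ^ r" "dim_col (chev_e r i) = 2 ^ r" by (simp_all add: chev_e_def)
  have "ent r (chev_f r i) A B = ent r (chev_e r i) B A"
    using assms by (simp add: ent_def chev_f_def idx_less dim)
  also have "\<dots> = (if lowerable r i B \<and> A = lowered i B then 1 else 0)"
    using assms by (simp add: ent_chev_e)
  also have "\<dots> = (if raisable r i A \<and> B = raised r i A then 1 else 0)"
    using assms raisable_lowered[of r i B] lowerable_raised[of i r A] raised_lowered[of i r B] lowered_raised[of i r A]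
    by auto
  finally show ?thesis .
qed

text \<open>
Applies to all Chevalley generators: in a minuscule representation no weight can be raised twice
by the same simple root, whence \<open>e\<^sub>i\<^sup>2 = f\<^sub>i\<^sup>2 = 0\<close>.
\<close>

lemma mat_exp_square_zero:
  assumes A: "A \<in> carrier_mat n n" and "A * A = 0\<^sub>m n n"
  shows "mat_exp n A = 1\<^sub>m n + A"
proof (rule eq_matI)
  fix a b assume "a < dim_row (1\<^sub>m n + A)" "b < dim_col (1\<^sub>m n + A)"
  then have ab: "a < n" "b < n" using A by auto
  have pow: "A ^\<^sub>m k = 0\<^sub>m n n" if "2 \<le> k" for k
    using that
  proof (induction k rule: dec_induct)
    case base then show ?case using A assms(2) by (simp add: numeral_2_eq_2)
  next
    case (step k) then show ?case using A by simp
  qed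
  have "suminf (\<lambda>k. (A ^\<^sub>m k) $$ (a, b) / fact k) = (\<Sum>k\<in>{0, 1}. (A ^\<^sub>m k) $$ (a, b) / fact k)"
  proof (rule suminf_finite)
    fix k assume "k \<notin> {0, 1 :: nat}"
    then have "2 \<le> k" by auto
    then show "(A ^\<^sub>m k) $$ (a, b) / fact k = 0" using pow ab by simp
  qed simp
  then show "mat_exp n A $$ (a, b) = (1\<^sub>m n + A) $$ (a, b)"
    using ab A by (simp add: mat_exp_def)
qed (use A in \<open>auto simp: mat_exp_def\<close>)

lemma ent_smult: "M \<in> sq r \<Longrightarrow> A \<subseteq> {1..r} \<Longrightarrow> B \<subseteq> {1..r} \<Longrightarrow> ent r (c \<cdot>\<^sub>m M) A B = c * ent r M A B"
  by (simp add: ent_def idx_less carrier_matD)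

lemma ent_add: "M \<in> sq r \<Longrightarrow> N \<in> sq r \<Longrightarrow> A \<subseteq> {1..r} \<Longrightarrow> B \<subseteq> {1..r}
    \<Longrightarrow> ent r (M + N) A B = ent r M A B + ent r N A B"
  by (simp add: ent_def idx_less carrier_matD)

lemma ent_zero: "A \<subseteq> {1..r} \<Longrightarrow> B \<subseteq> {1..r} \<Longrightarrow> ent r (0\<^sub>m (2 ^ r) (2 ^ r)) A B = 0"
  by (simp add: ent_def idx_less)

lemma x_pos_eq: 
  assumes "i \<in> {1..r}"
  shows "x_pos r i t = sl2_blk r i 1 t 0 1"
proof -
  let ?M = "t \<cdot>\<^sub>m chev_e r i"
  have M: "?M \<in> sq r" by simp
  have "?M * ?M = 0\<^sub>m (2 ^ r) (2 ^ r)"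
  proof (rule mat_eq_entI)
    fix A B assume "A \<subseteq> {1..r}" "B \<subseteq> {1..r}"
    then show "ent r (?M * ?M) A B = ent r (0\<^sub>m (2 ^ r) (2 ^ r)) A B"
      using assms M by (subst ent_mult)
        (auto simp: ent_smult ent_chev_e ent_zero lowerable_def lowered_def intro!: sum.neutral)
  qed (use M in \<open>simp_all add: mult_carrier_mat[OF M M]\<close>)
  then have "x_pos r i t = 1\<^sub>m (2 ^ r) + ?M"
    unfolding x_pos_def by (intro mat_exp_square_zero[OF M])
  also have "\<dots> = sl2_blk r i 1 t 0 1"
  proof (rule mat_eq_entI)
    fix A B assume "A \<subseteq> {1..r}" "B \<subseteq> {1..r}"
    then show "ent r (1\<^sub>m (2 ^ r) + ?M) A B = ent r (sl2_blk r i 1 t 0 1) A B"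
      using assms M by (auto simp: ent_add ent_one ent_smult ent_chev_e sl2_blk_def sl2_act_def)
  qed auto
  finally show ?thesis .
qed

lemma y_neg_eq: 
  assumes "i \<in> {1..r}"
  shows "y_neg r i t = sl2_blk r i 1 0 t 1"
proof -
  let ?M = "t \<cdot>\<^sub>m chev_f r i"
  have M: "?M \<in> sq r" by simp
  have "?M * ?M = 0\<^sub>m (2 ^ r) (2 ^ r)"
  proof (rule mat_eq_entI)
    fix A B assume "A \<subseteq> {1..r}" "B \<subseteq> {1..r}"
    then show "ent r (?M * ?M) A B = ent r (0\<^sub>m (2 ^ r) (2 ^ r)) A B"
      using assms M by (subst ent_mult)
        (auto simp: ent_smult ent_chev_f ent_zero raisable_def raised_def intro!: sum.neutral)
  qed (use M in \<open>simp_all add: mult_carrier_mat[OF M M]\<close>)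
  then have "y_neg r i t = 1\<^sub>m (2 ^ r) + ?M"
    unfolding y_neg_def by (intro mat_exp_square_zero[OF M])
  also have "\<dots> = sl2_blk r i 1 0 t 1"
  proof (rule mat_eq_entI)
    fix A B assume "A \<subseteq> {1..r}" "B \<subseteq> {1..r}"
    then show "ent r (1\<^sub>m (2 ^ r) + ?M) A B = ent r (sl2_blk r i 1 0 t 1) A B"
      using assms M raisable_not_lowerable[of r i A]
      by (auto simp: ent_add ent_one ent_smult ent_chev_f sl2_blk_def sl2_act_def)
  qed auto
  finally show ?thesis .
qed

definition hweight :: "nat \<Rightarrow> nat \<Rightarrow> nat set \<Rightarrow> int" where
  "hweight r i A = (if lowerable r i A then 1 else if raisable r i A then -1 else 0)"

lemma coroot_val_minus_set: "i \<in> {1..r} \<Longrightarrow> coroot_val r i a = hweight r i (minus_set r a)"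
  by (cases "i = r") (auto simp: coroot_val_def hweight_def spin_sign_minus_set lowerable_def raisable_def)

lemma coroot_elt_diag:
  "i \<in> {1..r} \<Longrightarrow> coroot_elt r i t = set_mat r (\<lambda>A B. if A = B then t powi hweight r i A else 0)"
  using bij_minus_set[of r] by (auto simp: coroot_elt_def set_mat_def mat_diag_def coroot_val_minus_set bij_betw_def inj_on_def
      intro!: cong_mat)

lemma coroot_elt_eq: "i \<in> {1..r} \<Longrightarrow> coroot_elt r i t = sl2_blk r i t 0 0 (inverse t)"
  by (auto simp: coroot_elt_diag sl2_blk_def set_mat_def sl2_act_def hweight_def power_int_minus intro!: cong_mat)

section \<open>The group and its subgroups\<close>

lemma sq_mult [simp]: "M \<in> sq r \<Longrightarrow> N \<in> sq r \<Longrightarrow> M * N \<in> sq r"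
  by (rule mult_carrier_mat)

lemma sq_assoc: "M \<in> sq r \<Longrightarrow> N \<in> sq r \<Longrightarrow> P \<in> sq r \<Longrightarrow> M * N * P = M * (N * P)"
  by (rule assoc_mult_mat)

lemma sq_one_left: "M \<in> sq r \<Longrightarrow> 1\<^sub>m (2 ^ r) * M = M"
  and sq_one_right: "M \<in> sq r \<Longrightarrow> M * 1\<^sub>m (2 ^ r) = M"
  by (rule left_mult_one_mat right_mult_one_mat; assumption)+

lemma gl_group: "group (gl n)"
proof -
  interpret ring "ring_mat TYPE(complex) n ()" by (rule ring_mat)
  show ?thesis unfolding gl_def by (rule units_group)
qed

lemma mult_gl [simp]: "monoid.mult (gl n) = (*)"
  and one_gl [simp]: "monoid.one (gl n) = 1\<^sub>m n"
  by (simp_all add: gl_def units_of_mult units_of_one ring_mat_simps)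

lemma carrier_glI:
  assumes "M \<in> carrier_mat n n" "N \<in> carrier_mat n n" "M * N = 1\<^sub>m n" "N * M = 1\<^sub>m n"
  shows "M \<in> carrier (gl n)"
  using assms by (auto simp: gl_def units_of_carrier Units_def ring_mat_simps)

lemma carrier_gl_subset: "carrier (gl n) \<subseteq> carrier_mat n n"
  by (auto simp: gl_def units_of_carrier Units_def ring_mat_simps)

lemma mult_spin [simp]: "monoid.mult (spin r) = (*)"
  and one_spin [simp]: "monoid.one (spin r) = 1\<^sub>m (2 ^ r)"
  by (simp_all add: spin_def)

lemma x_pos_inverse: "i \<in> {1..r} \<Longrightarrow> x_pos r i t * x_pos r i (- t) = 1\<^sub>m (2 ^ r)"
  by (simp add: x_pos_eq sl2_blk_mult sl2_blk_one)

lemma y_neg_inverse: "i \<in> {1..r} \<Longrightarrow> y_neg r i t * y_neg r i (- t) = 1\<^sub>m (2 ^ r)"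
  by (simp add: y_neg_eq sl2_blk_mult sl2_blk_one)

lemma x_pos_gl: "i \<in> {1..r} \<Longrightarrow> x_pos r i t \<in> carrier (gl (2 ^ r))"
  using x_pos_inverse[of i r t] x_pos_inverse[of i r "- t"]
  by (intro carrier_glI[of _ _ "x_pos r i (- t)"]) (simp_all add: x_pos_eq)

lemma y_neg_gl: "i \<in> {1..r} \<Longrightarrow> y_neg r i t \<in> carrier (gl (2 ^ r))"
  using y_neg_inverse[of i r t] y_neg_inverse[of i r "- t"]
  by (intro carrier_glI[of _ _ "y_neg r i (- t)"]) (simp_all add: y_neg_eq)

lemma spin_gens_gl:
  "{x_pos r i t | i t. i \<in> {1..r}} \<union> {y_neg r i t | i t. i \<in> {1..r}} \<subseteq> carrier (gl (2 ^ r))"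
  using x_pos_gl y_neg_gl by blast

lemma spin_group: "group (spin r)"
  unfolding spin_def
  by (intro group.subgroup_imp_group group.generate_is_subgroup gl_group spin_gens_gl)

lemma carrier_spin_sq: "carrier (spin r) \<subseteq> sq r"
  using group.generate_in_carrier[OF gl_group spin_gens_gl] carrier_gl_subset
  by (fastforce simp: spin_def)

lemma spin_sq [simp]: "g \<in> carrier (spin r) \<Longrightarrow> g \<in> sq r"
  using carrier_spin_sq by blast

lemma x_pos_spin [simp]: "i \<in> {1..r} \<Longrightarrow> x_pos r i t \<in> carrier (spin r)"
  and y_neg_spin [simp]: "i \<in> {1..r} \<Longrightarrow> y_neg r i t \<in> carrier (spin r)"
  by (auto simp: spin_def intro!: generate.incl)

lemma spin_mult_closed [simp]:
  "g \<in> carrier (spin r) \<Longrightarrow> h \<in> carrier (spin r) \<Longrightarrow> g * h \<in> carrier (spin r)"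
  using monoid.m_closed[OF group.is_monoid[OF spin_group]] by fastforce

lemma spin_one_closed [simp]: "1\<^sub>m (2 ^ r) \<in> carrier (spin r)"
  using monoid.one_closed[OF group.is_monoid[OF spin_group], of r] by simp

lemma inv_spin_eqI:
  assumes "g \<in> carrier (spin r)" "h \<in> carrier (spin r)" "g * h = 1\<^sub>m (2 ^ r)"
  shows "inv\<^bsub>spin r\<^esub> g = h"
proof -
  interpret group "spin r" by (rule spin_group)
  show ?thesis using inv_equality[of h g] inv_comm[of g h] assms by simp
qed

lemma inv_x_pos: "i \<in> {1..r} \<Longrightarrow> inv\<^bsub>spin r\<^esub> (x_pos r i t) = x_pos r i (- t)"
  by (rule inv_spin_eqI) (simp_all add: x_pos_inverse)

lemma inv_y_neg: "i \<in> {1..r} \<Longrightarrow> inv\<^bsub>spin r\<^esub> (y_neg r i t) = y_neg r i (- t)"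
  by (rule inv_spin_eqI) (simp_all add: y_neg_inverse)

text \<open>
The inverses in the definition of the generated subgroup are absorbed by
\<open>x\<^sub>i(t)\<^sup>-\<^sup>1 = x\<^sub>i(-t)\<close>, so that closure under products is all that has to be checked.
\<close>

lemma spin_induct [consumes 1, case_names one pos neg mult]:
  assumes "g \<in> carrier (spin r)"
    and "P (1\<^sub>m (2 ^ r))"
    and "\<And>i t. i \<in> {1..r} \<Longrightarrow> P (x_pos r i t)"
    and "\<And>i t. i \<in> {1..r} \<Longrightarrow> P (y_neg r i t)"
    and "\<And>g h. g \<in> carrier (spin r) \<Longrightarrow> h \<in> carrier (spin r) \<Longrightarrow> P g \<Longrightarrow> P h \<Longrightarrow> P (g * h)"
  shows "P g"
proof -
  let ?S = "{x_pos r i t | i t. i \<in> {1..r}} \<union> {y_neg r i t | i t. i \<in> {1..r}}"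
  have inv_eq: "inv\<^bsub>gl (2 ^ r)\<^esub> h = inv\<^bsub>spin r\<^esub> h" if "h \<in> ?S" for h
    unfolding spin_def using that
    by (intro group.m_inv_consistent[symmetric] gl_group group.generate_is_subgroup spin_gens_gl generate.incl)
  have "g \<in> generate (gl (2 ^ r)) ?S" using assms(1) by (simp add: spin_def)
  then show ?thesis
  proof (induction rule: generate.induct)
    case one then show ?case using assms(2) by simp
  next
    case (incl h) then show ?case using assms(3,4) by auto
  next
    case (inv h)
    then show ?case unfolding inv_eq[OF inv.hyps] using assms(3,4) by (auto simp: inv_x_pos inv_y_neg)
  next
    case (eng g h)
    then show ?case using assms(5)[of g h] by (simp add: spin_def)
  qed
qed

lemma N_pos_gens: "{x_pos r i t | i t. i \<in> {1..r}} \<subseteq> carrier (spin r)"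
  and N_neg_gens: "{y_neg r i t | i t. i \<in> {1..r}} \<subseteq> carrier (spin r)"
  by auto

lemma N_pos_induct [consumes 1, case_names one gen mult]:
  assumes "g \<in> N_pos r"
    and "P (1\<^sub>m (2 ^ r))"
    and "\<And>i t. i \<in> {1..r} \<Longrightarrow> P (x_pos r i t)"
    and "\<And>g h. g \<in> N_pos r \<Longrightarrow> h \<in> N_pos r \<Longrightarrow> P g \<Longrightarrow> P h \<Longrightarrow> P (g * h)"
  shows "P g"
  using assms(1) unfolding N_pos_def
proof (induction rule: generate.induct)
  case one then show ?case using assms(2) by simp
next
  case (incl h) then show ?case using assms(3) by auto
next
  case (inv h) then show ?case using assms(3) by (auto simp: inv_x_pos)
next
  case (eng g h) then show ?case using assms(4)[of g h] by (simp add: N_pos_def)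
qed

lemma N_neg_induct [consumes 1, case_names one gen mult]:
  assumes "g \<in> N_neg r"
    and "P (1\<^sub>m (2 ^ r))"
    and "\<And>i t. i \<in> {1..r} \<Longrightarrow> P (y_neg r i t)"
    and "\<And>g h. g \<in> N_neg r \<Longrightarrow> h \<in> N_neg r \<Longrightarrow> P g \<Longrightarrow> P h \<Longrightarrow> P (g * h)"
  shows "P g"
  using assms(1) unfolding N_neg_def
proof (induction rule: generate.induct)
  case one then show ?case using assms(2) by simp
next
  case (incl h) then show ?case using assms(3) by auto
next
  case (inv h) then show ?case using assms(3) by (auto simp: inv_y_neg)
next
  case (eng g h) then show ?case using assms(4)[of g h] by (simp add: N_neg_def)
qed

lemma N_pos_subgroup: "subgroup (N_pos r) (spin r)"
  and N_neg_subgroup: "subgroup (N_neg r) (spin r)"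
  unfolding N_pos_def N_neg_def
  by (intro group.generate_is_subgroup spin_group N_pos_gens N_neg_gens)+

lemma x_pos_N_pos [simp]: "i \<in> {1..r} \<Longrightarrow> x_pos r i t \<in> N_pos r"
  and y_neg_N_neg [simp]: "i \<in> {1..r} \<Longrightarrow> y_neg r i t \<in> N_neg r"
  by (auto simp: N_pos_def N_neg_def intro!: generate.incl)

lemma N_pos_spin [simp]: "g \<in> N_pos r \<Longrightarrow> g \<in> carrier (spin r)"
  and N_neg_spin [simp]: "g \<in> N_neg r \<Longrightarrow> g \<in> carrier (spin r)"
  using subgroup.subset[OF N_pos_subgroup] subgroup.subset[OF N_neg_subgroup] by auto

lemma N_pos_mult [simp]: "g \<in> N_pos r \<Longrightarrow> h \<in> N_pos r \<Longrightarrow> g * h \<in> N_pos r"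
  and N_neg_mult [simp]: "g \<in> N_neg r \<Longrightarrow> h \<in> N_neg r \<Longrightarrow> g * h \<in> N_neg r"
  using subgroup.m_closed[OF N_pos_subgroup] subgroup.m_closed[OF N_neg_subgroup] by fastforce+

lemma N_pos_one [simp]: "1\<^sub>m (2 ^ r) \<in> N_pos r"
  and N_neg_one [simp]: "1\<^sub>m (2 ^ r) \<in> N_neg r"
  using subgroup.one_closed[OF N_pos_subgroup, of r] subgroup.one_closed[OF N_neg_subgroup, of r] by simp_all

text \<open>
The torus is given by explicit diagonal matrices; that these belong to the generated group rests
on writing \<open>diag(u, 1/u)\<close> in \<open>SL\<^sub>2\<close> as a product of four elementary matrices.
\<close>

lemma coroot_elt_spin [simp]:
  assumes "i \<in> {1..r}" "u \<noteq> 0"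
  shows "coroot_elt r i u \<in> carrier (spin r)"
proof -
  have "coroot_elt r i u =
      y_neg r i (- inverse u) * (x_pos r i (u - 1) * (y_neg r i 1 * x_pos r i (inverse u - 1)))"
    using assms by (simp add: coroot_elt_eq y_neg_eq x_pos_eq sl2_blk_mult algebra_simps)
  then show ?thesis using assms by simp
qed

text \<open>
The Gauss decomposition in \<open>SL\<^sub>2\<close>. Its denominator is the only obstruction to reordering a product
into the form prescribed by \<open>G\<^sub>0\<close>.
\<close>

lemma x_pos_y_neg_same:
  assumes "i \<in> {1..r}" "1 + t * s \<noteq> 0"
  shows "x_pos r i t * y_neg r i s =
    y_neg r i (s / (1 + t * s)) * (coroot_elt r i (1 + t * s) * x_pos r i (t / (1 + t * s)))"
proof -
  have "s * t / (1 + t * s) + inverse (1 + t * s) = 1"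
    using assms(2) by (simp add: field_simps)
  then show ?thesis using assms by (simp add: coroot_elt_eq y_neg_eq x_pos_eq sl2_blk_mult)
qed

lemma ent_sl2_blk: "A \<subseteq> {1..r} \<Longrightarrow> B \<subseteq> {1..r}
    \<Longrightarrow> ent r (sl2_blk r i p q u v) A B = sl2_act r i p q u v (\<lambda>C. if C = B then 1 else 0) A"
  by (simp add: sl2_blk_def)

text \<open>
Corresponds to \<open>[e\<^sub>i, f\<^sub>j] = 0\<close>. Away from neighbouring letters the two moves involve disjoint sites; for
neighbours neither order of the two moves is ever possible.
\<close>

lemma x_pos_y_neg_commute:
  assumes i: "i \<in> {1..r}" and j: "j \<in> {1..r}" and "i \<noteq> j"
  shows "x_pos r i t * y_neg r j s = y_neg r j s * x_pos r i t"
proof -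
  have ax: "sl2_act r i 1 t 0 1 f A = f A + (if lowerable r i A then t * f (lowered i A) else 0)" for f A
    by (auto simp: sl2_act_def)
  have ay: "sl2_act r j 1 0 s 1 f A = f A + (if raisable r j A then s * f (raised r j A) else 0)" for f A
    using raisable_not_lowerable by (auto simp: sl2_act_def)
  show ?thesis
    unfolding x_pos_eq[OF i] y_neg_eq[OF j]
  proof (rule mat_eq_entI)
    fix A B assume AB: "A \<subseteq> {1..r}" "B \<subseteq> {1..r}"
    let ?d = "\<lambda>C. if C = B then 1 else 0 :: complex"
    have iff: "lowerable r i A \<and> raisable r j (lowered i A) \<longleftrightarrow> raisable r j A \<and> lowerable r i (raised r j A)"
      using i j AB(1) \<open>i \<noteq> j\<close>
      by (auto simp: lowerable_def raisable_def lowered_def raised_def)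
    have eq: "raised r j (lowered i A) = lowered i (raised r j A)" if "lowerable r i A" "raisable r j (lowered i A)"
      using that i j AB(1) \<open>i \<noteq> j\<close>
      by (auto simp: lowerable_def raisable_def lowered_def raised_def)
    have comm: "sl2_act r i 1 t 0 1 (sl2_act r j 1 0 s 1 f) A = sl2_act r j 1 0 s 1 (sl2_act r i 1 t 0 1 f) A" for f
    proof (cases "lowerable r i A \<and> raisable r j (lowered i A)")
      case True
      then show ?thesis using iff eq unfolding ax ay by (simp add: algebra_simps)
    next
      case False
      then show ?thesis using iff unfolding ax ay by auto
    qed
    have "ent r (sl2_blk r i 1 t 0 1 * sl2_blk r j 1 0 s 1) A B = sl2_act r i 1 t 0 1 (sl2_act r j 1 0 s 1 ?d) A"
      using i j AB lowered_subset[OF i AB(1)] by (simp add: ent_sl2_blk_mult ent_sl2_blk ax)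
    also have "\<dots> = sl2_act r j 1 0 s 1 (sl2_act r i 1 t 0 1 ?d) A" by (rule comm)
    also have "\<dots> = ent r (sl2_blk r j 1 0 s 1 * sl2_blk r i 1 t 0 1) A B"
      using i j AB raised_subset[OF j AB(1)] by (simp add: ent_sl2_blk_mult ent_sl2_blk ay)
    finally show "ent r (sl2_blk r i 1 t 0 1 * sl2_blk r j 1 0 s 1) A B = ent r (sl2_blk r j 1 0 s 1 * sl2_blk r i 1 t 0 1) A B" .
  qed simp_all
qed

section \<open>The torus\<close>

definition set_diag :: "nat \<Rightarrow> (nat set \<Rightarrow> complex) \<Rightarrow> complex mat" where
  "set_diag r c = set_mat r (\<lambda>A B. if A = B then c A else 0)"

lemma set_diag_sq [simp]: "set_diag r c \<in> sq r"
  by (simp add: set_diag_def)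

lemma ent_set_diag: "A \<subseteq> {1..r} \<Longrightarrow> B \<subseteq> {1..r} \<Longrightarrow> ent r (set_diag r c) A B = (if A = B then c A else 0)"
  by (simp add: set_diag_def)

lemma ent_set_diag_mult:
  assumes "M \<in> sq r" "A \<subseteq> {1..r}" "B \<subseteq> {1..r}"
  shows "ent r (set_diag r c * M) A B = c A * ent r M A B"
proof -
  have "ent r (set_diag r c * M) A B = (\<Sum>C\<in>Pow {1..r}. if C = A then c A * ent r M A B else 0)"
    unfolding ent_mult[OF set_diag_sq assms] using assms by (intro sum.cong) (auto simp: ent_set_diag)
  then show ?thesis using assms by simp
qed

lemma ent_mult_set_diag:
  assumes "M \<in> sq r" "A \<subseteq> {1..r}" "B \<subseteq> {1..r}"
  shows "ent r (M * set_diag r c) A B = ent r M A B * c B"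
proof -
  have "ent r (M * set_diag r c) A B = (\<Sum>C\<in>Pow {1..r}. if C = B then ent r M A B * c B else 0)"
    unfolding ent_mult[OF assms(1) set_diag_sq assms(2,3)] using assms by (intro sum.cong) (auto simp: ent_set_diag)
  then show ?thesis using assms by simp
qed

lemma set_diag_mult: "set_diag r c * set_diag r d = set_diag r (\<lambda>A. c A * d A)"
  by (rule mat_eq_entI[of _ r]) (simp_all add: ent_set_diag_mult ent_set_diag)

lemma set_diag_one: "set_diag r (\<lambda>A. 1) = 1\<^sub>m (2 ^ r)"
  by (rule mat_eq_entI[of _ r]) (simp_all add: ent_set_diag ent_one)

lemma gprod_Nil [simp]: "gprod G [] = \<one>\<^bsub>G\<^esub>"
  and gprod_Cons [simp]: "gprod G (x # xs) = x \<otimes>\<^bsub>G\<^esub> gprod G xs"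
  by (simp_all add: gprod_def)

definition torus_char :: "nat \<Rightarrow> (nat \<Rightarrow> complex) \<Rightarrow> nat set \<Rightarrow> complex" where
  "torus_char r t A = (\<Prod>j\<in>{1..r}. t j powi hweight r j A)"

lemma torus_elt_eq: "torus_elt r t = set_diag r (torus_char r t)"
proof -
  have "gprod (spin r) (map (\<lambda>j. coroot_elt r j (t j)) js) =
      set_diag r (\<lambda>A. prod_list (map (\<lambda>j. t j powi hweight r j A) js))" if "set js \<subseteq> {1..r}" for js
    using that by (induction js) (auto simp: set_diag_one set_diag_mult coroot_elt_diag simp flip: set_diag_def)
  from this[of "[1..<Suc r]"]
  have "torus_elt r t = set_diag r (\<lambda>A. prod_list (map (\<lambda>j. t j powi hweight r j A) [1..<Suc r]))"
    by (simp add: torus_elt_def atLeastLessThanSuc_atLeastAtMost del: upt_Suc)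
  also have "(\<lambda>A. prod_list (map (\<lambda>j. t j powi hweight r j A) [1..<Suc r])) = torus_char r t"
    by (rule ext) (simp only: prod.distinct_set_conv_list[OF distinct_upt, symmetric] set_upt
        torus_char_def atLeastLessThanSuc_atLeastAtMost)
  finally show ?thesis .
qed

lemma torus_char_nonzero: "(\<forall>j. t j \<noteq> 0) \<Longrightarrow> torus_char r t A \<noteq> 0"
  by (simp add: torus_char_def)

lemma torus_elt_mult: "torus_elt r t * torus_elt r u = torus_elt r (\<lambda>j. t j * u j)"
  by (simp add: torus_elt_eq set_diag_mult torus_char_def[abs_def] power_int_mult_distrib prod.distrib)

lemma torus_mult [simp]: "g \<in> torus r \<Longrightarrow> h \<in> torus r \<Longrightarrow> g * h \<in> torus r"
  by (force simp: torus_def torus_elt_mult)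

lemma torus_one [simp]: "1\<^sub>m (2 ^ r) \<in> torus r"
proof -
  have "1\<^sub>m (2 ^ r) = torus_elt r (\<lambda>_. 1)"
    by (simp add: torus_elt_eq torus_char_def[abs_def] set_diag_one)
  then show ?thesis by (auto simp: torus_def)
qed

lemma torus_sq [simp]: "h \<in> torus r \<Longrightarrow> h \<in> sq r"
  by (auto simp: torus_def torus_elt_eq)

lemma coroot_elt_torus [simp]:
  assumes "i \<in> {1..r}" "u \<noteq> 0"
  shows "coroot_elt r i u \<in> torus r"
proof -
  have "torus_char r ((\<lambda>_. 1)(i := u)) A = u powi hweight r i A" for A
    using assms by (simp add: torus_char_def if_distrib[of "\<lambda>x. x powi _"] prod.delta cong: if_cong)
  then have "coroot_elt r i u = torus_elt r ((\<lambda>_. 1)(i := u))"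
    using assms by (simp add: coroot_elt_diag torus_elt_eq set_diag_def cong: if_cong)
  then show ?thesis using assms by (auto simp: torus_def)
qed

lemma torus_spin [simp]:
  assumes "h \<in> torus r" shows "h \<in> carrier (spin r)"
proof -
  from assms obtain t where t: "\<forall>j. t j \<noteq> 0" "h = torus_elt r t" by (auto simp: torus_def)
  have "gprod (spin r) (map (\<lambda>j. coroot_elt r j (t j)) js) \<in> carrier (spin r)" if "set js \<subseteq> {1..r}" for js
    using that t(1) by (induction js) auto
  from this[of "[1..<Suc r]"] show ?thesis unfolding t(2) torus_elt_def by (simp add: atLeastLessThanSuc_atLeastAtMost del: upt_Suc)
qed

text \<open>
The change of the \<open>h\<^sub>j\<close>-weight under \<open>f\<^sub>i\<close>, that is, minus the Cartan integer \<open>\<alpha>\<^sub>i(h\<^sub>j)\<close>.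
\<close>

definition cartan :: "nat \<Rightarrow> nat \<Rightarrow> nat \<Rightarrow> int" where
  "cartan r j i = (if j = r then (if i = r then -2 else if Suc i = r then 2 else 0)
     else if j = i then -2 else if Suc j = i \<or> j = Suc i then 1 else 0)"

lemma hweight_eq:
  "hweight r j A = (if j = r then if r \<in> A then -1 else 1
     else (if Suc j \<in> A then 1 else 0) - (if j \<in> A then 1 else 0))"
  by (simp add: hweight_def lowerable_def raisable_def)

lemma hweight_lowered:
  assumes "i \<in> {1..r}" "j \<in> {1..r}" "A \<subseteq> {1..r}" "lowerable r i A"
  shows "hweight r j (lowered i A) = hweight r j A + cartan r j i"
proof -
  have "i \<notin> A" "i = r \<and> Suc i \<notin> A \<or> i \<noteq> r \<and> Suc i \<in> A"
    using assms by (auto simp: lowerable_def)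
  then show ?thesis
    using assms(1,2) unfolding hweight_eq cartan_def lowered_def
    by (cases "j = r"; cases "j = i"; cases "j = Suc i"; cases "Suc j = i") auto
qed

text \<open>
The ratio \<open>z\<close> is the inverse of the value of the root \<open>\<alpha>\<^sub>i\<close> at \<open>h\<close>. That it is the same for all weights
is what lets the torus normalise the one-parameter subgroups.
\<close>

lemma torus_root:
  assumes "h \<in> torus r" "i \<in> {1..r}"
  shows "\<exists>c z. h = set_diag r c \<and>
    (\<forall>A. A \<subseteq> {1..r} \<longrightarrow> lowerable r i A \<longrightarrow> c (lowered i A) = z * c A)"
proof -
  from assms obtain t where t: "\<forall>j. t j \<noteq> 0" "h = torus_elt r t" by (auto simp: torus_def)
  define z where "z = (\<Prod>j\<in>{1..r}. t j powi cartan r j i)"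
  show ?thesis
  proof (intro exI[of _ "torus_char r t"] exI[of _ z] conjI allI impI)
    fix A assume A: "A \<subseteq> {1..r}" "lowerable r i A"
    show "torus_char r t (lowered i A) = z * torus_char r t A"
      unfolding torus_char_def z_def prod.distrib[symmetric]
      using hweight_lowered[OF assms(2) _ A] t(1)
      by (intro prod.cong) (auto simp: power_int_add)
  qed (use t torus_elt_eq in auto)
qed

lemma torus_y_neg:
  assumes "h \<in> torus r" "i \<in> {1..r}"
  shows "\<exists>s'. h * y_neg r i s = y_neg r i s' * h"
proof -
  obtain c z where *: "h = set_diag r c"
    "\<And>A. A \<subseteq> {1..r} \<Longrightarrow> lowerable r i A \<Longrightarrow> c (lowered i A) = z * c A"
    using torus_root[OF assms] by auto
  have "h * y_neg r i s = y_neg r i (z * s) * h"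
  proof (rule mat_eq_entI[of _ r])
    fix A B assume AB: "A \<subseteq> {1..r}" "B \<subseteq> {1..r}"
    have "c A = z * c (raised r i A)" if "raisable r i A"
      using *(2)[OF raised_subset[OF assms(2) AB(1)] lowerable_raised[OF assms(2) that]]
        lowered_raised[OF assms(2) AB(1) that] by simp
    then show "ent r (h * y_neg r i s) A B = ent r (y_neg r i (z * s) * h) A B"
      using AB assms(2) raisable_not_lowerable[of r i A] unfolding *(1)
      by (simp add: ent_set_diag_mult ent_mult_set_diag y_neg_eq) (auto simp: sl2_blk_def sl2_act_def)
  qed (use assms in \<open>auto simp: y_neg_eq\<close>)
  then show ?thesis ..
qed

lemma x_pos_torus:
  assumes "h \<in> torus r" "i \<in> {1..r}"
  shows "\<exists>s'. x_pos r i s * h = h * x_pos r i s'"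
proof -
  obtain c z where *: "h = set_diag r c"
    "\<And>A. A \<subseteq> {1..r} \<Longrightarrow> lowerable r i A \<Longrightarrow> c (lowered i A) = z * c A"
    using torus_root[OF assms] by auto
  have "x_pos r i s * h = h * x_pos r i (z * s)"
  proof (rule mat_eq_entI[of _ r])
    fix A B assume AB: "A \<subseteq> {1..r}" "B \<subseteq> {1..r}"
    show "ent r (x_pos r i s * h) A B = ent r (h * x_pos r i (z * s)) A B"
      using AB assms(2) *(2)[OF AB(1)] unfolding *(1)
      by (simp add: ent_set_diag_mult ent_mult_set_diag x_pos_eq) (auto simp: sl2_blk_def sl2_act_def)
  qed (use assms in \<open>auto simp: x_pos_eq\<close>)
  then show ?thesis ..
qed

lemma torus_one_commute: "h \<in> torus r \<Longrightarrow> h * 1\<^sub>m (2 ^ r) = 1\<^sub>m (2 ^ r) * h"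
  by (simp add: sq_one_left[of _ r] sq_one_right[of _ r])

lemma torus_N_neg:
  assumes "a \<in> N_neg r" "h \<in> torus r"
  shows "\<exists>a'\<in>N_neg r. h * a = a' * h"
  using assms(1)
proof (induction rule: N_neg_induct)
  case one then show ?case using torus_one_commute[OF assms(2)] by (intro bexI[of _ "1\<^sub>m (2 ^ r)"]) auto
next
  case (gen i t) then show ?case using torus_y_neg[OF assms(2)] y_neg_N_neg by metis
next
  case (mult a b)
  then obtain a' b' where *: "a' \<in> N_neg r" "h * a = a' * h" "b' \<in> N_neg r" "h * b = b' * h" by auto
  have sq: "h \<in> sq r" "a \<in> sq r" "b \<in> sq r" "a' \<in> sq r" "b' \<in> sq r"
    using * mult assms(2) by auto
  have "h * (a * b) = h * a * b" by (rule sq_assoc[symmetric]) (use sq in auto)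
  also have "\<dots> = a' * (h * b)" unfolding *(2) by (rule sq_assoc) (use sq in auto)
  also have "\<dots> = a' * b' * h" unfolding *(4) by (rule sq_assoc[symmetric]) (use sq in auto)
  finally show ?case using * by (intro bexI[of _ "a' * b'"]) auto
qed

lemma N_pos_torus:
  assumes "b \<in> N_pos r" "h \<in> torus r"
  shows "\<exists>b'\<in>N_pos r. b * h = h * b'"
  using assms(1)
proof (induction rule: N_pos_induct)
  case one then show ?case using torus_one_commute[OF assms(2)] by (intro bexI[of _ "1\<^sub>m (2 ^ r)"]) auto
next
  case (gen i t) then show ?case using x_pos_torus[OF assms(2)] x_pos_N_pos by metis
next
  case (mult a b)
  then obtain a' b' where *: "a' \<in> N_pos r" "a * h = h * a'" "b' \<in> N_pos r" "b * h = h * b'" by auto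
  have sq: "h \<in> sq r" "a \<in> sq r" "b \<in> sq r" "a' \<in> sq r" "b' \<in> sq r"
    using * mult assms(2) by auto
  have "a * b * h = a * (b * h)" by (rule sq_assoc) (use sq in auto)
  also have "\<dots> = a * h * b'" unfolding *(4) by (rule sq_assoc[symmetric]) (use sq in auto)
  also have "\<dots> = h * (a' * b')" unfolding *(2) by (rule sq_assoc) (use sq in auto)
  finally show ?case using * by (intro bexI[of _ "a' * b'"]) auto
qed

section \<open>Uniqueness in the Gauss decomposition\<close>

text \<open>
The height of the difference to the highest weight: \<open>\<epsilon>\<^sub>d = \<alpha>\<^sub>d + ... + \<alpha>\<^sub>r\<close> has height \<open>r + 1 - d\<close>.
\<close>

definition height :: "nat \<Rightarrow> nat set \<Rightarrow> nat" where
  "height r A = (\<Sum>d\<in>A. Suc r - d)"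

lemma height_lowered:
  assumes "i \<in> {1..r}" "A \<subseteq> {1..r}" "lowerable r i A"
  shows "height r (lowered i A) = Suc (height r A)"
proof -
  have fin: "finite A" using assms(2) finite_subset by blast
  have low: "height r (lowered i A) = (Suc r - i) + height r (A - {Suc i})"
    unfolding height_def lowered_def using fin assms(3) by (subst sum.insert) (auto simp: lowerable_def)
  show ?thesis
  proof (cases "i = r")
    case True
    then have "A - {Suc i} = A" using assms(2) by auto
    then show ?thesis using low True by simp
  next
    case False
    then have "Suc i \<in> A" using assms(3) by (simp add: lowerable_def)
    then have "height r A = (r - i) + height r (A - {Suc i})"
      using sum.remove[OF fin, of "Suc i" "\<lambda>d. Suc r - d"] unfolding height_def by (metis diff_Suc_Suc)
    then show ?thesis using low assms(1) False by simp arith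
  qed
qed

text \<open>
With \<open>L\<close> the order \<open><\<close> on heights these are the upper, with \<open>>\<close> the lower unitriangular matrices.
\<close>

definition unitri :: "nat \<Rightarrow> (nat \<Rightarrow> nat \<Rightarrow> bool) \<Rightarrow> complex mat set" where
  "unitri r L = {M \<in> sq r. \<forall>A B. A \<subseteq> {1..r} \<longrightarrow> B \<subseteq> {1..r} \<longrightarrow> ent r M A A = 1 \<and>
      (ent r M A B \<noteq> 0 \<longrightarrow> A = B \<or> L (height r A) (height r B))}"

lemma unitri_off_diag: "M \<in> unitri r L \<Longrightarrow> ent r M A B \<noteq> 0 \<Longrightarrow> A \<subseteq> {1..r} \<Longrightarrow> B \<subseteq> {1..r}
    \<Longrightarrow> A = B \<or> L (height r A) (height r B)"
  and unitri_diag: "M \<in> unitri r L \<Longrightarrow> A \<subseteq> {1..r} \<Longrightarrow> ent r M A A = 1"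
  and unitri_sq: "M \<in> unitri r L \<Longrightarrow> M \<in> sq r"
  unfolding unitri_def by blast+

lemma unitri_one: "1\<^sub>m (2 ^ r) \<in> unitri r L"
  by (auto simp: unitri_def ent_one split: if_splits)

lemma unitri_mult:
  assumes "transp L" "\<And>x. \<not> L x x" "M \<in> unitri r L" "N \<in> unitri r L"
  shows "M * N \<in> unitri r L"
proof -
  have sq: "M \<in> sq r" "N \<in> sq r" using assms(3,4) by (auto intro: unitri_sq)
  have nz: "A = B \<or> L (height r A) (height r B)"
    if "ent r (M * N) A B \<noteq> 0" "A \<subseteq> {1..r}" "B \<subseteq> {1..r}" for A B
  proof -
    have "(\<Sum>C\<in>Pow {1..r}. ent r M A C * ent r N C B) \<noteq> 0"
      using that(1) by (simp add: ent_mult[OF sq that(2,3)])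
    then obtain C where C: "C \<subseteq> {1..r}" "ent r M A C * ent r N C B \<noteq> 0"
      using sum.not_neutral_contains_not_neutral[of "\<lambda>C. ent r M A C * ent r N C B" "Pow {1..r}"] by auto
    have "A = C \<or> L (height r A) (height r C)" "C = B \<or> L (height r C) (height r B)"
      using unitri_off_diag[OF assms(3)] unitri_off_diag[OF assms(4)] C that(2,3) by auto
    then show ?thesis using transpD[OF assms(1)] by blast
  qed
  have "ent r (M * N) A A = 1" if A: "A \<subseteq> {1..r}" for A
  proof -
    have *: "ent r M A C * ent r N C A = (if C = A then 1 else 0)" if "C \<subseteq> {1..r}" for C
    proof (cases "C = A")
      case True then show ?thesis using unitri_diag[OF assms(3) A] unitri_diag[OF assms(4) A] by simp
    next
      case False
      have "ent r M A C = 0 \<or> ent r N C A = 0"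
        using unitri_off_diag[OF assms(3) _ A that] unitri_off_diag[OF assms(4) _ that A] False
          transpD[OF assms(1)] assms(2) by blast
      then show ?thesis using False by auto
    qed
    have "ent r (M * N) A A = (\<Sum>C\<in>Pow {1..r}. if C = A then 1 else 0)"
      unfolding ent_mult[OF sq A A] using * by (intro sum.cong) auto
    then show ?thesis using A by simp
  qed
  then show ?thesis using nz sq by (simp add: unitri_def)
qed

lemma unitriI:
  assumes "M \<in> sq r" "\<And>A. A \<subseteq> {1..r} \<Longrightarrow> ent r M A A = 1"
    and "\<And>A B. ent r M A B \<noteq> 0 \<Longrightarrow> A \<noteq> B \<Longrightarrow> A \<subseteq> {1..r} \<Longrightarrow> B \<subseteq> {1..r} \<Longrightarrow> L (height r A) (height r B)"
  shows "M \<in> unitri r L"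
  unfolding unitri_def using assms by blast

lemma N_pos_unitri: "b \<in> N_pos r \<Longrightarrow> b \<in> unitri r (<)"
proof (induction rule: N_pos_induct)
  case (gen i t)
  have ne: "lowered i A \<noteq> A" if "lowerable r i A" for A
    using that by (auto simp: lowerable_def lowered_def)
  show ?case
  proof (rule unitriI)
    fix A B assume "ent r (x_pos r i t) A B \<noteq> 0" "A \<noteq> B" and AB: "A \<subseteq> {1..r}" "B \<subseteq> {1..r}"
    then have "lowerable r i A" "B = lowered i A"
      using gen by (simp_all add: x_pos_eq ent_sl2_blk sl2_act_def split: if_splits)
    then show "height r A < height r B" using height_lowered[OF gen AB(1)] by simp
  qed (use gen ne in \<open>simp_all add: x_pos_eq ent_sl2_blk sl2_act_def\<close>)
next
  case (mult g h)
  show ?case using mult.IH by (rule unitri_mult[OF transp_on_less less_irrefl])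
qed (rule unitri_one)

lemma N_neg_unitri: "a \<in> N_neg r \<Longrightarrow> a \<in> unitri r (>)"
proof (induction rule: N_neg_induct)
  case (gen i t)
  have ne: "raised r i A \<noteq> A" if "raisable r i A" for A
    using that by (auto simp: raisable_def raised_def)
  show ?case
  proof (rule unitriI)
    fix A B assume "ent r (y_neg r i t) A B \<noteq> 0" "A \<noteq> B" and AB: "A \<subseteq> {1..r}" "B \<subseteq> {1..r}"
    then have *: "raisable r i A" "B = raised r i A"
      using gen by (simp_all add: y_neg_eq ent_sl2_blk sl2_act_def split: if_splits)
    show "height r B < height r A"
      using height_lowered[OF gen AB(2)] lowerable_raised[OF gen *(1)] lowered_raised[OF gen AB(1) *(1)] *(2) by simp
  qed (use gen ne raisable_not_lowerable in \<open>simp_all add: y_neg_eq ent_sl2_blk sl2_act_def\<close>)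
next
  case (mult g h)
  show ?case using mult.IH by (rule unitri_mult[OF transp_on_greater less_irrefl])
qed (rule unitri_one)

lemma torus_set_diag:
  assumes "h \<in> torus r"
  shows "\<exists>c. h = set_diag r c \<and> (\<forall>A. c A \<noteq> 0)"
proof -
  from assms obtain t where "\<forall>j. t j \<noteq> 0" "h = torus_elt r t" by (auto simp: torus_def)
  then show ?thesis using torus_char_nonzero[of t r] torus_elt_eq[of r t] by blast
qed

text \<open>
From \<open>a h b = a' h' b'\<close> one gets \<open>(a'\<^sup>-\<^sup>1 a) h = h' (b' b\<^sup>-\<^sup>1)\<close>, a lower triangular matrix with the
diagonal of \<open>h\<close> which is also upper triangular with the diagonal of \<open>h'\<close>.
\<close>

lemma gauss_torus_unique:
  assumes "a \<in> N_neg r" "h \<in> torus r" "b \<in> N_pos r"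
    and "a' \<in> N_neg r" "h' \<in> torus r" "b' \<in> N_pos r"
    and eq: "a * h * b = a' * h' * b'"
  shows "h = h'"
proof -
  interpret group "spin r" by (rule spin_group)
  define a1 where "a1 = inv\<^bsub>spin r\<^esub> a' * a"
  define b1 where "b1 = b' * inv\<^bsub>spin r\<^esub> b"
  have a1: "a1 \<in> N_neg r" "b1 \<in> N_pos r"
    using assms subgroup.m_inv_closed[OF N_neg_subgroup, of a' r] subgroup.m_inv_closed[OF N_pos_subgroup, of b r]
    by (auto simp: a1_def b1_def)
  have inG: "a \<in> carrier (spin r)" "h \<in> carrier (spin r)" "b \<in> carrier (spin r)"
    "a' \<in> carrier (spin r)" "h' \<in> carrier (spin r)" "b' \<in> carrier (spin r)"
    using assms by auto
  have "a1 * h = h' * b1"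
  proof -
    define A B where "A = inv\<^bsub>spin r\<^esub> a'" and "B = inv\<^bsub>spin r\<^esub> b"
    have sq: "a \<in> sq r" "h \<in> sq r" "b \<in> sq r" "a' \<in> sq r" "h' \<in> sq r" "b' \<in> sq r" "A \<in> sq r" "B \<in> sq r"
      using inG by (simp_all add: A_def B_def)
    have AB: "A * a' = 1\<^sub>m (2 ^ r)" "b * B = 1\<^sub>m (2 ^ r)"
      using l_inv[OF inG(4)] r_inv[OF inG(3)] by (simp_all add: A_def B_def)
    have "a1 * h = A * (a * (h * (b * B)))"
      using sq by (simp add: a1_def AB(2) sq_one_right[of _ r] sq_assoc[of _ r] flip: A_def)
    also have "\<dots> = A * ((a * h * b) * B)" using sq by (simp add: sq_assoc[of _ r])
    also have "\<dots> = (A * a') * (h' * (b' * B))" unfolding eq using sq by (simp add: sq_assoc[of _ r])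
    also have "\<dots> = h' * b1" unfolding AB b1_def B_def[symmetric]
      by (rule sq_one_left[of _ r]) (use sq in simp)
    finally show ?thesis .
  qed
  moreover obtain c c' where c: "h = set_diag r c" "h' = set_diag r c'"
    using torus_set_diag[OF assms(2)] torus_set_diag[OF assms(5)] by blast
  moreover have "c A = c' A" if A: "A \<subseteq> {1..r}" for A
  proof -
    have "ent r (a1 * h) A A = c A" "ent r (h' * b1) A A = c' A"
      using c A unitri_diag[OF N_neg_unitri[OF a1(1)] A] unitri_diag[OF N_pos_unitri[OF a1(2)] A]
        unitri_sq[OF N_neg_unitri[OF a1(1)]] unitri_sq[OF N_pos_unitri[OF a1(2)]]
      by (simp_all add: ent_mult_set_diag ent_set_diag_mult)
    then show ?thesis using \<open>a1 * h = h' * b1\<close> by simp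
  qed
  ultimately show ?thesis
    by (intro mat_eq_entI[of _ r]) (auto simp: ent_set_diag)
qed

lemma G0_iff: "x \<in> G0 r \<longleftrightarrow> (\<exists>a\<in>N_neg r. \<exists>h\<in>torus r. \<exists>b\<in>N_pos r. x = a * h * b)"
  by (auto simp: G0_def set_mult_def)

lemma torus_part_eq:
  assumes "a \<in> N_neg r" "h \<in> torus r" "b \<in> N_pos r"
  shows "torus_part r (a * h * b) = h"
  unfolding torus_part_def
  using assms gauss_torus_unique[of _ r] by (intro the_equality) auto

lemma hweight_empty: "i \<in> {1..r} \<Longrightarrow> hweight r i {} = (if i = r then 1 else 0)"
  by (simp add: hweight_eq)

lemma torus_entry: "1 \<le> r \<Longrightarrow> ent r (torus_elt r t) {} {} = t r"
  by (simp add: torus_elt_eq ent_set_diag torus_char_def hweight_empty if_distrib[of "\<lambda>x. _ powi x"] prod.delta' cong: if_cong)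

lemma fund_char_last:
  assumes "h \<in> torus r" "1 \<le> r"
  shows "fund_char r r h = ent r h {} {}"
  using assms torus_entry[OF assms(2)] unfolding fund_char_def torus_def
  by (intro the_equality) auto

text \<open>
In the product \<open>a h b\<close> only the corner of \<open>h\<close> reaches the corner entry, and this entry of a torus element
is its coordinate \<open>t\<^sub>r\<close>, because \<open>\<Lambda>\<^sub>r\<close> is the highest weight of the spin representation.
\<close>

lemma gauss_entry:
  assumes "x \<in> G0 r" "1 \<le> r"
  shows "fund_char r r (torus_part r x) = ent r x {} {}"
proof -
  from assms obtain a h b where *: "a \<in> N_neg r" "h \<in> torus r" "b \<in> N_pos r" "x = a * h * b"
    by (auto simp: G0_iff)
  obtain c where c: "h = set_diag r c" using torus_set_diag[OF *(2)] by blast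
  have e: "{} \<subseteq> {1..r}" by simp
  have ah: "a * h \<in> sq r" using *(1,2) by simp
  have "ent r x {} {} = (\<Sum>C\<in>Pow {1..r}. ent r (a * h) {} C * ent r b C {})"
    unfolding *(4) by (rule ent_mult[OF ah _ e e]) (use * in auto)
  also have "\<dots> = (\<Sum>C\<in>Pow {1..r}. if C = {} then c {} else 0)"
  proof (rule sum.cong)
    fix C assume "C \<in> Pow {1..r}"
    then have C: "C \<subseteq> {1..r}" by simp
    show "ent r (a * h) {} C * ent r b C {} = (if C = {} then c {} else 0)"
      using unitri_off_diag[OF N_neg_unitri[OF *(1)] _ e C] unitri_diag[OF N_neg_unitri[OF *(1)] e]
        unitri_diag[OF N_pos_unitri[OF *(3)] e] C e *(1) unfolding c
      by (auto simp: ent_mult_set_diag height_def)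
  qed simp
  also have "\<dots> = ent r h {} {}" by (simp add: c ent_set_diag)
  finally show ?thesis using * assms(2) by (simp add: torus_part_eq fund_char_last)
qed

section \<open>Zariski density of the big cell\<close>

lemma x_pos_affine: "i \<in> {1..r} \<Longrightarrow> x_pos r i t = 1\<^sub>m (2 ^ r) + t \<cdot>\<^sub>m chev_e r i"
  by (rule mat_eq_entI[of _ r])
    (auto simp: x_pos_eq ent_sl2_blk sl2_act_def ent_add ent_one ent_smult ent_chev_e)

text \<open>
Density is proved by restricting regular functions to the lines \<open>t \<mapsto> W x\<^sub>j(t) x\<close>, on which they
become polynomials in one variable.
\<close>

lemma mat_poly_fun_line:
  assumes "p \<in> mat_poly_fun n" "M \<in> carrier_mat n n" "E \<in> carrier_mat n n"
  shows "\<exists>q. \<forall>t. poly q t = p (M + t \<cdot>\<^sub>m E)"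
  using assms(1)
proof induction
  case (const c) then show ?case by (intro exI[of _ "[:c:]"]) simp
next
  case (entry a b)
  then show ?case using assms(2,3) by (intro exI[of _ "[:M $$ (a, b), E $$ (a, b):]"]) auto
next
  case (add p1 p2)
  then obtain q1 q2 where "\<forall>t. poly q1 t = p1 (M + t \<cdot>\<^sub>m E)" "\<forall>t. poly q2 t = p2 (M + t \<cdot>\<^sub>m E)" by blast
  then show ?case by (intro exI[of _ "q1 + q2"]) simp
next
  case (mult p1 p2)
  then obtain q1 q2 where "\<forall>t. poly q1 t = p1 (M + t \<cdot>\<^sub>m E)" "\<forall>t. poly q2 t = p2 (M + t \<cdot>\<^sub>m E)" by blast
  then show ?case by (intro exI[of _ "q1 * q2"]) simp
qed

lemma poly_zero_near_0:
  fixes q :: "complex poly"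
  assumes "e > 0" "\<And>t. norm t < e \<Longrightarrow> poly q t = 0"
  shows "q = 0"
proof (rule ccontr)
  assume "q \<noteq> 0"
  then have "finite {t. poly q t = 0}" by (rule poly_roots_finite)
  moreover have "complex_of_real ` {0<..<e} \<subseteq> {t. poly q t = 0}" using assms(2) by auto
  ultimately have "finite (complex_of_real ` {0<..<e})" by (rule finite_subset[rotated])
  then have "finite {0<..<e}" by (rule finite_imageD) (simp add: inj_on_def)
  then show False using assms(1) by (simp add: infinite_Ioo)
qed

text \<open>
The bound \<open>d\<close> on the new parameter is what makes the argument below compose over products.
\<close>

abbreviation carried_through :: "nat \<Rightarrow> nat \<Rightarrow> real \<Rightarrow> complex \<Rightarrow> complex mat \<Rightarrow> bool" where
  "carried_through r j d t a \<equiv> \<exists>a'\<in>N_neg r. \<exists>h\<in>torus r. \<exists>t'. norm t' < d \<and>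
    x_pos r j t * a = a' * (h * x_pos r j t')"

text \<open>
For small \<open>t\<close> the factor \<open>x\<^sub>j(t)\<close> can be carried through a product of elements \<open>y\<^sub>i(s)\<close> from left to right:
it commutes with \<open>y\<^sub>i(s)\<close> for \<open>i \<noteq> j\<close>, and for \<open>i = j\<close> the Gauss decomposition in \<open>SL\<^sub>2\<close> replaces \<open>t\<close> by
\<open>t / (1 + t s)\<close>, where the denominator stays away from 0.
\<close>

lemma x_pos_N_neg:
  assumes "a \<in> N_neg r" "j \<in> {1..r}" "d > 0"
  shows "\<exists>e>0. \<forall>t. norm t < e \<longrightarrow> carried_through r j d t a"
  using assms(1,3)
proof (induction arbitrary: d rule: N_neg_induct)
  case one
  have "x_pos r j t * 1\<^sub>m (2 ^ r) = 1\<^sub>m (2 ^ r) * (1\<^sub>m (2 ^ r) * x_pos r j t)" for t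
    using assms(2) by (simp add: sq_one_left[of _ r] sq_one_right[of _ r])
  then show ?case using N_neg_one torus_one one by metis
next
  case (gen i s)
  show ?case
  proof (cases "i = j")
    case False
    have "x_pos r j t * y_neg r i s = y_neg r i s * (1\<^sub>m (2 ^ r) * x_pos r j t)" for t
      using x_pos_y_neg_commute[of j r i t s] gen assms(2) False
      by (simp add: sq_one_left[of _ r])
    then show ?thesis using torus_one y_neg_N_neg[OF gen(1)] gen(2) by metis
  next
    case True
    \<comment> \<open>The second bound keeps \<open>1 + t s\<close> at distance at least 1/2 from 0, so that the new parameter is at most \<open>2 \<bar>t\<bar>\<close>.\<close>
    define e where "e = min (d / 2) (1 / (2 * (1 + norm s)))"
    have pos: "0 < 1 + norm s" using norm_ge_zero[of s] by linarith
    have "e > 0" using gen(2) pos by (simp add: e_def)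
    moreover have "carried_through r j d t (y_neg r i s)" if t: "norm t < e" for t
    proof -
      have "norm (t * s) \<le> norm t * (1 + norm s)" by (simp add: norm_mult algebra_simps)
      also have "\<dots> \<le> 1 / (2 * (1 + norm s)) * (1 + norm s)"
        using t pos by (intro mult_right_mono) (auto simp: e_def)
      also have "\<dots> = 1 / 2" using pos by simp
      finally have ts: "norm (t * s) \<le> 1 / 2" .
      have "1 \<le> norm (1 + t * s) + norm (t * s)"
        using norm_triangle_ineq4[of "1 + t * s" "t * s"] by simp
      then have u: "1 / 2 \<le> norm (1 + t * s)" using ts by linarith
      then have nz: "1 + t * s \<noteq> 0" by auto
      have "norm (t / (1 + t * s)) \<le> norm t / (1 / 2)"
        unfolding norm_divide using u by (intro divide_left_mono) auto
      also have "\<dots> < d" using t by (simp add: e_def)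
      finally have "norm (t / (1 + t * s)) < d" .
      then show ?thesis
        using x_pos_y_neg_same[OF assms(2) nz] True assms(2) nz coroot_elt_torus y_neg_N_neg by metis
    qed
    ultimately show ?thesis by blast
  qed
next
  case (mult a b)
  obtain e1 where e1: "e1 > 0" "\<And>t. norm t < e1 \<Longrightarrow> carried_through r j d t b" using mult.IH(2)[OF mult.prems] by blast
  obtain e where e: "e > 0" "\<And>t. norm t < e \<Longrightarrow> carried_through r j e1 t a" using mult.IH(1)[OF e1(1)] by blast
  have "carried_through r j d t (a * b)" if t: "norm t < e" for t
  proof -
    obtain a1 h1 t1 where 1: "a1 \<in> N_neg r" "h1 \<in> torus r" "norm t1 < e1"
      "x_pos r j t * a = a1 * (h1 * x_pos r j t1)" using e(2)[OF t] by blast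
    obtain b1 h2 t2 where 2: "b1 \<in> N_neg r" "h2 \<in> torus r" "norm t2 < d"
      "x_pos r j t1 * b = b1 * (h2 * x_pos r j t2)" using e1(2)[OF 1(3)] by blast
    obtain b2 where 3: "b2 \<in> N_neg r" "h1 * b1 = b2 * h1" using torus_N_neg[OF 2(1) 1(2)] by blast
    have sq: "a \<in> sq r" "b \<in> sq r" "a1 \<in> sq r" "h1 \<in> sq r" "b1 \<in> sq r" "h2 \<in> sq r" "b2 \<in> sq r"
      "\<And>t. x_pos r j t \<in> sq r" using 1 2 3 mult assms(2) by auto
    have "x_pos r j t * (a * b) = x_pos r j t * a * b" by (rule sq_assoc[symmetric]) (use sq in auto)
    also have "\<dots> = a1 * (h1 * (x_pos r j t1 * b))" unfolding 1(4) using sq by (simp add: sq_assoc[of _ r])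
    also have "\<dots> = a1 * (h1 * b1 * (h2 * x_pos r j t2))" using sq by (simp add: 2(4) sq_assoc[of _ r])
    also have "\<dots> = (a1 * b2) * ((h1 * h2) * x_pos r j t2)" using sq by (simp add: 3(2) sq_assoc[of _ r])
    finally show ?thesis
      using 1 2 3 by (intro bexI[of _ "a1 * b2"] bexI[of _ "h1 * h2"] exI[of _ t2]) auto
  qed
  then show ?case using e(1) by blast
qed

lemma x_pos_G0:
  assumes "x \<in> G0 r" "j \<in> {1..r}"
  shows "\<exists>e>0. \<forall>t. norm t < e \<longrightarrow> x_pos r j t * x \<in> G0 r"
proof -
  from assms obtain a h b where *: "a \<in> N_neg r" "h \<in> torus r" "b \<in> N_pos r" "x = a * h * b"
    by (auto simp: G0_iff)
  obtain e where e: "e > 0" "\<And>t. norm t < e \<Longrightarrow> carried_through r j 1 t a" using x_pos_N_neg[OF *(1) assms(2), of 1] by auto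
  have "x_pos r j t * x \<in> G0 r" if t: "norm t < e" for t
  proof -
    obtain a1 h1 t1 where 1: "a1 \<in> N_neg r" "h1 \<in> torus r"
      "x_pos r j t * a = a1 * (h1 * x_pos r j t1)" using e(2)[OF t] by blast
    obtain b1 where b1: "b1 \<in> N_pos r" "x_pos r j t1 * h = h * b1"
      using N_pos_torus[OF x_pos_N_pos[OF assms(2)] *(2)] by blast
    have sq: "a \<in> sq r" "b \<in> sq r" "a1 \<in> sq r" "h1 \<in> sq r" "b1 \<in> sq r" "h \<in> sq r"
      "\<And>t. x_pos r j t \<in> sq r" using 1 b1 * assms(2) by auto
    have "x_pos r j t * x = x_pos r j t * a * (h * b)" using sq by (simp add: sq_assoc[of _ r] *(4))
    also have "\<dots> = a1 * (h1 * (x_pos r j t1 * (h * b)))" unfolding 1(3) using sq by (simp add: sq_assoc[of _ r])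
    also have "\<dots> = a1 * (h1 * ((x_pos r j t1 * h) * b))" using sq by (simp add: sq_assoc[of _ r])
    also have "\<dots> = a1 * (h1 * h) * (b1 * b)" using sq by (simp add: b1(2) sq_assoc[of _ r])
    finally show ?thesis unfolding G0_iff
      using 1 b1 * by (intro bexI[of _ "a1"] bexI[of _ "h1 * h"] bexI[of _ "b1 * b"]) auto
  qed
  then show ?thesis using e(1) by blast
qed

lemma y_neg_G0:
  assumes "x \<in> G0 r" "j \<in> {1..r}"
  shows "y_neg r j t * x \<in> G0 r"
proof -
  from assms obtain a h b where *: "a \<in> N_neg r" "h \<in> torus r" "b \<in> N_pos r" "x = a * h * b"
    by (auto simp: G0_iff)
  have sq: "a \<in> sq r" "b \<in> sq r" "h \<in> sq r" "y_neg r j t \<in> sq r" using * assms(2) by auto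
  have "y_neg r j t * x = y_neg r j t * a * h * b" using sq by (simp add: *(4) sq_assoc)
  then show ?thesis unfolding G0_iff using * assms(2)
    by (intro bexI[of _ "y_neg r j t * a"] bexI[of _ h] bexI[of _ b]) auto
qed

lemma G0_spin: "x \<in> G0 r \<Longrightarrow> x \<in> carrier (spin r)"
  by (auto simp: G0_iff)

lemma one_G0: "1\<^sub>m (2 ^ r) \<in> G0 r"
  unfolding G0_iff
  by (intro bexI[of _ "1\<^sub>m (2 ^ r)"]) auto

text \<open>
A polynomial that vanishes on the big cell vanishes at \<open>x\<^sub>i(t) x\<close> for \<open>x\<close> in the cell and small \<open>t\<close>, hence for
all \<open>t\<close>, since it is polynomial in \<open>t\<close>. So the closure of the cell is stable under left multiplication
by all generators. The matrix \<open>W\<close> makes the induction absorb factors on the left, and later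
serves to translate the cell by a Weyl group element.
\<close>

lemma G0_dense:
  assumes "g \<in> carrier (spin r)" "p \<in> mat_poly_fun (2 ^ r)" "W \<in> sq r"
    and "\<And>x. x \<in> G0 r \<Longrightarrow> p (W * x) = 0"
  shows "p (W * g) = 0"
proof -
  have "\<forall>x\<in>G0 r. p (W * (g * x)) = 0" if "W \<in> sq r" "\<forall>x\<in>G0 r. p (W * x) = 0" for W
    using assms(1) that
  proof (induction g arbitrary: W rule: spin_induct)
    case one
    then show ?case by (metis G0_spin left_mult_one_mat spin_sq)
  next
    case (pos i t)
    show ?case
    proof
      fix x assume x: "x \<in> G0 r"
      have sq: "x \<in> sq r" using G0_spin[OF x] by simp
      obtain q where q: "\<And>t. poly q t = p (W * x + t \<cdot>\<^sub>m (W * (chev_e r i * x)))"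
        using mat_poly_fun_line[OF assms(2), of "W * x" "W * (chev_e r i * x)"] sq pos by auto
      have "W * (x_pos r i t * x) = W * x + t \<cdot>\<^sub>m (W * (chev_e r i * x))" for t
        using sq pos(2) by (simp add: x_pos_affine[OF pos(1)]
          add_mult_distrib_mat[of _ "2 ^ r" "2 ^ r" _ _ "2 ^ r"] mult_add_distrib_mat[of _ "2 ^ r" "2 ^ r" _ "2 ^ r"]
          sq_one_left[of _ r] mult_smult_distrib[of _ "2 ^ r" "2 ^ r" _ "2 ^ r"]
          mult_smult_assoc_mat[of _ "2 ^ r" "2 ^ r" _ "2 ^ r"])
      then have q': "poly q t = p (W * (x_pos r i t * x))" for t by (simp add: q)
      obtain e where e: "e > 0" "\<And>t. norm t < e \<Longrightarrow> x_pos r i t * x \<in> G0 r"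
        using x_pos_G0[OF x pos(1)] by blast
      have "q = 0" using e pos(3) by (intro poly_zero_near_0[OF e(1)]) (simp add: q')
      then show "p (W * (x_pos r i t * x)) = 0" using q'[of t] by simp
    qed
  next
    case (neg i t)
    then show ?case using y_neg_G0 by blast
  next
    case (mult g h)
    have sq: "W \<in> sq r" "g \<in> sq r" "h \<in> sq r" "\<And>x. x \<in> G0 r \<Longrightarrow> x \<in> sq r"
      using mult G0_spin spin_sq by blast+
    have "\<forall>x\<in>G0 r. p (W * g * x) = 0"
      using mult.IH(1)[OF mult.prems] sq(4) by (simp add: sq_assoc[OF sq(1,2)])
    then have "\<forall>x\<in>G0 r. p (W * g * (h * x)) = 0"
      using mult.IH(2)[of "W * g"] sq by simp
    moreover have "W * g * (h * x) = W * (g * h * x)" if "x \<in> G0 r" for x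
      using sq(4)[OF that] sq(1-3) by (simp add: sq_assoc[of _ r])
    ultimately show ?case by simp
  qed
  from this[of W] have "p (W * (g * 1\<^sub>m (2 ^ r))) = 0" using assms(3,4) one_G0 by blast
  then show ?thesis using assms(1) by (simp add: sq_one_right[of _ r])
qed

section \<open>The Weyl group on weights\<close>

text \<open>
The simple reflection \<open>s\<^sub>i\<close> on vectors in \<open>\<epsilon>\<close>-coordinates.
\<close>

definition refl_at :: "nat \<Rightarrow> nat \<Rightarrow> (nat \<Rightarrow> int) \<Rightarrow> nat \<Rightarrow> int" where
  "refl_at r i x = (if i = r then x(r := - x r) else x(i := x (Suc i), Suc i := x i))"

text \<open>
The simple reflection \<open>s\<^sub>i\<close> on the weights of the spin representation.
\<close>

definition srefl :: "nat \<Rightarrow> nat \<Rightarrow> nat set \<Rightarrow> nat set" where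
  "srefl r i A = (if lowerable r i A then lowered i A else if raisable r i A then raised r i A else A)"

definition neg_coords :: "nat \<Rightarrow> (nat \<Rightarrow> int) \<Rightarrow> nat set" where
  "neg_coords r x = {j\<in>{1..r}. x j < 0}"

definition nonzero :: "nat \<Rightarrow> (nat \<Rightarrow> int) \<Rightarrow> bool" where
  "nonzero r x \<longleftrightarrow> (\<forall>j\<in>{1..r}. x j \<noteq> 0)"

abbreviation wact :: "nat \<Rightarrow> nat list \<Rightarrow> (nat \<Rightarrow> int) \<Rightarrow> nat \<Rightarrow> int" where
  "wact r ks x \<equiv> foldr (refl_at r) ks x"

abbreviation swact :: "nat \<Rightarrow> nat list \<Rightarrow> nat set \<Rightarrow> nat set" where
  "swact r ks A \<equiv> foldr (srefl r) ks A"

lemma srefl_subset: "i \<in> {1..r} \<Longrightarrow> A \<subseteq> {1..r} \<Longrightarrow> srefl r i A \<subseteq> {1..r}"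
  using lowered_subset raised_subset by (simp add: srefl_def)

lemma srefl_srefl:
  assumes "i \<in> {1..r}" "A \<subseteq> {1..r}"
  shows "srefl r i (srefl r i A) = A"
  using assms raisable_lowered[of r i A] lowerable_raised[of i r A] raised_lowered[of i r A] lowered_raised[of i r A]
    raisable_not_lowerable[of r i "lowered i A"]
  by (simp add: srefl_def)

lemma swact_subset: "set ks \<subseteq> {1..r} \<Longrightarrow> A \<subseteq> {1..r} \<Longrightarrow> swact r ks A \<subseteq> {1..r}"
proof (induction ks)
  case (Cons i ks)
  then show ?case using srefl_subset[of i r "swact r ks A"] by simp
qed simp

lemma swact_inj:
  assumes "set ks \<subseteq> {1..r}" "A \<subseteq> {1..r}" "B \<subseteq> {1..r}" "swact r ks A = swact r ks B"
  shows "A = B"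
  using assms
proof (induction ks)
  case (Cons i ks)
  have i: "i \<in> {1..r}" and ks: "set ks \<subseteq> {1..r}" using Cons.prems(1) by auto
  have "swact r ks A = srefl r i (srefl r i (swact r ks A))"
    by (rule srefl_srefl[OF i swact_subset[OF ks Cons.prems(2)], symmetric])
  also have "\<dots> = srefl r i (srefl r i (swact r ks B))"
    using Cons.prems(4) by simp
  also have "\<dots> = swact r ks B"
    by (rule srefl_srefl[OF i swact_subset[OF ks Cons.prems(3)]])
  finally show ?case by (rule Cons.IH[OF ks Cons.prems(2,3)])
qed simp

lemma nonzero_refl_at: "i \<in> {1..r} \<Longrightarrow> nonzero r x \<Longrightarrow> nonzero r (refl_at r i x)"
  by (auto simp: nonzero_def refl_at_def)

lemma nonzero_wact: "set ks \<subseteq> {1..r} \<Longrightarrow> nonzero r x \<Longrightarrow> nonzero r (wact r ks x)"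
  by (induction ks) (simp_all add: nonzero_refl_at)

lemma neg_coords_refl_at:
  assumes "i \<in> {1..r}" "nonzero r x"
  shows "neg_coords r (refl_at r i x) = srefl r i (neg_coords r x)"
proof (rule Set.set_eqI)
  fix j
  have nz: "x k < 0 \<longleftrightarrow> \<not> 0 < x k" if "k \<in> {1..r}" for k
    using assms(2) that unfolding nonzero_def by (metis less_asym linorder_neqE_linordered_idom)
  show "j \<in> neg_coords r (refl_at r i x) \<longleftrightarrow> j \<in> srefl r i (neg_coords r x)"
  proof (cases "i = r")
    case True
    then show ?thesis using assms(1) nz[of r]
      by (auto simp: neg_coords_def refl_at_def srefl_def lowerable_def raisable_def lowered_def raised_def)
  next
    case False
    then have "Suc i \<in> {1..r}" using assms(1) by auto
    then show ?thesis using assms(1) False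
      by (auto simp: neg_coords_def refl_at_def srefl_def lowerable_def raisable_def lowered_def raised_def)
  qed
qed

lemma neg_coords_wact:
  "set ks \<subseteq> {1..r} \<Longrightarrow> nonzero r x \<Longrightarrow> neg_coords r (wact r ks x) = swact r ks (neg_coords r x)"
  by (induction ks) (simp_all add: neg_coords_refl_at nonzero_wact)

lemma neg_coords_subset: "neg_coords r x \<subseteq> {1..r}"
  by (auto simp: neg_coords_def)

lemma s_bar_eq: "i \<in> {1..r} \<Longrightarrow> s_bar r i = sl2_blk r i 0 (-1) 1 0"
  by (simp add: s_bar_def x_pos_eq y_neg_eq sl2_blk_mult)

lemma s_bar_spin [simp]: "i \<in> {1..r} \<Longrightarrow> s_bar r i \<in> carrier (spin r)"
  by (simp add: s_bar_def)

abbreviation wprod :: "nat \<Rightarrow> nat list \<Rightarrow> complex mat" where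
  "wprod r ks \<equiv> gprod (spin r) (map (s_bar r) ks)"

lemma wprod_spin [simp]: "set ks \<subseteq> {1..r} \<Longrightarrow> wprod r ks \<in> carrier (spin r)"
  by (induction ks) simp_all

text \<open>
The lift of \<open>s\<^sub>i\<close> is a signed permutation matrix, and a minus sign arises exactly when
\<open>s\<^sub>i\<close> raises the weight that it is applied to.
\<close>

lemma ent_s_bar_mult:
  assumes "i \<in> {1..r}" "M \<in> sq r" "A \<subseteq> {1..r}" "B \<subseteq> {1..r}"
  shows "ent r (s_bar r i * M) A B = (if lowerable r i A then -1 else 1) * ent r M (srefl r i A) B"
  using assms by (simp add: s_bar_eq ent_sl2_blk_mult sl2_act_def srefl_def)

lemma weyl_word_Nil: "weyl_word r [] = torus r"
  and weyl_word_Cons: "weyl_word r (i # ks) = {h * s_bar r i * M | h M. h \<in> torus r \<and> M \<in> weyl_word r ks}"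
  by (auto simp: weyl_word_def weyl_def simple_refl_def set_mult_def r_coset_def)

lemma wprod_weyl_word: "set ks \<subseteq> {1..r} \<Longrightarrow> wprod r ks \<in> weyl_word r ks"
proof (induction ks)
  case (Cons i ks)
  have "wprod r (i # ks) = 1\<^sub>m (2 ^ r) * s_bar r i * wprod r ks"
    using Cons by (simp add: sq_one_left[of _ r])
  then show ?case using Cons torus_one[of r] unfolding weyl_word_Cons
    by (intro CollectI exI[of _ "1\<^sub>m (2 ^ r)"] exI[of _ "wprod r ks"] conjI) simp_all
qed (simp add: weyl_word_Nil)

text \<open>
Torus elements are diagonal, so all elements of a coset of the torus have the same nonzero positions.
Hence the element of the Weyl group given by a word determines how the word permutes the weights.
\<close>

lemma weyl_word_support:
  assumes "set ks \<subseteq> {1..r}" "M \<in> weyl_word r ks"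
  shows "M \<in> sq r \<and> (\<forall>A B. A \<subseteq> {1..r} \<longrightarrow> B \<subseteq> {1..r} \<longrightarrow> (ent r M A B \<noteq> 0 \<longleftrightarrow> A = swact r ks B))"
  using assms
proof (induction ks arbitrary: M)
  case Nil
  then have "M \<in> torus r" by (simp add: weyl_word_Nil)
  then obtain c where "M = set_diag r c" "\<And>A. c A \<noteq> 0" using torus_set_diag[of M r] by blast
  then show ?case by (simp add: ent_set_diag)
next
  case (Cons i ks)
  then obtain h M' where M: "M = h * s_bar r i * M'" "h \<in> torus r" "M' \<in> weyl_word r ks"
    by (auto simp: weyl_word_Cons)
  have i: "i \<in> {1..r}" and ks: "set ks \<subseteq> {1..r}" using Cons.prems by auto
  have IH: "M' \<in> sq r" "\<And>A B. A \<subseteq> {1..r} \<Longrightarrow> B \<subseteq> {1..r} \<Longrightarrow> (ent r M' A B \<noteq> 0 \<longleftrightarrow> A = swact r ks B)"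
    using Cons.IH[OF ks M(3)] by auto
  obtain c where c: "h = set_diag r c" "\<And>A. c A \<noteq> 0" using torus_set_diag[OF M(2)] by blast
  have sq: "s_bar r i \<in> sq r" using i by simp
  have M2: "M = set_diag r c * (s_bar r i * M')"
    unfolding M(1) c(1) by (rule sq_assoc) (use sq IH in simp_all)
  have "ent r M A B \<noteq> 0 \<longleftrightarrow> A = swact r (i # ks) B" if AB: "A \<subseteq> {1..r}" "B \<subseteq> {1..r}" for A B
  proof -
    have "ent r M A B \<noteq> 0 \<longleftrightarrow> ent r M' (srefl r i A) B \<noteq> 0"
      unfolding M2 using AB sq IH(1) i c(2) by (simp add: ent_set_diag_mult ent_s_bar_mult)
    also have "\<dots> \<longleftrightarrow> srefl r i A = swact r ks B"
      using IH(2)[OF srefl_subset[OF i AB(1)] AB(2)] .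
    also have "\<dots> \<longleftrightarrow> A = swact r (i # ks) B"
      using srefl_srefl[OF i AB(1)] srefl_srefl[OF i swact_subset[OF ks AB(2)]] by auto
    finally show ?thesis .
  qed
  then show ?case using M2 sq IH(1) by simp
qed

lemma swact_eqI:
  assumes "set ks \<subseteq> {1..r}" "set js \<subseteq> {1..r}" "weyl_word r ks = weyl_word r js" "B \<subseteq> {1..r}"
  shows "swact r ks B = swact r js B"
proof -
  have "wprod r ks \<in> weyl_word r js" using wprod_weyl_word[OF assms(1)] assms(3) by simp
  note 1 = weyl_word_support[OF assms(2) this] and 2 = weyl_word_support[OF assms(1) wprod_weyl_word[OF assms(1)]]
  have sub: "swact r ks B \<subseteq> {1..r}" by (rule swact_subset[OF assms(1,4)])
  then have "ent r (wprod r ks) (swact r ks B) B \<noteq> 0" using 2 assms(4) by blast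
  then show ?thesis using 1 sub assms(4) by blast
qed

text \<open>
Twice the vector \<open>(r, r - 1, ..., 1)\<close>, which is regular and dominant. It is written as a sum of vectors
with coordinates \<open>\<plusminus>1\<close>, so that the action on the weights of the spin representation determines
the action on it.
\<close>

definition rho2 :: "nat \<Rightarrow> nat \<Rightarrow> int" where
  "rho2 r j = (\<Sum>q\<le>r. (if j \<le> q then 1 else -1)) + (\<Sum>q\<le>r. 1)"

lemma rho2_eq: "j \<in> {1..r} \<Longrightarrow> rho2 r j = 2 * (int r + 1 - int j)"
proof -
  assume j: "j \<in> {1..r}"
  have "(\<Sum>q\<le>r. (if j \<le> q then 1 else -1 :: int)) = (\<Sum>q\<in>{..<j}. -1) + (\<Sum>q\<in>{j..r}. 1)"
  proof -
    have "{..r} \<inter> {q. j \<le> q} = {j..r}" "{..r} \<inter> - {q. j \<le> q} = {..<j}" using j by auto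
    then show ?thesis by (simp add: sum.If_cases)
  qed
  then show ?thesis using j by (simp add: rho2_def of_nat_diff)
qed

lemma wact_sum: "finite Q \<Longrightarrow> wact r ks (\<lambda>j. \<Sum>q\<in>Q. f q j) = (\<lambda>j. \<Sum>q\<in>Q. wact r ks (f q) j)"
  by (induction ks) (auto simp: refl_at_def sum_negf fun_eq_iff)

lemma wact_add: "wact r ks (\<lambda>j. f j + g j) = (\<lambda>j. wact r ks f j + wact r ks g j)"
  by (induction ks) (auto simp: refl_at_def fun_eq_iff)

lemma wact_sign:
  assumes "set ks \<subseteq> {1..r}" "\<And>j. j \<in> {1..r} \<Longrightarrow> \<bar>x j\<bar> = 1" "j \<in> {1..r}"
  shows "\<bar>wact r ks x j\<bar> = 1"
  using assms(1,3)
proof (induction ks arbitrary: j)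
  case (Cons i ks)
  then show ?case by (auto simp: refl_at_def)
qed (use assms in simp)

lemma wact_sign_eq:
  assumes "set ks \<subseteq> {1..r}" "\<And>j. j \<in> {1..r} \<Longrightarrow> \<bar>x j\<bar> = 1" "j \<in> {1..r}"
  shows "wact r ks x j = (if j \<in> swact r ks (neg_coords r x) then -1 else 1)"
proof -
  have "nonzero r x" using assms(2) by (force simp: nonzero_def)
  then have "j \<in> swact r ks (neg_coords r x) \<longleftrightarrow> j \<in> neg_coords r (wact r ks x)"
    by (simp add: neg_coords_wact[OF assms(1)])
  also have "\<dots> \<longleftrightarrow> wact r ks x j < 0" using assms(3) by (simp add: neg_coords_def)
  finally have "j \<in> swact r ks (neg_coords r x) \<longleftrightarrow> wact r ks x j < 0" .
  moreover have "\<bar>wact r ks x j\<bar> = 1" by (rule wact_sign[OF assms(1) _ assms(3)]) (rule assms(2))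
  ultimately show ?thesis by auto
qed

lemma wact_rho2_eqI:
  assumes "set ks \<subseteq> {1..r}" "set js \<subseteq> {1..r}" "weyl_word r ks = weyl_word r js" "j \<in> {1..r}"
  shows "wact r ks (rho2 r) j = wact r js (rho2 r) j"
proof -
  have "wact r ks (rho2 r) j = (\<Sum>q\<le>r. wact r ks (\<lambda>j. if j \<le> q then 1 else -1) j) + (\<Sum>q\<le>r. wact r ks (\<lambda>_. 1) j)" for ks
    unfolding rho2_def[abs_def] by (simp only: wact_add wact_sum finite_atMost)
  moreover have "wact r ks x j = wact r js x j" if "\<And>j. \<bar>x j\<bar> = 1" for x
    using wact_sign_eq[OF assms(1) that assms(4)] wact_sign_eq[OF assms(2) that assms(4)]
      swact_eqI[OF assms(1-3) neg_coords_subset] by simp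
  ultimately show ?thesis by simp
qed

definition pairs :: "nat \<Rightarrow> (nat \<times> nat) set" where
  "pairs r = {(a, b). a \<in> {1..r} \<and> b \<in> {1..r} \<and> a \<noteq> b}"

section \<open>Reduced words\<close>

text \<open>
Counts, for the pair \<open>{a, b}\<close>, which of the positive roots \<open>\<epsilon>\<^sub>a - \<epsilon>\<^sub>b\<close> (for \<open>a < b\<close>) and \<open>\<epsilon>\<^sub>a + \<epsilon>\<^sub>b\<close> are
negative on \<open>p\<close>. It is symmetric in \<open>a\<close> and \<open>b\<close>.
\<close>

definition pair_inv :: "(nat \<Rightarrow> int) \<Rightarrow> nat \<times> nat \<Rightarrow> nat" where
  "pair_inv p = (\<lambda>(a, b). of_bool (if a < b then p a < p b else p b < p a) + of_bool (p a + p b < 0))"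

text \<open>
Twice the number of positive roots that are negative on \<open>p\<close>. Summing over ordered pairs, hence
doubling, allows coordinates to be permuted by mere reindexing.
\<close>

definition twice_len :: "nat \<Rightarrow> (nat \<Rightarrow> int) \<Rightarrow> nat" where
  "twice_len r p = (\<Sum>ab\<in>pairs r. pair_inv p ab) + 2 * card (neg_coords r p)"

lemma finite_pairs [simp]: "finite (pairs r)"
  by (rule finite_subset[of _ "{1..r} \<times> {1..r}"]) (auto simp: pairs_def)

text \<open>
Changing the sign of \<open>p r\<close> interchanges the conditions \<open>p a < p r\<close> and \<open>p a + p r < 0\<close>, so that no pair
changes its count; only the short root \<open>\<epsilon>\<^sub>r\<close> does.
\<close>

lemma twice_len_flip:
  assumes "1 \<le> r" "0 < p r"
  shows "twice_len r (refl_at r r p) = twice_len r p + 2"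
proof -
  have "(\<Sum>ab\<in>pairs r. pair_inv (refl_at r r p) ab) = (\<Sum>ab\<in>pairs r. pair_inv p ab)"
    by (rule sum.cong) (auto simp: pairs_def pair_inv_def refl_at_def)
  moreover have "neg_coords r (refl_at r r p) = insert r (neg_coords r p)" "r \<notin> neg_coords r p" "finite (neg_coords r p)"
    using assms by (auto simp: neg_coords_def refl_at_def)
  ultimately show ?thesis by (simp add: twice_len_def)
qed

text \<open>
Exchanging neighbours preserves the order of every pair of indices except \<open>{i, i + 1}\<close> itself.
\<close>

lemma twice_len_swap:
  assumes "i \<in> {1..<r}" "p (Suc i) < p i"
  shows "twice_len r (refl_at r i p) = twice_len r p + 2"
proof -
  define s where "s = (\<lambda>j. if j = i then Suc i else if j = Suc i then i else j)"
  have ss: "s (s j) = j" for j by (simp add: s_def)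
  have s_mem: "s j \<in> {1..r} \<longleftrightarrow> j \<in> {1..r}" for j using assms(1) by (auto simp: s_def)
  have s_inj: "s a = s b \<longleftrightarrow> a = b" for a b using ss by metis
  have rp: "refl_at r i p j = p (s j)" for j using assms(1) by (auto simp: refl_at_def s_def)
  let ?E = "{(i, Suc i), (Suc i, i)}"
  have E: "?E \<subseteq> pairs r" using assms(1) by (auto simp: pairs_def)
  have sub: "map_prod s s ` (pairs r - ?E) \<subseteq> pairs r - ?E"
  proof
    fix cd assume "cd \<in> map_prod s s ` (pairs r - ?E)"
    then obtain a b where ab: "cd = (s a, s b)" "(a, b) \<in> pairs r" "(a, b) \<notin> ?E" by auto
    have "(s a, s b) \<in> pairs r" using ab(2) s_mem s_inj by (simp add: pairs_def)
    moreover have "(s a, s b) \<notin> ?E" using ab(3) by (auto simp: s_def split: if_splits)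
    ultimately show "cd \<in> pairs r - ?E" using ab(1) by simp
  qed
  have bij: "bij_betw (map_prod s s) (pairs r - ?E) (pairs r - ?E)"
    by (rule bij_betw_byWitness[of _ "map_prod s s", OF _ _ sub sub]) (auto simp: ss)
  have inv: "pair_inv (refl_at r i p) ab = pair_inv p (map_prod s s ab)" if "ab \<in> pairs r - ?E" for ab
  proof -
    obtain a b where ab: "ab = (a, b)" by fastforce
    have "s a < s b \<longleftrightarrow> a < b" using that ab by (auto simp: s_def pairs_def)
    then show ?thesis using ab by (simp add: pair_inv_def rp)
  qed
  have "(\<Sum>ab\<in>pairs r - ?E. pair_inv (refl_at r i p) ab) = (\<Sum>ab\<in>pairs r - ?E. pair_inv p (map_prod s s ab))"
    using inv by (intro sum.cong) auto
  also have "\<dots> = (\<Sum>ab\<in>pairs r - ?E. pair_inv p ab)"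
    by (rule sum.reindex_bij_betw[OF bij])
  finally have 1: "(\<Sum>ab\<in>pairs r - ?E. pair_inv (refl_at r i p) ab) = (\<Sum>ab\<in>pairs r - ?E. pair_inv p ab)" .
  have 2: "(\<Sum>ab\<in>?E. pair_inv (refl_at r i p) ab) = (\<Sum>ab\<in>?E. pair_inv p ab) + 2"
    using assms(2) by (simp add: pair_inv_def rp) (simp add: s_def add.commute)
  have "neg_coords r (refl_at r i p) = s ` neg_coords r p"
  proof -
    have "j \<in> s ` neg_coords r p" if "j \<in> neg_coords r (refl_at r i p)" for j
      using that ss[of j] s_mem[of j] by (intro image_eqI[of _ _ "s j"]) (simp_all add: neg_coords_def rp)
    moreover have "s j \<in> neg_coords r (refl_at r i p)" if "j \<in> neg_coords r p" for j
      using that ss[of j] s_mem[of j] by (simp add: neg_coords_def rp)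
    ultimately show ?thesis by blast
  qed
  then have "card (neg_coords r (refl_at r i p)) = card (neg_coords r p)"
    using s_inj by (simp add: card_image inj_on_def)
  then show ?thesis
    using 1 2 by (simp add: twice_len_def sum.subset_diff[OF E finite_pairs])
qed

lemma refl_at_refl_at: "refl_at r i (refl_at r i p) = p"
  by (auto simp: refl_at_def fun_eq_iff)

text \<open>
The simple coroot \<open>h\<^sub>i\<close> is positive on \<open>p\<close>.
\<close>

definition ascent :: "nat \<Rightarrow> nat \<Rightarrow> (nat \<Rightarrow> int) \<Rightarrow> bool" where
  "ascent r i p \<longleftrightarrow> (if i = r then 0 < p r else p (Suc i) < p i)"

lemma twice_len_ascent: "i \<in> {1..r} \<Longrightarrow> ascent r i p \<Longrightarrow> twice_len r (refl_at r i p) = twice_len r p + 2"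
  using twice_len_flip[of r p] twice_len_swap[of i r p] by (auto simp: ascent_def split: if_splits)

definition regular :: "nat \<Rightarrow> (nat \<Rightarrow> int) \<Rightarrow> bool" where
  "regular r p \<longleftrightarrow> nonzero r p \<and> (\<forall>a\<in>{1..r}. \<forall>b\<in>{1..r}. a \<noteq> b \<longrightarrow> \<bar>p a\<bar> \<noteq> \<bar>p b\<bar>)"

lemma regular_refl_at: "i \<in> {1..r} \<Longrightarrow> regular r p \<Longrightarrow> regular r (refl_at r i p)"
  using nonzero_refl_at[of i r p] by (auto simp: regular_def refl_at_def)

lemma regular_wact: "set ks \<subseteq> {1..r} \<Longrightarrow> regular r p \<Longrightarrow> regular r (wact r ks p)"
  by (induction ks) (simp_all add: regular_refl_at)

lemma regular_rho2: "regular r (rho2 r)"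
  by (auto simp: regular_def nonzero_def rho2_eq)

lemma twice_len_descent:
  assumes "i \<in> {1..r}" "regular r p" "\<not> ascent r i p"
  shows "twice_len r (refl_at r i p) < twice_len r p"
proof -
  have "ascent r i (refl_at r i p)"
  proof (cases "i = r")
    case True
    then have "p r \<noteq> 0" using assms(1,2) by (auto simp: regular_def nonzero_def)
    then show ?thesis using assms(3) True by (simp add: ascent_def refl_at_def)
  next
    case False
    then have "Suc i \<in> {1..r}" using assms(1) by auto
    then have "p i \<noteq> p (Suc i)" using assms(1,2) unfolding regular_def by (metis n_not_Suc_n)
    then show ?thesis using assms(3) False by (auto simp: ascent_def refl_at_def)
  qed
  then show ?thesis using twice_len_ascent[OF assms(1), of "refl_at r i p"] by (simp add: refl_at_refl_at)
qed

lemma twice_len_rho2: "twice_len r (rho2 r) = 0"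
proof -
  have "pair_inv (rho2 r) ab = 0" if "ab \<in> pairs r" for ab
    using that by (auto simp: pairs_def pair_inv_def rho2_eq)
  moreover have "neg_coords r (rho2 r) = {}" by (auto simp: neg_coords_def rho2_eq)
  ultimately show ?thesis by (simp add: twice_len_def)
qed

text \<open>
The number of positive roots made negative is a lower bound for the length of any word. Equality forces every letter
to be an ascent, which is how reduced words are used below.
\<close>

lemma twice_len_wact_le: "set ks \<subseteq> {1..r} \<Longrightarrow> twice_len r (wact r ks (rho2 r)) \<le> 2 * length ks"
proof (induction ks)
  case (Cons i ks)
  then have "twice_len r (wact r (i # ks) (rho2 r)) \<le> twice_len r (wact r ks (rho2 r)) + 2"
    using twice_len_ascent[of i r "wact r ks (rho2 r)"] twice_len_descent[of i r "wact r ks (rho2 r)"] regular_wact[OF _ regular_rho2, of ks r]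
    by (cases "ascent r i (wact r ks (rho2 r))") auto
  then show ?case using Cons by simp
qed (simp add: twice_len_rho2)

text \<open>
The signs of the coordinates of the transformed regular vector give the transformed
highest weight. At an ascent the coroot is positive on the former, hence nonnegative on the latter, so
the weight is lowered or fixed and no minus sign occurs.
\<close>

lemma wprod_highest:
  assumes "set ks \<subseteq> {1..r}" "2 * length ks \<le> twice_len r (wact r ks (rho2 r))" "A \<subseteq> {1..r}"
  shows "ent r (wprod r ks) A {} = (if A = neg_coords r (wact r ks (rho2 r)) then 1 else 0)"
  using assms
proof (induction ks arbitrary: A)
  case Nil
  have "neg_coords r (rho2 r) = {}" by (auto simp: neg_coords_def rho2_eq)
  then show ?case using Nil by (simp add: ent_one)
next
  case (Cons i ks)
  let ?p = "wact r ks (rho2 r)"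
  let ?N = "neg_coords r ?p"
  have i: "i \<in> {1..r}" and ks: "set ks \<subseteq> {1..r}" using Cons.prems by auto
  have regular: "regular r ?p" using regular_wact[OF ks regular_rho2] .
  have asc: "ascent r i ?p"
    using twice_len_descent[OF i regular] twice_len_wact_le[OF ks] Cons.prems(2) by (cases "ascent r i ?p") auto
  then have "2 * length ks \<le> twice_len r ?p"
    using twice_len_ascent[OF i asc] Cons.prems(2) by simp
  note IH = Cons.IH[OF ks this srefl_subset[OF i Cons.prems(3)]]
  have nr: "\<not> raisable r i ?N"
  proof
    assume *: "raisable r i ?N"
    show False
    proof (cases "i = r")
      case True
      then show False using * asc by (auto simp: raisable_def ascent_def neg_coords_def)
    next
      case False
      then have "Suc i \<in> {1..r}" using i by auto
      then show False using * asc False by (auto simp: raisable_def ascent_def neg_coords_def)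
    qed
  qed
  have "wprod r ks \<in> sq r" using ks by simp
  then have "ent r (wprod r (i # ks)) A {} =
      (if lowerable r i A then -1 else 1) * (if srefl r i A = ?N then 1 else 0)"
    using IH i Cons.prems(3) by (simp add: ent_s_bar_mult)
  also have "\<dots> = (if srefl r i A = ?N then 1 else 0)"
    using nr raisable_lowered[of r i A] by (auto simp: srefl_def)
  also have "srefl r i A = ?N \<longleftrightarrow> A = srefl r i ?N"
    using srefl_srefl[OF i Cons.prems(3)] srefl_srefl[OF i neg_coords_subset] by metis
  also have "srefl r i ?N = neg_coords r (wact r (i # ks) (rho2 r))"
    using neg_coords_refl_at[OF i, of ?p] regular by (simp add: regular_def)
  finally show ?case .
qed

section \<open>The generalized minor as a matrix entry\<close>

text \<open>
A cycle \<open>s\<^sub>1 ... s\<^sub>r\<close>, read from the right, negates the last coordinate and carries it to the front, past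
all the others. The hypotheses make each of these steps an ascent.
\<close>

lemma wact_cycle_partial:
  assumes "i \<le> r" "1 \<le> i" "0 < p r" "\<And>j. 1 \<le> j \<Longrightarrow> j < r \<Longrightarrow> - p r < p j"
  shows "(\<forall>j\<in>{1..r}. wact r [i..<Suc r] p j = (if j < i then p j else if j = i then - p r else p (j - 1)))
    \<and> twice_len r (wact r [i..<Suc r] p) = twice_len r p + 2 * (Suc r - i)"
  using assms(1,2)
proof (induction i rule: inc_induct)
  case base
  have "\<forall>j\<in>{1..r}. refl_at r r p j = (if j < r then p j else if j = r then - p r else p (j - 1))"
    by (auto simp: refl_at_def)
  moreover have "twice_len r (refl_at r r p) = twice_len r p + 2"
    using twice_len_ascent[of r r p] assms(3) base by (simp add: ascent_def)
  moreover have "wact r [r..<Suc r] p = refl_at r r p" by simp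
  ultimately show ?case
    unfolding \<open>wact r [r..<Suc r] p = refl_at r r p\<close> by (auto simp del: upt_Suc)
next
  case (step i)
  let ?p = "wact r [Suc i..<Suc r] p"
  have IH: "\<And>j. j \<in> {1..r} \<Longrightarrow> ?p j = (if j < Suc i then p j else if j = Suc i then - p r else p (j - 1))"
    "twice_len r ?p = twice_len r p + 2 * (Suc r - Suc i)" using step.IH by auto
  have w: "wact r [i..<Suc r] p = refl_at r i ?p" using step.hyps by (simp add: upt_conv_Cons)
  have "ascent r i ?p"
    using IH(1)[of i] IH(1)[of "Suc i"] step.hyps step.prems assms(4)[of i] by (simp add: ascent_def del: upt_Suc)
  then have "twice_len r (wact r [i..<Suc r] p) = twice_len r p + 2 * (Suc r - i)"
    using twice_len_ascent[of i r ?p] step.hyps step.prems IH(2) unfolding w by simp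
  moreover have "wact r [i..<Suc r] p j = (if j < i then p j else if j = i then - p r else p (j - 1))"
    if "j \<in> {1..r}" for j
  proof -
    have "refl_at r i ?p j = (if j = i then ?p (Suc i) else if j = Suc i then ?p i else ?p j)"
      using step.hyps by (simp add: refl_at_def)
    then show ?thesis
      unfolding w using IH(1)[of i] IH(1)[of "Suc i"] IH(1)[OF that] step.hyps step.prems
      by (simp del: upt_Suc)
  qed
  ultimately show ?case by simp
qed

lemma cyclic_word_0 [simp]: "cyclic_word r 0 = []"
  and cyclic_word_Suc: "cyclic_word r (Suc q) = [1..<Suc r] @ cyclic_word r q"
  by (simp_all add: cyclic_word_def)

lemma cyclic_word_snoc: "cyclic_word r (Suc q) = cyclic_word r q @ [1..<Suc r]"
  by (induction q) (simp_all add: cyclic_word_Suc del: upt_Suc)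

lemma length_cyclic_word: "length (cyclic_word r q) = q * r"
  by (induction q) (simp_all add: cyclic_word_Suc del: upt_Suc)

lemma set_cyclic_word: "set (cyclic_word r q) \<subseteq> {1..r}"
  by (induction q) (auto simp: cyclic_word_Suc simp del: upt_Suc)

text \<open>
As long as \<open>q \<le> r\<close>, all \<open>q r\<close> letters are ascents. So the word is reduced.
\<close>

lemma wact_cyclic_word:
  assumes "1 \<le> r" "q \<le> r"
  shows "(\<forall>j\<in>{1..r}. wact r (cyclic_word r q) (rho2 r) j =
      (if j \<le> q then - 2 * (int q + 1 - int j) else 2 * (int r + 1 + int q - int j)))
    \<and> twice_len r (wact r (cyclic_word r q) (rho2 r)) = 2 * (q * r)"
  using assms(2)
proof (induction q)
  case 0
  show ?case by (auto simp: rho2_eq twice_len_rho2)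
next
  case (Suc q)
  let ?p = "wact r (cyclic_word r q) (rho2 r)"
  have IH: "\<And>j. j \<in> {1..r} \<Longrightarrow> ?p j =
      (if j \<le> q then - 2 * (int q + 1 - int j) else 2 * (int r + 1 + int q - int j))"
    "twice_len r ?p = 2 * (q * r)" using Suc by auto
  have pr: "?p r = 2 * (int q + 1)" using IH(1)[of r] assms(1) Suc.prems by simp
  have low: "- ?p r < ?p j" if "1 \<le> j" "j < r" for j
    using IH(1)[of j] that unfolding pr by auto
  have "0 < ?p r" unfolding pr by simp
  note cp = wact_cycle_partial[of 1 r ?p, OF assms(1) order_refl this low]
  have *: "\<forall>j\<in>{1..r}. wact r [1..<Suc r] ?p j = (if j < 1 then ?p j else if j = 1 then - ?p r else ?p (j - 1))"
    "twice_len r (wact r [1..<Suc r] ?p) = twice_len r ?p + 2 * (Suc r - 1)"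
    using cp by blast+
  have w: "wact r (cyclic_word r (Suc q)) (rho2 r) = wact r [1..<Suc r] ?p"
    by (simp add: cyclic_word_Suc del: upt_Suc)
  have "wact r [1..<Suc r] ?p j =
      (if j \<le> Suc q then - 2 * (int (Suc q) + 1 - int j) else 2 * (int r + 1 + int (Suc q) - int j))"
    if j: "j \<in> {1..r}" for j
  proof (cases "j = 1")
    case True
    then show ?thesis using *(1) j pr by (simp del: upt_Suc)
  next
    case False
    then have "j - 1 \<in> {1..r}" using j by auto
    then show ?thesis using *(1) j IH(1)[of "j - 1"] False by (auto simp del: upt_Suc)
  qed
  then show ?case unfolding w using *(2) IH(2) by (simp del: upt_Suc)
qed

lemma neg_coords_cyclic_word:
  assumes "1 \<le> r" "q \<le> r"
  shows "neg_coords r (wact r (cyclic_word r q) (rho2 r)) = {1..q}"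
proof (rule Set.set_eqI)
  fix j
  show "j \<in> neg_coords r (wact r (cyclic_word r q) (rho2 r)) \<longleftrightarrow> j \<in> {1..q}"
  proof (cases "j \<in> {1..r}")
    case True
    then show ?thesis
      using bspec[OF conjunct1[OF wact_cyclic_word[OF assms]] True] by (auto simp: neg_coords_def)
  next
    case False
    then show ?thesis using assms(2) by (auto simp: neg_coords_def)
  qed
qed

lemma twice_len_cong:
  assumes "\<And>j. j \<in> {1..r} \<Longrightarrow> p j = p' j"
  shows "twice_len r p = twice_len r p'"
proof -
  have "pair_inv p ab = pair_inv p' ab" if "ab \<in> pairs r" for ab
    using that assms by (auto simp: pairs_def pair_inv_def)
  moreover have "neg_coords r p = neg_coords r p'" using assms by (auto simp: neg_coords_def)
  ultimately show ?thesis by (simp add: twice_len_def)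
qed

text \<open>
The lift is defined by an arbitrarily chosen reduced word. That word has at most \<open>q r\<close> letters and leads to the same
inversion count as the cyclic word, so all its letters are ascents.
\<close>

lemma w_bar_cyclic_word:
  assumes "1 \<le> r" "q \<le> r"
  defines "w \<equiv> weyl_word r (cyclic_word r q)"
  obtains ks where "set ks \<subseteq> {1..r}" "w_bar r w = wprod r ks"
    "\<And>A. A \<subseteq> {1..r} \<Longrightarrow> ent r (wprod r ks) A {} = (if A = {1..q} then 1 else 0)"
proof -
  let ?c = "cyclic_word r q"
  let ?ks = "SOME js. reduced_expr r w js"
  have "\<exists>js. (set js \<subseteq> {1..r} \<and> weyl_word r js = w) \<and>
      (\<forall>ks. set ks \<subseteq> {1..r} \<and> weyl_word r ks = w \<longrightarrow> length js \<le> length ks)"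
    by (rule ex_has_least_nat[of _ ?c]) (simp add: w_def set_cyclic_word del: One_nat_def)
  then have "\<exists>js. reduced_expr r w js" by (auto simp: reduced_expr_def)
  then have red: "reduced_expr r w ?ks" by (rule someI_ex)
  then have ks: "set ?ks \<subseteq> {1..r}" "weyl_word r ?ks = weyl_word r ?c" "length ?ks \<le> length ?c"
    using set_cyclic_word[of r q] by (auto simp: reduced_expr_def w_def)
  have eq: "wact r ?ks (rho2 r) j = wact r ?c (rho2 r) j" if "j \<in> {1..r}" for j
    by (rule wact_rho2_eqI[OF ks(1) set_cyclic_word ks(2) that])
  have "twice_len r (wact r ?ks (rho2 r)) = 2 * (q * r)"
    using twice_len_cong[OF eq] wact_cyclic_word[OF assms(1,2)] by simp
  then have "2 * length ?ks \<le> twice_len r (wact r ?ks (rho2 r))"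
    using ks(3) by (simp add: length_cyclic_word)
  moreover have "neg_coords r (wact r ?ks (rho2 r)) = neg_coords r (wact r ?c (rho2 r))"
    unfolding neg_coords_def using eq by (intro Collect_cong) (auto simp del: One_nat_def)
  then have "neg_coords r (wact r ?ks (rho2 r)) = {1..q}"
    using neg_coords_cyclic_word[OF assms(1,2)] by simp
  ultimately have "ent r (wprod r ?ks) A {} = (if A = {1..q} then 1 else 0)" if "A \<subseteq> {1..r}" for A
    using wprod_highest[OF ks(1) _ that] by simp
  then show ?thesis using that[of ?ks] ks(1) by (simp add: w_bar_def)
qed

text \<open>
The lift is a monomial matrix, so in the row of \<open>N\<close> only the column \<open>{}\<close> is occupied. Reading
this row of \<open>P Q = 1\<close> yields the row \<open>{}\<close> of the inverse.
\<close>

lemma inverse_highest_row: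
  assumes ks: "set ks \<subseteq> {1..r}" and Q: "Q \<in> sq r" "wprod r ks * Q = 1\<^sub>m (2 ^ r)"
    and N: "N \<subseteq> {1..r}" "\<And>A. A \<subseteq> {1..r} \<Longrightarrow> ent r (wprod r ks) A {} = (if A = N then 1 else 0)"
    and B: "B \<subseteq> {1..r}"
  shows "ent r Q {} B = (if B = N then 1 else 0)"
proof -
  have sq: "wprod r ks \<in> sq r" using ks by simp
  have supp: "ent r (wprod r ks) A C \<noteq> 0 \<longleftrightarrow> A = swact r ks C" if "A \<subseteq> {1..r}" "C \<subseteq> {1..r}" for A C
    using weyl_word_support[OF ks wprod_weyl_word[OF ks]] that by blast
  have "N = swact r ks {}" using supp[OF N(1), of "{}"] N by simp
  then have row: "ent r (wprod r ks) N C = (if C = {} then 1 else 0)" if "C \<subseteq> {1..r}" for C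
    using supp[OF N(1) that] swact_inj[OF ks that, of "{}"] N by auto
  have "(if N = B then 1 else 0) = ent r (wprod r ks * Q) N B"
    using Q N B by (simp add: ent_one)
  also have "\<dots> = (\<Sum>C\<in>Pow {1..r}. ent r (wprod r ks) N C * ent r Q C B)"
    by (rule ent_mult[OF sq Q(1) N(1) B])
  also have "\<dots> = (\<Sum>C\<in>Pow {1..r}. if C = {} then ent r Q {} B else 0)"
    using row by (intro sum.cong) auto
  also have "\<dots> = ent r Q {} B" by simp
  finally have "(if N = B then 1 else 0) = ent r Q {} B" .
  then show ?thesis by (cases "B = N") simp_all
qed

lemma ent_mult_row:
  assumes "M \<in> sq r" "x \<in> sq r" "N \<subseteq> {1..r}" "B \<subseteq> {1..r}"
    "\<And>C. C \<subseteq> {1..r} \<Longrightarrow> ent r M {} C = (if C = N then 1 else 0)"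
  shows "ent r (M * x) {} B = ent r x N B"
proof -
  have "ent r (M * x) {} B = (\<Sum>C\<in>Pow {1..r}. ent r M {} C * ent r x C B)"
    by (rule ent_mult) (use assms in auto)
  also have "\<dots> = (\<Sum>C\<in>Pow {1..r}. if C = N then ent r x N B else 0)"
    using assms(5) by (intro sum.cong) auto
  finally show ?thesis using assms(3) by simp
qed

lemma gen_minor_cyclic:
  assumes "1 \<le> r" "q \<le> r" "g \<in> carrier (spin r)"
  shows "gen_minor r (weyl_word r (cyclic_word r q)) r g = ent r g {1..q} {}"
proof -
  interpret group "spin r" by (rule spin_group)
  define w where "w = weyl_word r (cyclic_word r q)"
  obtain ks where ks: "set ks \<subseteq> {1..r}" "w_bar r w = wprod r ks"
    "\<And>A. A \<subseteq> {1..r} \<Longrightarrow> ent r (wprod r ks) A {} = (if A = {1..q} then 1 else 0)"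
    using w_bar_cyclic_word[OF assms(1,2)] unfolding w_def by metis
  define P where "P = wprod r ks"
  define Q where "Q = inv\<^bsub>spin r\<^esub> P"
  have P: "P \<in> carrier (spin r)" unfolding P_def by (rule wprod_spin[OF ks(1)])
  have Q: "Q \<in> carrier (spin r)" "P * Q = 1\<^sub>m (2 ^ r)" "Q * P = 1\<^sub>m (2 ^ r)"
    using P l_inv[OF P] r_inv[OF P] by (simp_all add: Q_def)
  have q: "{1..q} \<subseteq> {1..r}" using assms(2) by auto
  have row: "ent r Q {} B = (if B = {1..q} then 1 else 0)" if "B \<subseteq> {1..r}" for B
    by (rule inverse_highest_row[OF ks(1) _ _ q ks(3) that]) (use Q in \<open>simp_all add: P_def\<close>)
  have ent_Q: "ent r (Q * x) {} {} = ent r x {1..q} {}" if "x \<in> carrier (spin r)" for x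
    by (rule ent_mult_row[OF _ _ q _ row]) (use Q that in auto)
  define f where "f = restrict (\<lambda>x. ent r x {1..q} {}) (carrier (spin r))"
  have poly: "(\<lambda>x. ent r x {1..q} {}) \<in> mat_poly_fun (2 ^ r)"
    unfolding ent_def by (intro mat_poly_fun.entry idx_less) (use q in auto)
  have coset: "x \<in> P <#\<^bsub>spin r\<^esub> G0 r \<longleftrightarrow> (\<exists>y\<in>G0 r. x = P * y)" for x
    by (auto simp: l_coset_def)
  have QP: "Q * (P * y) = y" if "y \<in> G0 r" for y
    using G0_spin[OF that] P Q by (simp add: sq_assoc[of Q r P, symmetric] sq_one_left[of _ r])
  have val: "fund_char r r (torus_part r (Q * (P * y))) = ent r (P * y) {1..q} {}" if "y \<in> G0 r" for y
    using gauss_entry[OF that assms(1)] ent_Q[of "P * y"] G0_spin[OF that] P QP[OF that] by simp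
  have "gen_minor r w r = f"
    unfolding gen_minor_def ks(2) P_def[symmetric] Q_def[symmetric]
  proof (rule the_equality, intro conjI ballI)
    show "f \<in> regular_fun r" using poly by (auto simp: regular_fun_def f_def)
  next
    fix x assume "x \<in> P <#\<^bsub>spin r\<^esub> G0 r"
    then obtain y where y: "y \<in> G0 r" "x = P * y" by (auto simp: coset)
    then show "f x = fund_char r r (torus_part r (Q \<otimes>\<^bsub>spin r\<^esub> x))"
      using val[OF y(1)] G0_spin[OF y(1)] P by (simp add: f_def)
  next
    fix f' assume f': "f' \<in> regular_fun r \<and>
      (\<forall>x\<in>P <#\<^bsub>spin r\<^esub> G0 r. f' x = fund_char r r (torus_part r (Q \<otimes>\<^bsub>spin r\<^esub> x)))"
    then obtain p where p: "p \<in> mat_poly_fun (2 ^ r)" "f' = restrict p (carrier (spin r))"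
      by (auto simp: regular_fun_def)
    \<comment> \<open>The difference of two candidates is a polynomial, and it vanishes on the translated cell.\<close>
    define d where "d = (\<lambda>x. p x + (\<lambda>x. -1) x * ent r x {1..q} {})"
    have d: "d \<in> mat_poly_fun (2 ^ r)"
      unfolding d_def by (intro mat_poly_fun.add mat_poly_fun.mult mat_poly_fun.const p(1) poly)
    have d0: "d (P * y) = 0" if "y \<in> G0 r" for y
    proof -
      have "f' (P * y) = ent r (P * y) {1..q} {}"
        using f' val[OF that] coset[of "P * y"] that by auto
      then show ?thesis using G0_spin[OF that] P by (simp add: d_def p(2))
    qed
    show "f' = f"
    proof
      fix x
      show "f' x = f x"
      proof (cases "x \<in> carrier (spin r)")
        case True
        have "d (P * (Q * x)) = 0"
          by (rule G0_dense[OF _ d _ d0]) (use True P Q in auto)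
        moreover have "P * (Q * x) = x"
          using True P Q by (simp add: sq_assoc[of P r Q, symmetric] sq_one_left[of _ r])
        ultimately show ?thesis using True by (simp add: d_def p(2) f_def)
      qed (simp add: p(2) f_def)
    qed
  qed
  then show ?thesis using assms(3) by (simp add: w_def f_def)
qed

section \<open>The transfer matrix of one cycle\<close>

text \<open>
For \<open>t \<noteq> 0\<close> the operator \<open>x\<^bsub>-i\<^esub>(t)\<close> is the sum of \<open>t\<close> to the power \<open>-h\<^sub>i\<close> and \<open>f\<^sub>i\<close>.
\<close>

definition evolve :: "nat \<Rightarrow> nat \<Rightarrow> complex \<Rightarrow> (nat set \<Rightarrow> complex) \<Rightarrow> nat set \<Rightarrow> complex" where
  "evolve r i t f A = t powi (- hweight r i A) * f A + (if raisable r i A then f (raised r i A) else 0)"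

text \<open>
The letters \<open>i, ..., r\<close> of a cycle. Tails of a cycle are needed since the rightmost letter acts first.
\<close>

definition cycle_letters :: "nat \<Rightarrow> (nat \<Rightarrow> complex) \<Rightarrow> nat \<Rightarrow> (nat \<times> complex) list" where
  "cycle_letters r y i = map (\<lambda>j. (j, y j)) [i..<Suc r]"

abbreviation evolve_word ::
  "nat \<Rightarrow> (nat \<times> complex) list \<Rightarrow> (nat set \<Rightarrow> complex) \<Rightarrow> nat set \<Rightarrow> complex" where
  "evolve_word r \<equiv> foldr (\<lambda>(i, t). evolve r i t)"

definition count_upto :: "nat set \<Rightarrow> nat \<Rightarrow> nat" where
  "count_upto D j = card (D \<inter> {1..j})"

lemma count_upto_0 [simp]: "count_upto D 0 = 0"
  by (simp add: count_upto_def)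

lemma count_upto_Suc: "count_upto D (Suc j) = count_upto D j + (if Suc j \<in> D then 1 else 0)"
proof -
  have "D \<inter> {1..Suc j} = (if Suc j \<in> D then insert (Suc j) (D \<inter> {1..j}) else D \<inter> {1..j})"
    by (auto simp: le_Suc_eq)
  then show ?thesis by (simp add: count_upto_def)
qed

lemma count_upto_mono: "i \<le> j \<Longrightarrow> count_upto D i \<le> count_upto D j"
  by (auto simp: count_upto_def intro!: card_mono)

lemma count_upto_full: "D \<subseteq> {1..r} \<Longrightarrow> count_upto D r = card D"
  by (simp add: count_upto_def Int_absorb2)

text \<open>
The difference of the two counts is the number of particles that cross from above \<open>j\<close> to \<open>j\<close> or
below when the cycle turns \<open>E\<close> into \<open>D\<close> (for \<open>j = r\<close>: that are created). At most one can cross, and only if site \<open>j\<close> is free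
when its letter comes up; at that moment it is occupied as in \<open>E\<close>.
\<close>

definition shift_at :: "nat set \<Rightarrow> nat set \<Rightarrow> nat \<Rightarrow> bool" where
  "shift_at D E j \<longleftrightarrow> count_upto D j = count_upto E j \<or> (count_upto D j = Suc (count_upto E j) \<and> j \<notin> E)"

text \<open>
Reachability by the letters \<open>i, ..., r\<close>: sites below \<open>i\<close> have not yet changed.
\<close>

definition interlaced_from :: "nat \<Rightarrow> nat \<Rightarrow> nat set \<Rightarrow> nat set \<Rightarrow> bool" where
  "interlaced_from r i D E \<longleftrightarrow> (\<forall>j\<in>{1..<i}. j \<in> D \<longleftrightarrow> j \<in> E) \<and> (\<forall>j\<in>{i..r}. shift_at D E j)"

text \<open>
The contribution of letter \<open>j < r\<close> is the same expression whether or not a particle moves: in case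
of a move, site \<open>j\<close> is empty before and site \<open>j + 1\<close> empty after, and the exponent is 0. For \<open>j = r\<close> the
difference of cardinalities records whether a particle is created.
\<close>

definition tail_weight :: "nat \<Rightarrow> (nat \<Rightarrow> complex) \<Rightarrow> nat \<Rightarrow> nat set \<Rightarrow> nat set \<Rightarrow> complex" where
  "tail_weight r y i D E = (\<Prod>j\<in>{i..<r}. y j powi (of_bool (j \<in> E) - of_bool (Suc j \<in> D)))
     * y r powi (2 * of_bool (r \<in> E) - 1 + (int (card D) - int (card E)))"

lemma count_upto_eq: "(\<And>k. k \<in> {1..j} \<Longrightarrow> k \<in> D \<longleftrightarrow> k \<in> E) \<Longrightarrow> count_upto D j = count_upto E j"
  unfolding count_upto_def by (rule arg_cong[of _ _ card]) auto

lemma interlaced_from_last: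
  assumes r: "1 \<le> r" and D: "D \<subseteq> {1..r}" and E: "E \<subseteq> {1..r}"
  shows "interlaced_from r r D E \<longleftrightarrow> E = D \<or> (r \<in> D \<and> E = D - {r})"
proof
  assume L: "interlaced_from r r D E"
  then have eq: "j \<in> D \<longleftrightarrow> j \<in> E" if "j \<in> {1..<r}" for j using that by (simp add: interlaced_from_def)
  have dr: "shift_at D E r" using L by (simp add: interlaced_from_def)
  have "count_upto D (r - 1) = count_upto E (r - 1)" using eq by (intro count_upto_eq) auto
  moreover have "Suc (r - 1) = r" using r by simp
  ultimately have rE: "r \<in> E \<longrightarrow> r \<in> D"
    using dr count_upto_Suc[of D "r - 1"] count_upto_Suc[of E "r - 1"]
    by (cases "r \<in> D"; cases "r \<in> E") (simp_all add: shift_at_def)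
  have mem: "j \<in> D \<longleftrightarrow> j \<in> E" if "j \<noteq> r" for j
  proof (cases "j \<in> {1..<r}")
    case True then show ?thesis by (rule eq)
  next
    case False
    then have "j \<notin> {1..r}" using that by auto
    then show ?thesis using D E by blast
  qed
  show "E = D \<or> (r \<in> D \<and> E = D - {r})"
  proof (cases "r \<in> D \<longleftrightarrow> r \<in> E")
    case True
    then have "j \<in> E \<longleftrightarrow> j \<in> D" for j using mem[of j] by (cases "j = r") simp_all
    then show ?thesis by blast
  next
    case False
    then have "j \<in> E \<longleftrightarrow> j \<in> D - {r}" for j
      using mem[of j] rE by (cases "j = r") auto
    then show ?thesis using False rE by blast
  qed
next
  assume "E = D \<or> (r \<in> D \<and> E = D - {r})"
  then show "interlaced_from r r D E"
  proof
    assume *: "r \<in> D \<and> E = D - {r}"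
    then have "count_upto D (r - 1) = count_upto E (r - 1)" using r by (intro count_upto_eq) auto
    moreover have "Suc (r - 1) = r" using r by simp
    ultimately have "shift_at D E r"
      using * count_upto_Suc[of D "r - 1"] count_upto_Suc[of E "r - 1"] by (simp add: shift_at_def)
    then show ?thesis using * by (auto simp: interlaced_from_def)
  qed (simp add: interlaced_from_def shift_at_def)
qed

text \<open>
Letter \<open>i\<close> either leaves the configuration alone or moves a particle to site \<open>i\<close>. In the
first case \<open>D\<close> and \<open>E\<close> agree at \<open>i\<close>, in the second they do not, so at most one of the two histories exists. This is
why the transfer matrix has monomial entries.
\<close>

lemma interlaced_from_step:
  assumes i: "1 \<le> i" "i < r" and D: "D \<subseteq> {1..r}" and E: "E \<subseteq> {1..r}"
  shows "interlaced_from r i D E \<longleftrightarrow> interlaced_from r (Suc i) D E \<or> (raisable r i D \<and> interlaced_from r (Suc i) (raised r i D) E)"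
    (is "?L \<longleftrightarrow> ?A \<or> ?B")
    and "\<not> (interlaced_from r (Suc i) D E \<and> raisable r i D \<and> interlaced_from r (Suc i) (raised r i D) E)"
proof -
  have pcr: "count_upto (raised r i D) j = count_upto D j" if "raisable r i D" "Suc i \<le> j" for j
  proof -
    have "raised r i D \<inter> {1..j} = insert (Suc i) (D \<inter> {1..j} - {i})"
      using i that by (auto simp: raised_def)
    moreover have "Suc i \<notin> D \<inter> {1..j} - {i}" and mem: "i \<in> D \<inter> {1..j}"
      using i that by (auto simp: raisable_def)
    ultimately have "card (raised r i D \<inter> {1..j}) = Suc (card (D \<inter> {1..j} - {i}))"
      by (simp only: card_insert_disjoint finite_Diff finite_Int finite_atLeastAtMost simp_thms)
    also have "\<dots> = card (D \<inter> {1..j})" by (rule card.remove[symmetric]) (use mem in auto)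
    finally have "card (raised r i D \<inter> {1..j}) = card (D \<inter> {1..j})" .
    then show ?thesis by (simp add: count_upto_def)
  qed
  have split: "{i..r} = insert i {Suc i..r}" using i by auto
  have split2: "{1..<Suc i} = insert i {1..<i}" using i by auto
  define pre where "pre \<longleftrightarrow> (\<forall>j\<in>{1..<i}. j \<in> D \<longleftrightarrow> j \<in> E)"
  define post where "post \<longleftrightarrow> (\<forall>j\<in>{Suc i..r}. shift_at D E j)"
  have A: "?A \<longleftrightarrow> pre \<and> (i \<in> D \<longleftrightarrow> i \<in> E) \<and> post"
    unfolding interlaced_from_def split2 pre_def post_def by auto
  have B: "?B \<longleftrightarrow> raisable r i D \<and> pre \<and> i \<notin> E \<and> post"
  proof (cases "raisable r i D")
    case True
    have "shift_at (raised r i D) E j \<longleftrightarrow> shift_at D E j" if "j \<in> {Suc i..r}" for j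
      using pcr[OF True] that by (simp add: shift_at_def)
    moreover have "j \<in> raised r i D \<longleftrightarrow> j \<in> D" if "j \<in> {1..<i}" for j
      using that by (auto simp: raised_def)
    moreover have "i \<notin> raised r i D" by (auto simp: raised_def)
    ultimately show ?thesis unfolding interlaced_from_def split2 pre_def post_def using True by auto
  qed simp
  have pre_pc: "count_upto D (i - 1) = count_upto E (i - 1)" if pre
    using that by (intro count_upto_eq) (auto simp: pre_def)
  have si: "Suc (i - 1) = i" using i by simp
  have here: "shift_at D E i \<longleftrightarrow> (i \<in> D \<longleftrightarrow> i \<in> E) \<or> (i \<in> D \<and> i \<notin> E)" if pre
    using pre_pc[OF that] count_upto_Suc[of D "i - 1"] count_upto_Suc[of E "i - 1"] unfolding si shift_at_def by auto
  \<comment> \<open>If site \<open>i + 1\<close> were occupied as well, two particles would have crossed from above it, or one while it was occupied.\<close>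
  have rais: "raisable r i D" if pre post "i \<in> D" "i \<notin> E"
  proof -
    have "count_upto D i = Suc (count_upto E i)"
      using pre_pc[OF that(1)] count_upto_Suc[of D "i - 1"] count_upto_Suc[of E "i - 1"] that unfolding si by auto
    moreover have "shift_at D E (Suc i)" using that(2) i by (auto simp: post_def)
    ultimately have "Suc i \<notin> D"
      using count_upto_Suc[of D i] count_upto_Suc[of E i] by (auto simp: shift_at_def split: if_splits)
    then show ?thesis using that(3) by (simp add: raisable_def)
  qed
  have L: "?L \<longleftrightarrow> pre \<and> shift_at D E i \<and> post"
    unfolding interlaced_from_def split pre_def post_def by auto
  have id: "i \<in> D" if "raisable r i D" using that by (simp add: raisable_def)
  show "?L \<longleftrightarrow> ?A \<or> ?B" unfolding L A B using here rais id by blast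
  show "\<not> (?A \<and> raisable r i D \<and> interlaced_from r (Suc i) (raised r i D) E)"
    using A B id by blast
qed

lemma tail_weight_step:
  assumes i: "1 \<le> i" "i < r" and D: "D \<subseteq> {1..r}" and E: "E \<subseteq> {1..r}"
    and y: "y i \<noteq> 0"
  shows "interlaced_from r (Suc i) D E \<Longrightarrow> tail_weight r y i D E = y i powi (- hweight r i D) * tail_weight r y (Suc i) D E"
    and "raisable r i D \<Longrightarrow> interlaced_from r (Suc i) (raised r i D) E \<Longrightarrow>
      tail_weight r y i D E = tail_weight r y (Suc i) (raised r i D) E"
proof -
  have split: "{i..<r} = insert i {Suc i..<r}" using i by auto
  {
    assume "interlaced_from r (Suc i) D E"
    then have "i \<in> D \<longleftrightarrow> i \<in> E" using i by (simp add: interlaced_from_def)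
    then have "of_bool (i \<in> E) - of_bool (Suc i \<in> D) = - hweight r i D"
      using i by (simp add: hweight_eq)
    then show "tail_weight r y i D E = y i powi (- hweight r i D) * tail_weight r y (Suc i) D E"
      by (simp add: tail_weight_def split)
  next
    assume R: "raisable r i D" and I: "interlaced_from r (Suc i) (raised r i D) E"
    have "i \<in> raised r i D \<longleftrightarrow> i \<in> E" using I i by (simp add: interlaced_from_def)
    then have "i \<notin> E" by (simp add: raised_def split: if_splits)
    moreover have "Suc i \<notin> D" "i \<in> D" using R i by (auto simp: raisable_def)
    moreover have "(\<Prod>j\<in>{Suc i..<r}. y j powi (of_bool (j \<in> E) - of_bool (Suc j \<in> D)))
        = (\<Prod>j\<in>{Suc i..<r}. y j powi (of_bool (j \<in> E) - of_bool (Suc j \<in> raised r i D)))"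
      by (rule prod.cong) (auto simp: raised_def)
    moreover have "card (raised r i D) = card D"
    proof -
      have fin: "finite D" using D finite_subset by blast
      have "raised r i D = insert (Suc i) (D - {i})" using i by (auto simp: raised_def)
      then have "card (raised r i D) = Suc (card (D - {i}))"
        using \<open>Suc i \<notin> D\<close> fin by (simp only: card_insert_disjoint finite_Diff Diff_iff simp_thms)
      also have "\<dots> = card D" by (rule card.remove[symmetric]) (use fin \<open>i \<in> D\<close> in auto)
      finally show ?thesis .
    qed
    ultimately show "tail_weight r y i D E = tail_weight r y (Suc i) (raised r i D) E"
      by (simp add: tail_weight_def split)
  }
qed

lemma evolve_cycle_partial:
  assumes "i \<le> r" "1 \<le> i" "D \<subseteq> {1..r}" "\<And>j. j \<in> {1..r} \<Longrightarrow> y j \<noteq> 0"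
  shows "evolve_word r (cycle_letters r y i) f D =
    (\<Sum>E\<in>Pow {1..r}. if interlaced_from r i D E then tail_weight r y i D E * f E else 0)"
  using assms(1,2,3)
proof (induction i arbitrary: D rule: inc_induct)
  case base
  let ?w = "\<lambda>E. if interlaced_from r r D E then tail_weight r y r D E * f E else 0"
  have fin: "finite D" using base finite_subset by blast
  have lhs: "evolve_word r (cycle_letters r y r) f D = evolve r r (y r) f D"
    by (simp add: cycle_letters_def)
  have wD: "?w D = y r powi (- hweight r r D) * f D"
    using base by (auto simp: interlaced_from_last tail_weight_def hweight_eq)
  show ?case
  proof (cases "r \<in> D")
    case False
    have "(\<Sum>E\<in>Pow {1..r}. ?w E) = (\<Sum>E\<in>{D}. ?w E)"
      using base False by (intro sum.mono_neutral_right) (auto simp: interlaced_from_last)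
    then show ?thesis using wD False unfolding lhs by (simp add: evolve_def raisable_def)
  next
    case True
    have "(\<Sum>E\<in>Pow {1..r}. ?w E) = (\<Sum>E\<in>{D, D - {r}}. ?w E)"
      using base True by (intro sum.mono_neutral_right) (auto simp: interlaced_from_last)
    also have "\<dots> = ?w D + ?w (D - {r})" using True by (subst sum.insert) auto
    also have "?w (D - {r}) = f (D - {r})"
    proof -
      have "int (card D) - int (card (D - {r})) = 1"
        using card.remove[OF fin True] by linarith
      moreover have "interlaced_from r r D (D - {r})"
        using interlaced_from_last[of r D "D - {r}"] base True by auto
      ultimately show ?thesis by (simp add: tail_weight_def)
    qed
    finally show ?thesis using wD True unfolding lhs by (simp add: evolve_def raisable_def raised_def)
  qed
next
  case (step i)
  have i: "1 \<le> i" "i < r" "i \<in> {1..r}" using step by auto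
  let ?F = "evolve_word r (cycle_letters r y (Suc i)) f"
  have F: "?F D = (\<Sum>E\<in>Pow {1..r}. if interlaced_from r (Suc i) D E then tail_weight r y (Suc i) D E * f E else 0)"
    if "D \<subseteq> {1..r}" for D using step.IH[OF _ that] i by simp
  let ?T = "\<lambda>E. y i powi (- hweight r i D) *
        (if interlaced_from r (Suc i) D E then tail_weight r y (Suc i) D E * f E else 0) +
      (if raisable r i D then
        (if interlaced_from r (Suc i) (raised r i D) E then tail_weight r y (Suc i) (raised r i D) E * f E else 0) else 0)"
  have "evolve_word r (cycle_letters r y i) f D = evolve r i (y i) ?F D"
    using i by (simp add: cycle_letters_def upt_conv_Cons del: upt_Suc)
  also have "\<dots> = (\<Sum>E\<in>Pow {1..r}. ?T E)"
    unfolding evolve_def F[OF step.prems(2)] F[OF raised_subset[OF i(3) step.prems(2)]]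
    by (simp add: sum.distrib sum_distrib_left)
  also have "\<dots> = (\<Sum>E\<in>Pow {1..r}. if interlaced_from r i D E then tail_weight r y i D E * f E else 0)"
  proof (rule sum.cong)
    fix E assume "E \<in> Pow {1..r}"
    then have E: "E \<subseteq> {1..r}" by simp
    note st = interlaced_from_step[OF i(1,2) step.prems(2) E]
      tail_weight_step[OF i(1,2) step.prems(2) E, of y, OF assms(4)[OF i(3)]]
    show "?T E = (if interlaced_from r i D E then tail_weight r y i D E * f E else 0)"
    proof (cases "interlaced_from r (Suc i) D E")
      case True
      then have "interlaced_from r i D E" "\<not> (raisable r i D \<and> interlaced_from r (Suc i) (raised r i D) E)"
        using st(1,2) by blast+
      then show ?thesis using True st(3) by auto
    next
      case False
      then show ?thesis using st(1) st(4) by auto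
    qed
  qed simp
  finally show ?case .
qed

definition interlaced :: "nat \<Rightarrow> nat set \<Rightarrow> nat set \<Rightarrow> bool" where
  "interlaced r D E \<longleftrightarrow> (\<forall>j\<in>{1..r}. shift_at D E j)"

text \<open>
A particle moving from site \<open>d\<close> to site \<open>d'\<close> in a cycle with variables \<open>y\<close> contributes
\<open>num_factor r y d / den_factor y d'\<close>. With the variables of the appropriate cycles these are the numerator and
the denominator of \<open>B\<close>.
\<close>

definition num_factor :: "nat \<Rightarrow> (nat \<Rightarrow> complex) \<Rightarrow> nat \<Rightarrow> complex" where
  "num_factor r y d = (if d = r then (y r)\<^sup>2 else y d)"

definition den_factor :: "(nat \<Rightarrow> complex) \<Rightarrow> nat \<Rightarrow> complex" where
  "den_factor y d = (if d = 1 then 1 else y (d - 1))"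

definition cycle_weight :: "nat \<Rightarrow> (nat \<Rightarrow> complex) \<Rightarrow> nat set \<Rightarrow> nat set \<Rightarrow> complex" where
  "cycle_weight r y D E = (\<Prod>d\<in>E. num_factor r y d) / (\<Prod>d\<in>D. den_factor y d) * (if card D = card E then 1 / y r else 1)"

lemma interlaced_card:
  assumes "interlaced r D E" "1 \<le> r" "D \<subseteq> {1..r}" "E \<subseteq> {1..r}"
  shows "card D = card E \<or> (card D = Suc (card E) \<and> r \<notin> E)"
proof -
  have "shift_at D E r" using assms(1,2) by (auto simp: interlaced_def)
  then show ?thesis using assms by (simp add: shift_at_def count_upto_full)
qed

text \<open>
Sorts the factors of the letters by particles: the exponent of \<open>y j\<close> gains one if a particle
starts at \<open>j\<close> and loses one if a particle ends at \<open>j + 1\<close>. The letter \<open>r\<close> needs a separate look,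
because there a cycle without creation contributes an extra inverse.
\<close>

lemma tail_weight_1:
  assumes "1 \<le> r" "D \<subseteq> {1..r}" "E \<subseteq> {1..r}" "interlaced r D E" "\<And>j. j \<in> {1..r} \<Longrightarrow> y j \<noteq> 0"
  shows "tail_weight r y 1 D E = cycle_weight r y D E"
proof -
  have fin: "finite D" "finite E" using assms(2,3) finite_subset by blast+
  have "(\<Prod>j\<in>{1..<r}. y j powi (of_bool (j \<in> E) - of_bool (Suc j \<in> D))) =
      (\<Prod>j\<in>{1..<r}. (if j \<in> E then y j else 1) / (if Suc j \<in> D then y j else 1))"
    using assms(5) by (intro prod.cong) (auto simp: power_int_minus divide_inverse)
  also have "\<dots> = (\<Prod>j\<in>{1..<r}. if j \<in> E then y j else 1) / (\<Prod>j\<in>{1..<r}. if Suc j \<in> D then y j else 1)"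
    by (rule prod_dividef)
  also have "(\<Prod>j\<in>{1..<r}. if j \<in> E then y j else 1) = (\<Prod>d\<in>E - {r}. y d)"
  proof -
    have "{1..<r} \<inter> E = E - {r}" using assms(3) by auto
    then show ?thesis by (simp add: prod.inter_restrict[symmetric])
  qed
  also have "(\<Prod>j\<in>{1..<r}. if Suc j \<in> D then y j else 1) = (\<Prod>d\<in>D. den_factor y d)"
  proof -
    have "(\<Prod>j\<in>{1..<r}. if Suc j \<in> D then y j else 1) = (\<Prod>d\<in>Suc ` {1..<r}. if d \<in> D then den_factor y d else 1)"
      by (subst prod.reindex) (auto simp: den_factor_def intro!: prod.cong)
    also have "\<dots> = (\<Prod>d\<in>Suc ` {1..<r} \<inter> D. den_factor y d)" by (simp add: prod.inter_restrict)
    also have "\<dots> = (\<Prod>d\<in>D. den_factor y d)"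
    proof (rule prod.mono_neutral_left[OF fin(1)])
      show "\<forall>d\<in>D - Suc ` {1..<r} \<inter> D. den_factor y d = 1"
      proof
        fix d assume "d \<in> D - Suc ` {1..<r} \<inter> D"
        then have "d \<in> {1..r}" "d \<notin> Suc ` {1..<r}" using assms(2) by auto
        then have "d = 1" by (cases d) force+
        then show "den_factor y d = 1" by (simp add: den_factor_def)
      qed
    qed simp
    finally show ?thesis .
  qed
  finally have 1: "tail_weight r y 1 D E = (\<Prod>d\<in>E - {r}. y d) / (\<Prod>d\<in>D. den_factor y d) *
      y r powi (2 * of_bool (r \<in> E) - 1 + (int (card D) - int (card E)))"
    by (simp add: tail_weight_def)
  have "(\<Prod>d\<in>E. num_factor r y d) = (\<Prod>d\<in>E - {r}. y d) * (if r \<in> E then (y r)\<^sup>2 else 1)"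
  proof -
    have "(\<Prod>d\<in>E - {r}. num_factor r y d) = (\<Prod>d\<in>E - {r}. y d)" by (rule prod.cong) (auto simp: num_factor_def)
    then show ?thesis using fin(2) by (cases "r \<in> E") (simp_all add: prod.remove[of E r] num_factor_def mult.commute)
  qed
  moreover have "y r powi (2 * of_bool (r \<in> E) - 1 + (int (card D) - int (card E))) =
      (if r \<in> E then (y r)\<^sup>2 else 1) * (if card D = card E then 1 / y r else 1)"
    using interlaced_card[OF assms(4,1-3)] assms(1,5)
    by (auto simp: power_int_minus power2_eq_square field_simps)
  ultimately show ?thesis unfolding 1 cycle_weight_def by simp
qed

lemma evolve_cycle:
  assumes "1 \<le> r" "D \<subseteq> {1..r}" "\<And>j. j \<in> {1..r} \<Longrightarrow> y j \<noteq> 0"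
  shows "evolve_word r (cycle_letters r y 1) f D =
    (\<Sum>E\<in>{E. E \<subseteq> {1..r} \<and> interlaced r D E}. cycle_weight r y D E * f E)"
proof -
  have "interlaced_from r 1 D E \<longleftrightarrow> interlaced r D E" for E by (simp add: interlaced_from_def interlaced_def)
  then have "evolve_word r (cycle_letters r y 1) f D =
      (\<Sum>E\<in>Pow {1..r}. if interlaced r D E then tail_weight r y 1 D E * f E else 0)"
    using evolve_cycle_partial[of 1 r D y f] assms by simp
  also have "\<dots> = (\<Sum>E\<in>Pow {1..r}. if interlaced r D E then cycle_weight r y D E * f E else 0)"
    using tail_weight_1[OF assms(1,2) _ _ assms(3)] by (intro sum.cong) auto
  also have "\<dots> = (\<Sum>E\<in>Pow {1..r} \<inter> {E. interlaced r D E}. cycle_weight r y D E * f E)"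
    by (simp add: sum.inter_restrict[symmetric] sum.If_cases)
  also have "Pow {1..r} \<inter> {E. interlaced r D E} = {E. E \<subseteq> {1..r} \<and> interlaced r D E}" by auto
  finally show ?thesis .
qed

section \<open>Chains of configurations\<close>

text \<open>
\<open>S s\<close> is the configuration between the cycles \<open>s + 1\<close> and \<open>s\<close>; the cycles act in the order \<open>m, ..., 1\<close>, so that \<open>S m\<close>
is the initial and \<open>S 0\<close> the final configuration. Fixing the values beyond \<open>m\<close> makes the
functions correspond to finite sequences.
\<close>

definition chains :: "nat \<Rightarrow> nat set \<Rightarrow> nat \<Rightarrow> (nat \<Rightarrow> nat set) set" where
  "chains r A m = {S. S 0 = A \<and> (\<forall>s. S s \<subseteq> {1..r}) \<and> (\<forall>s>m. S s = {}) \<and>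
     (\<forall>s\<in>{1..m}. interlaced r (S (s - 1)) (S s))}"

abbreviation chain_weight :: "nat \<Rightarrow> (nat \<Rightarrow> nat \<Rightarrow> complex) \<Rightarrow> nat \<Rightarrow> (nat \<Rightarrow> nat set) \<Rightarrow> complex" where
  "chain_weight r Y m S \<equiv> \<Prod>s\<in>{1..m}. cycle_weight r (Y s) (S (s - 1)) (S s)"

lemma chains_0: "A \<subseteq> {1..r} \<Longrightarrow> chains r A 0 = {\<lambda>s. if s = 0 then A else {}}"
  by (auto simp: chains_def fun_eq_iff split: if_splits)

lemma chains_Suc:
  "bij_betw (\<lambda>(S, E). S(Suc m := E)) (SIGMA S:chains r A m. {E. E \<subseteq> {1..r} \<and> interlaced r (S m) E})
    (chains r A (Suc m))"
proof (rule bij_betw_byWitness[of _ "\<lambda>S. (S(Suc m := {}), S (Suc m))"])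
  show "\<forall>SE\<in>SIGMA S:chains r A m. {E. E \<subseteq> {1..r} \<and> interlaced r (S m) E}.
      (\<lambda>S. (S(Suc m := {}), S (Suc m))) ((\<lambda>(S, E). S(Suc m := E)) SE) = SE"
    by (auto simp: chains_def fun_eq_iff)
  show "(\<lambda>(S, E). S(Suc m := E)) ` (SIGMA S:chains r A m. {E. E \<subseteq> {1..r} \<and> interlaced r (S m) E}) \<subseteq> chains r A (Suc m)"
    by (force simp: chains_def)
  show "(\<lambda>S. (S(Suc m := {}), S (Suc m))) ` chains r A (Suc m) \<subseteq>
      (SIGMA S:chains r A m. {E. E \<subseteq> {1..r} \<and> interlaced r (S m) E})"
    by (force simp: chains_def)
qed auto

lemma finite_chains: "A \<subseteq> {1..r} \<Longrightarrow> finite (chains r A m)"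
proof (induction m)
  case (Suc m)
  have "finite {E. E \<subseteq> {1..r} \<and> interlaced r (S m) E}" for S :: "nat \<Rightarrow> nat set" by simp
  then have "finite (SIGMA S:chains r A m. {E. E \<subseteq> {1..r} \<and> interlaced r (S m) E})"
    using Suc by (intro finite_SigmaI) auto
  then show ?case using bij_betw_finite[OF chains_Suc] by blast
qed (simp add: chains_0)

lemma evolve_cycles:
  assumes "1 \<le> r" "A \<subseteq> {1..r}" "\<And>s j. s \<in> {1..m} \<Longrightarrow> j \<in> {1..r} \<Longrightarrow> Y s j \<noteq> 0"
  shows "evolve_word r (concat (map (\<lambda>s. cycle_letters r (Y s) 1) [1..<Suc m])) f A =
    (\<Sum>S\<in>chains r A m. chain_weight r Y m S * f (S m))"
  using assms(3)
proof (induction m arbitrary: f)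
  case 0
  then show ?case using assms(2) by (simp add: chains_0)
next
  case (Suc m)
  let ?N = "\<lambda>S. {E. E \<subseteq> {1..r} \<and> interlaced r (S m) E}"
  let ?g = "evolve_word r (cycle_letters r (Y (Suc m)) 1) f"
  have "evolve_word r (concat (map (\<lambda>s. cycle_letters r (Y s) 1) [1..<Suc (Suc m)])) f A =
      evolve_word r (concat (map (\<lambda>s. cycle_letters r (Y s) 1) [1..<Suc m])) ?g A"
    by simp
  also have "\<dots> = (\<Sum>S\<in>chains r A m. chain_weight r Y m S * ?g (S m))"
    by (rule Suc.IH) (use Suc.prems in auto)
  also have "\<dots> = (\<Sum>S\<in>chains r A m. \<Sum>E\<in>?N S.
      chain_weight r Y m S * (cycle_weight r (Y (Suc m)) (S m) E * f E))"
  proof (rule sum.cong)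
    fix S assume "S \<in> chains r A m"
    then have "S m \<subseteq> {1..r}" by (simp add: chains_def)
    then show "chain_weight r Y m S * ?g (S m) = (\<Sum>E\<in>?N S.
      chain_weight r Y m S * (cycle_weight r (Y (Suc m)) (S m) E * f E))"
      by (subst evolve_cycle[OF assms(1)]) (use Suc.prems in \<open>auto simp: sum_distrib_left\<close>)
  qed simp
  also have "\<dots> = (\<Sum>(S, E)\<in>Sigma (chains r A m) ?N.
      chain_weight r Y m S * (cycle_weight r (Y (Suc m)) (S m) E * f E))"
    by (rule sum.Sigma) (use finite_chains[OF assms(2)] in auto)
  also have "\<dots> = (\<Sum>SE\<in>Sigma (chains r A m) ?N. (\<lambda>S. chain_weight r Y (Suc m) S * f (S (Suc m)))
      ((\<lambda>(S, E). S(Suc m := E)) SE))"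
  proof (rule sum.cong, simp, clarify)
    fix S E
    have "chain_weight r Y m (S(Suc m := E)) =
        chain_weight r Y m S"
      by (rule prod.cong) auto
    then show "chain_weight r Y m S * (cycle_weight r (Y (Suc m)) (S m) E * f E) =
        chain_weight r Y (Suc m) (S(Suc m := E)) * f ((S(Suc m := E)) (Suc m))"
      by (simp add: prod.cl_ivl_Suc del: fun_upd_apply) simp
  qed
  also have "\<dots> = (\<Sum>S\<in>chains r A (Suc m). chain_weight r Y (Suc m) S * f (S (Suc m)))"
    by (rule sum.reindex_bij_betw[OF chains_Suc])
  finally show ?case .
qed

section \<open>The factorization map\<close>

lemma x_minus_eq: "i \<in> {1..r} \<Longrightarrow> t \<noteq> 0 \<Longrightarrow> x_minus r i t = sl2_blk r i (inverse t) 0 1 t"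
  by (simp add: x_minus_def y_neg_eq coroot_elt_eq sl2_blk_mult)

lemma x_minus_spin: "i \<in> {1..r} \<Longrightarrow> t \<noteq> 0 \<Longrightarrow> x_minus r i t \<in> carrier (spin r)"
  by (simp add: x_minus_def)

lemma ent_xL:
  assumes "length js = length ts" "set js \<subseteq> {1..r}" "0 \<notin> set ts"
  shows "xL r js ts \<in> carrier (spin r) \<and> (\<forall>A. A \<subseteq> {1..r} \<longrightarrow> ent r (xL r js ts) A {} =
    evolve_word r (zip js ts) (\<lambda>A. if A = {} then 1 else 0) A)"
  using assms
proof (induction js ts rule: list_induct2)
  case Nil
  then show ?case by (simp add: xL_def ent_one)
next
  case (Cons i js t ts)
  have i: "i \<in> {1..r}" "t \<noteq> 0" using Cons.prems by auto
  have IH: "xL r js ts \<in> carrier (spin r)" "\<And>A. A \<subseteq> {1..r} \<Longrightarrow> ent r (xL r js ts) A {} =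
    evolve_word r (zip js ts) (\<lambda>A. if A = {} then 1 else 0) A" using Cons by auto
  have xL: "xL r (i # js) (t # ts) = x_minus r i t * xL r js ts" by (simp add: xL_def)
  have "ent r (xL r (i # js) (t # ts)) A {} =
      evolve_word r (zip (i # js) (t # ts)) (\<lambda>A. if A = {} then 1 else 0) A"
    if A: "A \<subseteq> {1..r}" for A
  proof -
    have "ent r (xL r (i # js) (t # ts)) A {} = sl2_act r i (inverse t) 0 1 t (\<lambda>C. ent r (xL r js ts) C {}) A"
      unfolding xL x_minus_eq[OF i] using A i IH(1) by (simp add: ent_sl2_blk_mult)
    also have "\<dots> = evolve r i t (\<lambda>C. ent r (xL r js ts) C {}) A"
      using raisable_not_lowerable[of r i A] by (auto simp: sl2_act_def evolve_def hweight_def power_int_minus)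
    also have "\<dots> = evolve r i t (evolve_word r (zip js ts) (\<lambda>A. if A = {} then 1 else 0)) A"
      using IH(2)[OF A] IH(2)[OF raised_subset[OF i(1) A]] by (simp add: evolve_def)
    finally show ?thesis by simp
  qed
  then show ?case using IH(1) i xL by (simp add: x_minus_spin)
qed

lemma zip_cyclic_word:
  "zip (cyclic_word r m) (Y_list r m Y) = concat (map (\<lambda>s. cycle_letters r (Y s) 1) [1..<Suc m])"
  and length_Y_list: "length (Y_list r m Y) = m * r"
proof (induction m)
  case 0
  { case 1 show ?case by simp }
  { case 2 show ?case by (simp add: Y_list_def) }
next
  case (Suc m)
  note c = cyclic_word_snoc[of r m]
  have Y: "Y_list r (Suc m) Y = Y_list r m Y @ map (Y (Suc m)) [1..<Suc r]"
    by (simp add: Y_list_def)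
  have z: "zip [1..<Suc r] (map y [1..<Suc r]) = cycle_letters r y 1" for y :: "nat \<Rightarrow> complex"
    by (simp add: cycle_letters_def zip_map2 zip_same_conv_map del: upt_Suc)
  { case 1
    have "zip (cyclic_word r (Suc m)) (Y_list r (Suc m) Y) =
        zip (cyclic_word r m) (Y_list r m Y) @ zip [1..<Suc r] (map (Y (Suc m)) [1..<Suc r])"
      unfolding c Y using Suc(2) by (intro zip_append) (simp add: length_cyclic_word)
    moreover have "concat (map (\<lambda>s. cycle_letters r (Y s) 1) [1..<Suc (Suc m)]) =
        concat (map (\<lambda>s. cycle_letters r (Y s) 1) [1..<Suc m]) @ cycle_letters r (Y (Suc m)) 1" by simp
    ultimately show ?case unfolding z Suc(1) by (simp only:) }
  { case 2 show ?case using Suc(2) by (simp add: Y del: upt_Suc) }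
qed

lemma DeltaL_eq:
  assumes "1 \<le> m'" "m' \<le> m" "m \<le> r"
    and "\<And>s j. s \<in> {1..m} \<Longrightarrow> j \<in> {1..r} \<Longrightarrow> Y s j \<noteq> 0"
  shows "DeltaL r (m' * r) (cyclic_word r m) (Y_list r m Y) =
    evolve_word r (concat (map (\<lambda>s. cycle_letters r (Y s) 1) [1..<Suc m]))
      (\<lambda>A. if A = {} then 1 else 0) {1..m'}"
proof -
  have r: "1 \<le> r" using assms by simp
  have "cyclic_word r m = cyclic_word r m' @ cyclic_word r (m - m')"
    using assms(2) by (simp add: cyclic_word_def replicate_add[symmetric] flip: concat_append)
  then have take: "take (m' * r) (cyclic_word r m) = cyclic_word r m'"
    by (simp add: length_cyclic_word)
  obtain q where q: "m' = Suc q" using assms(1) by (cases m') auto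
  have "cyclic_word r m' = cyclic_word r q @ [1..<Suc r]"
    unfolding q by (rule cyclic_word_snoc)
  then have "last (cyclic_word r m') = r" "cyclic_word r m' \<noteq> []" using r by auto
  then have "cyclic_word r m' ! (m' * r - 1) = r" by (simp add: last_conv_nth length_cyclic_word)
  moreover have "m' * r - 1 < m' * r" using assms(1) r by simp
  ultimately have nth: "cyclic_word r m ! (m' * r - 1) = r"
    using take by (metis nth_take)
  have "0 \<notin> set (Y_list r m Y)" using assms(4) by (force simp: Y_list_def)
  then have X: "xL r (cyclic_word r m) (Y_list r m Y) \<in> carrier (spin r)"
    "\<And>A. A \<subseteq> {1..r} \<Longrightarrow> ent r (xL r (cyclic_word r m) (Y_list r m Y)) A {} =
    evolve_word r (zip (cyclic_word r m) (Y_list r m Y)) (\<lambda>A. if A = {} then 1 else 0) A"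
    using ent_xL[OF _ set_cyclic_word] by (simp_all add: length_cyclic_word length_Y_list)
  show ?thesis
    unfolding DeltaL_def minor_word_def take nth
    using gen_minor_cyclic[OF r _ X(1), of m'] X(2)[of "{1..m'}"] assms(2,3)
    by (simp add: zip_cyclic_word del: upt_Suc)
qed

section \<open>Particles in a configuration\<close>

text \<open>
The site of particle \<open>i\<close>. This form makes \<open>site D\<close> and the counting function \<open>count_upto D\<close> adjoint to each other
(\<open>site_le_iff\<close>), from which the translation of interlacing follows.
\<close>

definition site :: "nat set \<Rightarrow> nat \<Rightarrow> nat" where
  "site D i = (LEAST j. i \<le> count_upto D j)"

lemma count_upto_le_card: "finite D \<Longrightarrow> count_upto D j \<le> card D"
  unfolding count_upto_def by (rule card_mono) auto

lemma count_upto_le: "count_upto D j \<le> j"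
proof -
  have "count_upto D j \<le> card {1..j}" unfolding count_upto_def by (rule card_mono) auto
  then show ?thesis by simp
qed

lemma site_le_iff:
  assumes "D \<subseteq> {1..r}" "i \<le> card D"
  shows "site D i \<le> j \<longleftrightarrow> i \<le> count_upto D j"
proof
  have ex: "i \<le> count_upto D r" using assms by (simp add: count_upto_full)
  have "i \<le> count_upto D (site D i)" unfolding site_def by (rule LeastI[of _ r]) (rule ex)
  then show "i \<le> count_upto D j" if "site D i \<le> j" using count_upto_mono[OF that, of D] by simp
  show "site D i \<le> j" if "i \<le> count_upto D j" using that unfolding site_def by (rule Least_le)
qed

lemma site_mem:
  assumes "D \<subseteq> {1..r}" "1 \<le> i" "i \<le> card D"
  shows "site D i \<in> D" "count_upto D (site D i) = i"
proof -
  have le: "i \<le> count_upto D (site D i)" using site_le_iff[OF assms(1,3), of "site D i"] by simp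
  have "site D i \<noteq> 0"
  proof
    assume "site D i = 0"
    then show False using le assms(2) by simp
  qed
  then obtain e where e: "site D i = Suc e" using not0_implies_Suc by blast
  then have "\<not> i \<le> count_upto D e" using site_le_iff[OF assms(1,3), of e] by simp
  then show "site D i \<in> D" "count_upto D (site D i) = i" using le e count_upto_Suc[of D e] by (auto split: if_splits)
qed

lemma site_count_upto:
  assumes "D \<subseteq> {1..r}" "d \<in> D"
  shows "1 \<le> count_upto D d" "count_upto D d \<le> card D" "site D (count_upto D d) = d"
proof -
  have fin: "finite D" using assms(1) finite_subset by blast
  show le: "count_upto D d \<le> card D" by (rule count_upto_le_card[OF fin])
  obtain c where c: "d = Suc c" using assms by (cases d) auto
  have s: "count_upto D d = Suc (count_upto D c)" using count_upto_Suc[of D c] assms(2) c by simp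
  then show "1 \<le> count_upto D d" by simp
  have "site D (count_upto D d) \<le> d" using site_le_iff[OF assms(1) le] by simp
  moreover have "\<not> site D (count_upto D d) \<le> c" using site_le_iff[OF assms(1) le] s by simp
  ultimately show "site D (count_upto D d) = d" using c by simp
qed

lemma site_image:
  assumes "D \<subseteq> {1..r}"
  shows "D = site D ` {1..card D}"
proof
  show "D \<subseteq> site D ` {1..card D}"
  proof
    fix d assume "d \<in> D"
    then show "d \<in> site D ` {1..card D}"
      using site_count_upto[OF assms, of d] by (intro image_eqI[of _ _ "count_upto D d"]) simp_all
  qed
  show "site D ` {1..card D} \<subseteq> D" using site_mem(1)[OF assms] by auto
qed

lemma site_unique:
  assumes D: "D = \<kappa> ` {1..q}" "D \<subseteq> {1..r}"
    and step: "\<And>i. 1 \<le> i \<Longrightarrow> i < q \<Longrightarrow> \<kappa> i < \<kappa> (Suc i)"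
  shows "card D = q" and "\<And>i. 1 \<le> i \<Longrightarrow> i \<le> q \<Longrightarrow> site D i = \<kappa> i"
proof -
  have mono: "\<kappa> i < \<kappa> j" if "1 \<le> i" "i < j" "j \<le> q" for i j
  proof -
    have "Suc i \<le> j" using that(2) by simp
    then show ?thesis using that(3)
    proof (induction j rule: dec_induct)
      case base then show ?case using step[of i] that(1) by simp
    next
      case (step j) then show ?case using assms(3)[of j] that(1) by simp
    qed
  qed
  have inj: "inj_on \<kappa> {1..q}"
  proof (rule inj_onI)
    fix i j assume "i \<in> {1..q}" "j \<in> {1..q}" "\<kappa> i = \<kappa> j"
    then show "i = j" using mono[of i j] mono[of j i] by (cases i j rule: linorder_cases) auto
  qed
  then show c: "card D = q" using D(1) by (simp add: card_image)
  show "site D i = \<kappa> i" if i: "1 \<le> i" "i \<le> q" for i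
  proof -
    have sub: "{1..i} \<subseteq> {1..q}" using i by auto
    have "D \<inter> {1..\<kappa> i} = \<kappa> ` {1..i}"
    proof
      show "D \<inter> {1..\<kappa> i} \<subseteq> \<kappa> ` {1..i}"
      proof
        fix d assume "d \<in> D \<inter> {1..\<kappa> i}"
        then obtain j where j: "1 \<le> j" "j \<le> q" "d = \<kappa> j" "\<kappa> j \<le> \<kappa> i" unfolding D(1) by auto
        then have "j \<le> i" using mono[of i j] i by (meson linorder_not_less)
        then show "d \<in> \<kappa> ` {1..i}" using j by auto
      qed
      show "\<kappa> ` {1..i} \<subseteq> D \<inter> {1..\<kappa> i}"
      proof
        fix d assume "d \<in> \<kappa> ` {1..i}"
        then obtain j where j: "1 \<le> j" "j \<le> i" "d = \<kappa> j" by auto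
        have "d \<in> D" using j i unfolding D(1) by auto
        moreover have "d \<le> \<kappa> i" using mono[of j i] j i by (cases "j = i") auto
        ultimately show "d \<in> D \<inter> {1..\<kappa> i}" using D(2) by auto
      qed
    qed
    then have "count_upto D (\<kappa> i) = i"
      unfolding count_upto_def using card_image[OF inj_on_subset[OF inj sub]] by simp
    moreover have "\<kappa> i \<in> D" using i unfolding D(1) by auto
    ultimately show ?thesis using site_count_upto(3)[OF D(2)] by metis
  qed
qed

text \<open>
The comparison of counts is turned into one of sites through the adjunction: \<open>D\<close> has at least as many particles as \<open>E\<close> up to
each site because particle \<open>i\<close> moves down, at most one more because it stays above the old
site of particle \<open>i - 1\<close>, and the strictness of this bound is the condition at the sites of \<open>E\<close>.
\<close>

lemma interlaced_iff:
  assumes "1 \<le> r" and D: "D \<subseteq> {1..r}" and E: "E \<subseteq> {1..r}"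
  shows "interlaced r D E \<longleftrightarrow> card E \<le> card D \<and> card D \<le> Suc (card E) \<and>
    (\<forall>i. 1 \<le> i \<longrightarrow> i \<le> card E \<longrightarrow> site D i \<le> site E i \<and> (Suc i \<le> card D \<longrightarrow> site E i < site D (Suc i)))"
    (is "_ \<longleftrightarrow> ?R")
proof
  assume L: "interlaced r D E"
  have dr: "shift_at D E j" if "j \<in> {1..r}" for j using L that by (simp add: interlaced_def)
  have c: "card E \<le> card D" "card D \<le> Suc (card E)"
    using interlaced_card[OF L assms] by auto
  moreover have "site D i \<le> site E i \<and> (Suc i \<le> card D \<longrightarrow> site E i < site D (Suc i))"
    if i: "1 \<le> i" "i \<le> card E" for i
  proof -
    note m = site_mem[OF E i]
    have "site E i \<in> {1..r}" using m(1) E by blast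
    then have count_upto: "count_upto D (site E i) = i" using dr[of "site E i"] m by (auto simp: shift_at_def)
    have "site D i \<le> site E i" using site_le_iff[OF D, of i "site E i"] i c count_upto by simp
    moreover have "site E i < site D (Suc i)" if "Suc i \<le> card D"
      using site_le_iff[OF D that, of "site E i"] count_upto by simp
    ultimately show ?thesis by blast
  qed
  ultimately show ?R
    by blast
next
  assume R: ?R
  then have c: "card E \<le> card D" "card D \<le> Suc (card E)"
    and e1: "\<And>i. 1 \<le> i \<Longrightarrow> i \<le> card E \<Longrightarrow> site D i \<le> site E i"
    and e2: "\<And>i. 1 \<le> i \<Longrightarrow> i \<le> card E \<Longrightarrow> Suc i \<le> card D \<Longrightarrow> site E i < site D (Suc i)" by blast+
  have fin: "finite D" "finite E" using D E finite_subset by blast+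
  have "shift_at D E j" if "j \<in> {1..r}" for j
  proof -
    define a where "a = count_upto E j"
    have a: "a \<le> card E" unfolding a_def by (rule count_upto_le_card[OF fin(2)])
    have pD: "count_upto D j \<le> card D" by (rule count_upto_le_card[OF fin(1)])
    have lo: "a \<le> count_upto D j"
    proof (cases "a = 0")
      case False
      then have "site D a \<le> site E a" using e1[of a] a by simp
      also have "site E a \<le> j" using site_le_iff[OF E a] by (simp add: a_def)
      finally show ?thesis using site_le_iff[OF D, of a j] a c by simp
    qed simp
    have hi: "count_upto D j \<le> Suc a"
    proof (rule ccontr)
      assume "\<not> count_upto D j \<le> Suc a"
      then have 2: "Suc (Suc a) \<le> count_upto D j" by simp
      then have 3: "Suc (Suc a) \<le> card D" "Suc a \<le> card E" using pD c by simp_all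
      have "site E (Suc a) < site D (Suc (Suc a))" using e2[of "Suc a"] 3 by simp
      also have "\<dots> \<le> j" using site_le_iff[OF D 3(1)] 2 by simp
      finally have "site E (Suc a) \<le> j" by simp
      then have "Suc a \<le> count_upto E j" using site_le_iff[OF E 3(2)] by simp
      then show False by (simp add: a_def)
    qed
    have "j \<notin> E" if s: "count_upto D j = Suc a"
    proof
      assume j: "j \<in> E"
      note p = site_count_upto[OF E j, folded a_def]
      have "site E a < site D (Suc a)" using e2[of a] p s pD by simp
      moreover have "site D (Suc a) \<le> j" using site_le_iff[OF D, of "Suc a" j] s pD by simp
      ultimately show False using p(3) by simp
    qed
    then show ?thesis using lo hi unfolding shift_at_def a_def[symmetric] by linarith
  qed
  then show "interlaced r D E" by (simp add: interlaced_def)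
qed

section \<open>Chains and summation indices\<close>

definition to_chain :: "nat \<Rightarrow> (nat \<Rightarrow> nat) \<times> (nat \<Rightarrow> nat \<Rightarrow> nat) \<Rightarrow> nat \<Rightarrow> nat set" where
  "to_chain m' = (\<lambda>(t, \<kappa>) s. {\<kappa> i s | i. i \<in> {1..m'} \<and> s < t i})"

text \<open>
The number of chain members in which particle \<open>i\<close> is present; the value at 0 follows the convention for \<open>t\<^sub>0\<close>.
\<close>

definition birth :: "nat \<Rightarrow> (nat \<Rightarrow> nat set) \<Rightarrow> nat \<Rightarrow> nat" where
  "birth m S i = (if i = 0 then m + 1 else (LEAST s. card (S s) < i))"

definition from_chain :: "nat \<Rightarrow> nat \<Rightarrow> (nat \<Rightarrow> nat set) \<Rightarrow> (nat \<Rightarrow> nat) \<times> (nat \<Rightarrow> nat \<Rightarrow> nat)" where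
  "from_chain m m' S = (birth m S, \<lambda>i s. if i \<in> {1..m'} \<and> s < birth m S i then site (S s) i else 0)"

lemma index_pairsD:
  assumes "(t, \<kappa>) \<in> index_pairs r m m'"
  shows "t 0 = m + 1" "\<And>i. m' < i \<Longrightarrow> t i = 0"
    "\<And>i s. i \<in> {1..m'} \<Longrightarrow> s \<le> m' - i \<Longrightarrow> \<kappa> i s = i"
    "\<And>i s. i \<notin> {1..m'} \<Longrightarrow> \<kappa> i s = 0"
    "\<And>i s. m' + 1 - i \<le> s \<Longrightarrow> t i \<le> s \<Longrightarrow> \<kappa> i s = 0"
    "\<And>i. i \<in> {1..m'} \<Longrightarrow> 1 \<le> t i" "\<And>i. i \<in> {1..m'} \<Longrightarrow> t i \<le> m"
    "\<And>i. i \<in> {1..<m'} \<Longrightarrow> t (i + 1) < t i"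
    "\<And>i s. i \<in> {1..m'} \<Longrightarrow> m' + 1 - i \<le> s \<Longrightarrow> s < t i \<Longrightarrow> i \<le> \<kappa> i s \<and> \<kappa> i s \<le> r"
    "\<And>i s. i \<in> {1..m'} \<Longrightarrow> 1 \<le> s \<Longrightarrow> s < t i \<Longrightarrow> \<kappa> i (s - 1) \<le> \<kappa> i s"
    "\<And>i s. i \<in> {1..m'} \<Longrightarrow> 1 \<le> s \<Longrightarrow> s < t i \<Longrightarrow> i + 1 \<le> m' \<Longrightarrow> s - 1 < t (i + 1) \<Longrightarrow> \<kappa> i s < \<kappa> (i + 1) (s - 1)"
  using assms unfolding index_pairs_def mem_Collect_eq prod.case by blast+

lemma index_pairs_t_strict:
  assumes "(t, \<kappa>) \<in> index_pairs r m m'" "1 \<le> i" "i < j" "j \<le> m'"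
  shows "t j < t i"
proof -
  have "Suc i \<le> j" using assms(3) by simp
  then show ?thesis using assms(4)
  proof (induction j rule: dec_induct)
    case base then show ?case using index_pairsD(8)[OF assms(1), of i] assms(2) by simp
  next
    case (step j) then show ?case using index_pairsD(8)[OF assms(1), of j] assms(2) by simp
  qed
qed

text \<open>
The numbers \<open>t\<^sub>i\<close> decrease strictly to \<open>t\<^bsub>m'\<^esub> \<ge> 1\<close>. So the sites \<open>k\<^sub>i\<^sup>(\<^sup>s\<^sup>) = i\<close>
fixed by convention all precede \<open>t\<^sub>i\<close>.
\<close>

lemma index_pairs_t_ge:
  assumes "(t, \<kappa>) \<in> index_pairs r m m'" "1 \<le> i" "i \<le> m'"
  shows "m' + 1 - i \<le> t i"
  using assms(3,2)
proof (induction i rule: inc_induct)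
  case base then show ?case using index_pairsD(6)[OF assms(1), of m'] by simp
next
  case (step i) then show ?case using index_pairsD(8)[OF assms(1), of i] by simp
qed

text \<open>
At each time \<open>s\<close> the particles present are an initial segment, since \<open>t\<close> decreases, and their sites increase, since
particle \<open>i + 1\<close> stays above the old site of particle \<open>i\<close>. So the configuration determines
the sites.
\<close>

lemma to_chain_site:
  assumes ip: "(t, \<kappa>) \<in> index_pairs r m m'" and r: "m' \<le> r"
  defines "S \<equiv> to_chain m' (t, \<kappa>)"
  shows "S s \<subseteq> {1..r}"
    and "\<And>i. i \<in> {1..m'} \<Longrightarrow> i \<le> card (S s) \<longleftrightarrow> s < t i"
    and "card (S s) \<le> m'"
    and "\<And>i. i \<in> {1..m'} \<Longrightarrow> s < t i \<Longrightarrow> site (S s) i = \<kappa> i s"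
    and "inj_on (\<lambda>i. \<kappa> i s) {i \<in> {1..m'}. s < t i}"
proof -
  note D = index_pairsD[OF ip]
  define q where "q = card {i \<in> {1..m'}. s < t i}"
  have down: "{i \<in> {1..m'}. s < t i} = {1..q}"
  proof -
    have "\<exists>p. {i \<in> {1..n}. s < t i} = {1..p}" if "n \<le> m'" for n
      using that
    proof (induction n)
      case 0
      show ?case by (rule exI[of _ 0]) auto
    next
      case (Suc n)
      show ?case
      proof (cases "s < t (Suc n)")
        case True
        have "s < t i" if "i \<in> {1..Suc n}" for i
          using index_pairs_t_strict[OF ip, of i "Suc n"] that True Suc.prems by (cases "i = Suc n") auto
        then have "{i \<in> {1..Suc n}. s < t i} = {1..Suc n}" by blast
        then show ?thesis by blast
      next
        case False
        then have "{i \<in> {1..Suc n}. s < t i} = {i \<in> {1..n}. s < t i}" by (auto simp: le_Suc_eq)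
        then show ?thesis using Suc by simp
      qed
    qed
    then obtain p where "{i \<in> {1..m'}. s < t i} = {1..p}" by blast
    then show ?thesis by (simp add: q_def)
  qed
  have "q \<le> card {1..m'}" unfolding q_def by (rule card_mono) auto
  then have qm: "q \<le> m'" by simp
  have iff: "i \<le> q \<longleftrightarrow> s < t i" if "i \<in> {1..m'}" for i
  proof -
    have "i \<in> {i \<in> {1..m'}. s < t i} \<longleftrightarrow> i \<in> {1..q}" unfolding down ..
    then show ?thesis using that by simp
  qed
  have S: "S s = (\<lambda>i. \<kappa> i s) ` {1..q}"
    unfolding S_def to_chain_def prod.case down[symmetric] by auto
  have rng: "\<kappa> i s \<in> {1..r}" if "i \<in> {1..q}" for i
  proof -
    have i: "i \<in> {1..m'}" "s < t i" using that iff[of i] qm by auto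
    show ?thesis
    proof (cases "s \<le> m' - i")
      case True then show ?thesis using D(3)[OF i(1)] i r by auto
    next
      case False
      then have "m' + 1 - i \<le> s" by simp
      then show ?thesis using D(9)[OF i(1) _ i(2)] i by auto
    qed
  qed
  show sub: "S s \<subseteq> {1..r}" unfolding S using rng by blast
  have step: "\<kappa> i s < \<kappa> (Suc i) s" if "1 \<le> i" "i < q" for i
  proof -
    have i: "i \<in> {1..m'}" "Suc i \<in> {1..m'}" "s < t (Suc i)" using that iff[of "Suc i"] qm by auto
    show ?thesis
    proof (cases "s = 0")
      case True then show ?thesis using D(3)[OF i(1)] D(3)[OF i(2)] by simp
    next
      case False
      have ti: "s < t i" using iff[of i] that i by simp
      have "\<kappa> i s < \<kappa> (i + 1) (s - 1)" using D(11)[OF i(1) _ ti] i False by simp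
      also have "\<dots> \<le> \<kappa> (Suc i) s" using D(10)[OF i(2) _ i(3)] False by simp
      finally show ?thesis .
    qed
  qed
  note eu = site_unique[OF S sub step]
  show "i \<le> card (S s) \<longleftrightarrow> s < t i" if "i \<in> {1..m'}" for i using iff[OF that] eu(1) by simp
  show "card (S s) \<le> m'" using eu(1) qm by simp
  show "site (S s) i = \<kappa> i s" if "i \<in> {1..m'}" "s < t i" for i
    using eu(2)[of i] iff[of i] that by simp
  show "inj_on (\<lambda>i. \<kappa> i s) {i \<in> {1..m'}. s < t i}"
    unfolding down by (rule eq_card_imp_inj_on) (use eu(1) S in simp_all)
qed

lemma to_chain_chains:
  assumes ip: "(t, \<kappa>) \<in> index_pairs r m m'" and r: "1 \<le> m'" "m' \<le> r"
  shows "to_chain m' (t, \<kappa>) \<in> chains r {1..m'} m" and "to_chain m' (t, \<kappa>) m = {}"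
proof -
  note D = index_pairsD[OF ip]
  note C = to_chain_site[OF ip r(2)]
  let ?S = "to_chain m' (t, \<kappa>)"
  have S_empty: "?S s = {}" if "m \<le> s" for s
  proof -
    have "\<not> s < t i" if "i \<in> {1..m'}" for i using D(7)[OF that] \<open>m \<le> s\<close> by simp
    then show ?thesis unfolding to_chain_def by auto
  qed
  then show "?S m = {}" by simp
  have S0: "?S 0 = {1..m'}"
  proof -
    have "0 < t i" "\<kappa> i 0 = i" if "i \<in> {1..m'}" for i using D(6)[OF that] D(3)[OF that, of 0] by simp_all
    then show ?thesis unfolding to_chain_def by force
  qed
  have "interlaced r (?S (s - 1)) (?S s)" if s: "1 \<le> s" for s
  proof -
    let ?D = "?S (s - 1)" and ?E = "?S s"
    have pred: "s - 1 < t i \<longleftrightarrow> s \<le> t i" for i using s by auto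
    have "card ?E \<le> card ?D"
    proof (cases "card ?E = 0")
      case False
      then have "card ?E \<in> {1..m'}" using C(3)[of s] by simp
      then show ?thesis using C(2)[of "card ?E" s] C(2)[of "card ?E" "s - 1"] pred by auto
    qed simp
    moreover have "card ?D \<le> Suc (card ?E)"
    proof (rule ccontr)
      assume "\<not> card ?D \<le> Suc (card ?E)"
      then have le: "Suc (Suc (card ?E)) \<le> card ?D" by simp
      then have mem: "Suc (card ?E) \<in> {1..m'}" "Suc (Suc (card ?E)) \<in> {1..m'}" using C(3)[of "s - 1"] by auto
      have "s \<le> t (Suc (Suc (card ?E)))" using C(2)[OF mem(2), of "s - 1"] le pred by simp
      also have "\<dots> < t (Suc (card ?E))" using D(8)[of "Suc (card ?E)"] mem by simp
      finally have "Suc (card ?E) \<le> card ?E" using C(2)[OF mem(1), of s] by simp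
      then show False by simp
    qed
    moreover have "site ?D i \<le> site ?E i \<and> (Suc i \<le> card ?D \<longrightarrow> site ?E i < site ?D (Suc i))"
      if i: "1 \<le> i" "i \<le> card ?E" for i
    proof -
      have im: "i \<in> {1..m'}" using i C(3)[of s] by simp
      then have ti: "s < t i" using C(2)[OF im, of s] i by simp
      have e: "site ?E i = \<kappa> i s" "site ?D i = \<kappa> i (s - 1)" using C(4)[OF im] ti by simp_all
      have "\<kappa> i s < site ?D (Suc i)" if "Suc i \<le> card ?D"
      proof -
        have im2: "Suc i \<in> {1..m'}" using that C(3)[of "s - 1"] by simp
        then have "s - 1 < t (Suc i)" using C(2)[OF im2, of "s - 1"] that by simp
        then show ?thesis using C(4)[OF im2, of "s - 1"] D(11)[OF im s ti] im2 by simp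
      qed
      then show ?thesis unfolding e using D(10)[OF im s ti] by blast
    qed
    ultimately show ?thesis using r by (subst interlaced_iff[OF _ C(1) C(1)]) auto
  qed
  then show "?S \<in> chains r {1..m'} m"
    using S0 S_empty C(1) by (auto simp: chains_def)
qed

lemma chains_card:
  assumes S: "S \<in> chains r {1..m'} m" "S m = {}" and r: "1 \<le> r"
  shows "card (S (Suc s)) \<le> card (S s)" "card (S s) \<le> Suc (card (S (Suc s)))"
    and "interlaced r (S s) (S (Suc s))"
proof -
  have sub: "S s \<subseteq> {1..r}" for s using S(1) by (simp add: chains_def)
  have empty: "S s = {}" if "m \<le> s" for s using S that by (cases "s = m") (auto simp: chains_def)
  show int: "interlaced r (S s) (S (Suc s))"
  proof (cases "s < m")
    case True
    then have "Suc s \<in> {1..m}" by simp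
    then have "interlaced r (S (Suc s - 1)) (S (Suc s))" using S(1) unfolding chains_def by blast
    then show ?thesis by simp
  next
    case False
    then show ?thesis using empty by (simp add: interlaced_def shift_at_def)
  qed
  show "card (S (Suc s)) \<le> card (S s)" "card (S s) \<le> Suc (card (S (Suc s)))"
    using interlaced_card[OF int r sub sub] by auto
qed

text \<open>
The particle numbers \<open>card (S s)\<close> decrease in \<open>s\<close> and vanish at \<open>m\<close>.
\<close>

lemma less_birth_iff:
  assumes S: "S \<in> chains r {1..m'} m" "S m = {}" and r: "1 \<le> r" and i: "1 \<le> i"
  shows "s < birth m S i \<longleftrightarrow> i \<le> card (S s)"
proof -
  have ex: "card (S m) < i" using S(2) i by simp
  have anti: "card (S s') \<le> card (S s)" if "s \<le> s'" for s s'
    using that by (induction s' rule: dec_induct) (use chains_card(1)[OF S r] le_trans in blast)+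
  have le: "card (S (birth m S i)) < i"
    unfolding birth_def using i LeastI[of "\<lambda>s. card (S s) < i", OF ex] by simp
  show ?thesis
  proof
    assume "s < birth m S i"
    then have "s < (LEAST s. card (S s) < i)" using i by (simp add: birth_def)
    then show "i \<le> card (S s)" using not_less_Least by (meson linorder_not_less)
  next
    assume "i \<le> card (S s)"
    then show "s < birth m S i" using anti[of "birth m S i" s] le by (meson leD le_trans linorder_not_less)
  qed
qed

text \<open>
The main point is that the sites fixed by convention are forced. Since a cycle creates at most one
particle, at time \<open>s\<close> at least \<open>m' - s\<close> are present; particle \<open>i\<close> ends at site \<open>i\<close>, and going back one cycle it can only have
been at or above \<open>i\<close>, and below the later site \<open>i + 1\<close> of its successor.
\<close>

lemma from_chain_index_pairs:
  assumes S: "S \<in> chains r {1..m'} m" "S m = {}" and r: "1 \<le> m'" "m' \<le> m" "m' \<le> r"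
  shows "from_chain m m' S \<in> index_pairs r m m'"
proof -
  have r1: "1 \<le> r" using r by simp
  note T = less_birth_iff[OF S r1]
  note K = chains_card[OF S r1]
  have sub: "S s \<subseteq> {1..r}" for s using S(1) by (simp add: chains_def)
  have S0: "S 0 = {1..m'}" using S(1) by (simp add: chains_def)
  let ?t = "birth m S"
  let ?k = "\<lambda>i s. if i \<in> {1..m'} \<and> s < ?t i then site (S s) i else 0"
  note II = iffD1[OF interlaced_iff[OF r1 sub sub] K(3)]
  have e1: "site (S s) i \<le> site (S (Suc s)) i" if "1 \<le> i" "i \<le> card (S (Suc s))" for i s
    using II that by blast
  have e2: "site (S (Suc s)) i < site (S s) (Suc i)" if "1 \<le> i" "i \<le> card (S (Suc s))" "Suc i \<le> card (S s)" for i s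
    using II that by blast
  have big: "m' - s \<le> card (S s)" for s
  proof (induction s)
    case (Suc s) then show ?case using K(2)[of s] by simp
  qed (simp add: S0)
  \<comment> \<open>The particle on site \<open>i + 1\<close> at time \<open>s\<close> is a strict upper bound for its predecessor one cycle earlier.\<close>
  have low: "site (S s) i = i" if "1 \<le> i" "i \<le> m' - s" for i s
    using that
  proof (induction s arbitrary: i)
    case 0
    have "i \<in> {1..m'}" using 0 by simp
    moreover have "count_upto {1..m'} i = i"
      using 0 by (simp add: count_upto_def Int_absorb1)
    ultimately show ?case using site_count_upto(3)[of "{1..m'}" r i] r S0 by simp
  next
    case (Suc s)
    have "i \<le> card (S (Suc s))" "Suc i \<le> card (S s)" using big[of "Suc s"] big[of s] Suc.prems by simp_all
    then have "site (S s) i \<le> site (S (Suc s)) i" "site (S (Suc s)) i < site (S s) (Suc i)"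
      using e1 e2 Suc.prems by blast+
    then show ?case using Suc.IH[of i] Suc.IH[of "Suc i"] Suc.prems by simp
  qed
  have t_pos: "0 < ?t i" if "i \<in> {1..m'}" for i using T[of i 0] that S0 by simp
  have t_le: "?t i \<le> m" if "i \<in> {1..m'}" for i using T[of i m] that S(2) by simp
  have t_dec: "?t (i + 1) < ?t i" if "i \<in> {1..<m'}" for i
  proof -
    have "i + 1 \<in> {1..m'}" using that by simp
    then obtain s where s: "?t (i + 1) = Suc s" using t_pos[of "i + 1"] by (auto simp: gr0_conv_Suc)
    then have "i + 1 \<le> card (S s)" using T[of "i + 1" s] by simp
    then have "i \<le> card (S (Suc s))" using K(2)[of s] by simp
    then show ?thesis using T[of i "Suc s"] that s by simp
  qed
  have lt: "s < ?t i" if "i \<in> {1..m'}" "s \<le> m' - i" for i s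
  proof -
    have "i \<le> m' - s" "1 \<le> i" using that by auto
    then show ?thesis using T[of i s] big[of s] by simp
  qed
  have rng: "i \<le> site (S s) i \<and> site (S s) i \<le> r" if "i \<in> {1..m'}" "s < ?t i" for i s
  proof -
    have c: "1 \<le> i" "i \<le> card (S s)" using T[of i s] that by auto
    have "site (S s) i \<in> {1..r}" using site_mem(1)[OF sub c] sub by blast
    moreover have "i \<le> site (S s) i" using site_mem(2)[OF sub c] count_upto_le[of "S s" "site (S s) i"] by simp
    ultimately show ?thesis by simp
  qed
  have up: "site (S (s - 1)) i \<le> site (S s) i" if "i \<in> {1..m'}" "1 \<le> s" "s < ?t i" for i s
    using e1[of i "s - 1"] T[of i s] that by simp
  have nxt: "site (S s) i < site (S (s - 1)) (i + 1)"
    if "i \<in> {1..m'}" "1 \<le> s" "s < ?t i" "i + 1 \<le> m'" "s - 1 < ?t (i + 1)" for i s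
    using e2[of i "s - 1"] T[of i s] T[of "i + 1" "s - 1"] that by simp
  have t_big: "?t i = 0" if "m' < i" for i
    using T[of i 0] that S0 r by simp
  show ?thesis
    unfolding index_pairs_def from_chain_def mem_Collect_eq prod.case
  proof (intro conjI allI ballI impI)
    show "?t 0 = m + 1" by (simp add: birth_def)
    show "?t i = 0" if "m' < i" for i using t_big that .
    show "?k i s = i" if "i \<in> {1..m'}" "s \<le> m' - i" for i s
    proof -
      have "1 \<le> i" "i \<le> m' - s" using that by auto
      then show ?thesis using lt[OF that] low[of i s] that(1) by simp
    qed
    show "?k i s = 0" if "i \<notin> {1..m'} \<or> (m' + 1 - i \<le> s \<and> ?t i \<le> s)" for i s
      using that by auto
    show "1 \<le> ?t i" if "i \<in> {1..m'}" for i using t_pos[OF that] by simp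
    show "?t i \<le> m" if "i \<in> {1..m'}" for i using t_le[OF that] .
    show "?t (i + 1) < ?t i" if "i \<in> {1..<m'}" for i using t_dec[OF that] .
    show "i \<le> ?k i s" if "i \<in> {1..m'}" "m' + 1 - i \<le> s \<and> s < ?t i" for i s
      using rng[of i s] that by simp
    show "?k i s \<le> r" if "i \<in> {1..m'}" "m' + 1 - i \<le> s \<and> s < ?t i" for i s
      using rng[of i s] that by simp
    show "?k i s \<le> ?k i (s + 1)" if "i \<in> {1..m'}" "m' + 1 - i \<le> s \<and> s + 1 < ?t i" for i s
      using up[of i "s + 1"] that by simp
    show "?k i (s - 1) \<le> ?k i s" if "i \<in> {1..m'}" "1 \<le> s \<and> s < ?t i" for i s
      using up[of i s] that by simp
    show "?k i s < ?k (i + 1) (s - 1)"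
      if "i \<in> {1..m'}" "1 \<le> s \<and> s < ?t i" "i + 1 \<le> m' \<and> s - 1 < ?t (i + 1)" for i s
      using nxt[of i s] that by simp
  qed
qed

lemma to_chain_from_chain:
  assumes S: "S \<in> chains r {1..m'} m" "S m = {}" and r: "1 \<le> r"
  shows "to_chain m' (from_chain m m' S) = S"
proof
  fix s
  have sub: "S s \<subseteq> {1..r}" using S(1) by (simp add: chains_def)
  have anti: "card (S s) \<le> card (S 0)"
    by (induction s) (use chains_card(1)[OF S r] le_trans in blast)+
  moreover have "S 0 = {1..m'}" using S(1) by (simp add: chains_def)
  ultimately have cm: "card (S s) \<le> m'" by simp
  have "to_chain m' (from_chain m m' S) s = site (S s) ` {i \<in> {1..m'}. s < birth m S i}"
    unfolding to_chain_def from_chain_def prod.case by auto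
  also have "{i \<in> {1..m'}. s < birth m S i} = {1..card (S s)}"
    using less_birth_iff[OF S r, of _ s] cm by auto
  also have "site (S s) ` {1..card (S s)} = S s" by (rule site_image[OF sub, symmetric])
  finally show "to_chain m' (from_chain m m' S) s = S s" .
qed

lemma from_chain_to_chain:
  assumes ip: "(t, \<kappa>) \<in> index_pairs r m m'" and r: "1 \<le> m'" "m' \<le> r"
  shows "from_chain m m' (to_chain m' (t, \<kappa>)) = (t, \<kappa>)"
proof -
  note D = index_pairsD[OF ip]
  note C = to_chain_site[OF ip r(2)]
  let ?S = "to_chain m' (t, \<kappa>)"
  have r1: "1 \<le> r" using r by simp
  note T = less_birth_iff[OF to_chain_chains[OF ip r] r1]
  have t: "birth m ?S = t"
  proof
    fix i
    show "birth m ?S i = t i"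
    proof (cases "i \<in> {1..m'}")
      case True
      then have "s < birth m ?S i \<longleftrightarrow> s < t i" for s using T[of i s] C(2)[OF True, of s] by simp
      then show ?thesis by (meson less_irrefl linorder_neqE_nat)
    next
      case False
      show ?thesis
      proof (cases "i = 0")
        case True then show ?thesis using D(1) by (simp add: birth_def)
      next
        case F: False
        then have "m' < i" using False by simp
        moreover have "\<not> 0 < birth m ?S i" using T[of i 0] F C(3)[of 0] \<open>m' < i\<close> by simp
        ultimately show ?thesis using D(2) by simp
      qed
    qed
  qed
  have "(if i \<in> {1..m'} \<and> s < t i then site (?S s) i else 0) = \<kappa> i s" for i s
  proof (cases "i \<in> {1..m'}")
    case True
    show ?thesis
    proof (cases "s < t i")
      case False
      moreover have "m' + 1 - i \<le> t i" using index_pairs_t_ge[OF ip] True by simp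
      ultimately have "\<kappa> i s = 0" using D(5)[of i s] by simp
      then show ?thesis using False by simp
    qed (use True C(4)[OF True] in simp)
  next
    case False
    then show ?thesis using D(4)[OF False, of s] by auto
  qed
  then show ?thesis unfolding from_chain_def t by simp
qed

section \<open>Weights of chains\<close>

lemma prod_gaps:
  fixes f :: "nat \<Rightarrow> complex"
  assumes "\<And>i. i \<le> p \<Longrightarrow> t (Suc i) < t i"
  shows "(\<Prod>i = 1..p + 1. \<Prod>s\<in>{t i<..<t (i - 1)}. f s) = (\<Prod>s\<in>{t (p + 1)<..<t 0} - t ` {1..p}. f s)"
  using assms
proof (induction p)
  case (Suc p)
  have dec: "t j < t i" if "i < j" "j \<le> Suc (Suc p)" for i j
  proof -
    have "Suc i \<le> j" using that(1) by simp
    then show ?thesis using that(2)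
    proof (induction j rule: dec_induct)
      case base then show ?case using Suc.prems[of i] by simp
    next
      case (step j) then show ?case using Suc.prems[of j] by simp
    qed
  qed
  have split: "{t (Suc p + 1)<..<t 0} - t ` {1..Suc p} =
      ({t (p + 1)<..<t 0} - t ` {1..p}) \<union> {t (Suc (Suc p))<..<t (Suc p)}" (is "?L = ?A \<union> ?B")
  proof
    show "?L \<subseteq> ?A \<union> ?B"
    proof
      fix s assume s: "s \<in> ?L"
      then have "s \<noteq> t (Suc p)" by auto
      then show "s \<in> ?A \<union> ?B" using s by auto
    qed
    have "t (Suc (Suc p)) < t (Suc p)" "t (Suc p) < t 0" using dec by simp_all
    moreover have "t (Suc p) < t i" if "i \<in> {1..p}" for i using dec[of i "Suc p"] that by simp
    ultimately show "?A \<union> ?B \<subseteq> ?L" by (fastforce simp: le_Suc_eq)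
  qed
  have "(\<Prod>s\<in>?A \<union> ?B. f s) = (\<Prod>s\<in>?A. f s) * (\<Prod>s\<in>?B. f s)"
    by (rule prod.union_disjoint) auto
  moreover have "(\<Prod>i = 1..Suc p + 1. \<Prod>s\<in>{t i<..<t (i - 1)}. f s) =
      (\<Prod>i = 1..p + 1. \<Prod>s\<in>{t i<..<t (i - 1)}. f s) * (\<Prod>s\<in>?B. f s)"
    by simp
  moreover have "(\<Prod>i = 1..p + 1. \<Prod>s\<in>{t i<..<t (i - 1)}. f s) = (\<Prod>s\<in>?A. f s)"
    by (rule Suc.IH) (use Suc.prems in simp)
  ultimately show ?case unfolding split by simp
qed simp

text \<open>
The factors at the forced sites cancel in the product of all weights: the denominator of particle \<open>i + 1\<close>
at time \<open>s\<close> is the numerator of particle \<open>i\<close> at time \<open>s + 1\<close>.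
\<close>

lemma prod_rearrange:
  fixes Y :: "nat \<Rightarrow> nat \<Rightarrow> complex"
  assumes "1 \<le> p" "p \<le> r"
  shows "(\<Prod>i\<in>{1..p}. \<Prod>s\<in>{1..<p + 1 - i}. num_factor r (Y s) i) = (\<Prod>i\<in>{1..p}. \<Prod>s\<in>{0..<p + 1 - i}. den_factor (Y (Suc s)) i)"
proof -
  let ?g = "\<lambda>i. \<Prod>s\<in>{1..<p + 1 - i}. Y s i"
  have "(\<Prod>i\<in>{1..p}. \<Prod>s\<in>{1..<p + 1 - i}. num_factor r (Y s) i) = (\<Prod>i\<in>{1..p}. ?g i)"
  proof (rule prod.cong)
    fix i assume "i \<in> {1..p}"
    show "(\<Prod>s\<in>{1..<p + 1 - i}. num_factor r (Y s) i) = ?g i"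
      by (rule prod.cong) (use assms in \<open>auto simp: num_factor_def\<close>)
  qed simp
  also have "\<dots> = (\<Prod>i\<in>{1..<p}. ?g i)"
    using assms(1) by (intro prod.mono_neutral_right) auto
  also have "\<dots> = (\<Prod>i\<in>{1..<p}. \<Prod>s\<in>{0..<p + 1 - Suc i}. den_factor (Y (Suc s)) (Suc i))"
  proof (rule prod.cong)
    fix i assume i: "i \<in> {1..<p}"
    have "(\<Prod>s\<in>{1..<p + 1 - i}. Y s i) = (\<Prod>s\<in>{0..<p - i}. Y (Suc s) i)"
      using i prod.shift_bounds_Suc_ivl[of "\<lambda>s. Y s i" 0 "p - i"] by (simp add: Suc_diff_le)
    then show "?g i = (\<Prod>s\<in>{0..<p + 1 - Suc i}. den_factor (Y (Suc s)) (Suc i))"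
      using i by (simp add: den_factor_def)
  qed simp
  also have "\<dots> = (\<Prod>i\<in>{Suc 1..<Suc p}. \<Prod>s\<in>{0..<p + 1 - i}. den_factor (Y (Suc s)) i)"
    by (rule prod.shift_bounds_Suc_ivl[symmetric])
  also have "\<dots> = (\<Prod>i\<in>{1..p}. \<Prod>s\<in>{0..<p + 1 - i}. den_factor (Y (Suc s)) i)"
    by (rule prod.mono_neutral_left) (auto simp: den_factor_def intro!: prod.neutral)
  finally show ?thesis .
qed

text \<open>
The numerator of a cycle weight belongs to the configuration before the cycle, its denominator to
the one after it. Shifting the denominators by one cycle therefore collects, for each particle and each time, the two halves of one
factor \<open>B\<close>.
\<close>

lemma chain_weight_to_chain:
  assumes ip: "(t, \<kappa>) \<in> index_pairs r m m'" and r: "1 \<le> m'" "m' \<le> r"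
    and nz: "\<And>s j. s \<in> {1..m} \<Longrightarrow> j \<in> {1..r} \<Longrightarrow> Y s j \<noteq> 0"
  defines "S \<equiv> to_chain m' (t, \<kappa>)"
  shows "chain_weight r Y m S =
    (\<Prod>i = 1..m' + 1. (\<Prod>s\<in>{m' + 1 - i..<t i}. B_bar r Y s (\<kappa> i s)) *
        (\<Prod>s\<in>{t i<..<t (i - 1)}. B_last r Y s))"
proof -
  note D = index_pairsD[OF ip]
  note C = to_chain_site[OF ip r(2), folded S_def]
  let ?I = "{1..m'}"
  have Ss: "S s = (\<lambda>i. \<kappa> i s) ` {i \<in> ?I. s < t i}" for s
    unfolding S_def to_chain_def prod.case by auto
  have prodS: "(\<Prod>d\<in>S s. h d) = (\<Prod>i\<in>{i \<in> ?I. s < t i}. h (\<kappa> i s))" for h :: "nat \<Rightarrow> complex" and s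
    unfolding Ss by (simp only: prod.reindex[OF C(5)[of s]] o_def)
  have nums: "(\<Prod>s\<in>{1..m}. \<Prod>d\<in>S s. num_factor r (Y s) d) = (\<Prod>i\<in>?I. \<Prod>s\<in>{1..<t i}. num_factor r (Y s) (\<kappa> i s))"
  proof -
    have "(\<Prod>s\<in>{1..m}. \<Prod>d\<in>S s. num_factor r (Y s) d) = (\<Prod>s\<in>{1..m}. \<Prod>i\<in>{i \<in> ?I. s < t i}. num_factor r (Y s) (\<kappa> i s))"
      by (simp only: prodS)
    also have "\<dots> = (\<Prod>i\<in>?I. \<Prod>s\<in>{s \<in> {1..m}. s < t i}. num_factor r (Y s) (\<kappa> i s))"
      by (rule prod.swap_restrict) auto
    also have "\<dots> = (\<Prod>i\<in>?I. \<Prod>s\<in>{1..<t i}. num_factor r (Y s) (\<kappa> i s))"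
    proof (rule prod.cong)
      fix i assume i: "i \<in> ?I"
      have "{s \<in> {1..m}. s < t i} = {1..<t i}" using D(7)[OF i] by auto
      then show "(\<Prod>s\<in>{s \<in> {1..m}. s < t i}. num_factor r (Y s) (\<kappa> i s)) = (\<Prod>s\<in>{1..<t i}. num_factor r (Y s) (\<kappa> i s))"
        by simp
    qed simp
    finally show ?thesis .
  qed
  have dens: "(\<Prod>s\<in>{1..m}. \<Prod>d\<in>S (s - 1). den_factor (Y s) d) = (\<Prod>i\<in>?I. \<Prod>s\<in>{0..<t i}. den_factor (Y (Suc s)) (\<kappa> i s))"
  proof -
    have "(\<Prod>s\<in>{1..m}. \<Prod>d\<in>S (s - 1). den_factor (Y s) d) = (\<Prod>s\<in>{0..<m}. \<Prod>d\<in>S s. den_factor (Y (Suc s)) d)"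
      using prod.shift_bounds_Suc_ivl[of "\<lambda>s. \<Prod>d\<in>S (s - 1). den_factor (Y s) d" 0 m]
      by (simp add: atLeastLessThanSuc_atLeastAtMost)
    also have "\<dots> = (\<Prod>s\<in>{0..<m}. \<Prod>i\<in>{i \<in> ?I. s < t i}. den_factor (Y (Suc s)) (\<kappa> i s))"
      by (simp only: prodS)
    also have "\<dots> = (\<Prod>i\<in>?I. \<Prod>s\<in>{s \<in> {0..<m}. s < t i}. den_factor (Y (Suc s)) (\<kappa> i s))"
      by (rule prod.swap_restrict) auto
    also have "\<dots> = (\<Prod>i\<in>?I. \<Prod>s\<in>{0..<t i}. den_factor (Y (Suc s)) (\<kappa> i s))"
    proof (rule prod.cong)
      fix i assume i: "i \<in> ?I"
      have "{s \<in> {0..<m}. s < t i} = {0..<t i}" using D(7)[OF i] by auto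
      then show "(\<Prod>s\<in>{s \<in> {0..<m}. s < t i}. den_factor (Y (Suc s)) (\<kappa> i s)) = (\<Prod>s\<in>{0..<t i}. den_factor (Y (Suc s)) (\<kappa> i s))"
        by simp
    qed simp
    finally show ?thesis .
  qed
  have t_ge: "1 \<le> m' + 1 - i" "m' + 1 - i \<le> t i" if "i \<in> ?I" for i
  proof -
    have "1 \<le> i" "i \<le> m'" using that by simp_all
    then show "1 \<le> m' + 1 - i" "m' + 1 - i \<le> t i" using index_pairs_t_ge[OF ip, of i] by linarith+
  qed
  have frozen: "\<kappa> i s = i" if "i \<in> ?I" "s < m' + 1 - i" for i s
    using D(3)[OF that(1), of s] that(2) by simp
  \<comment> \<open>The factors at the forced sites, to be cancelled.\<close>
  define K where "K = (\<Prod>i\<in>?I. \<Prod>s\<in>{1..<m' + 1 - i}. num_factor r (Y s) i)"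
  have num_split: "(\<Prod>i\<in>?I. \<Prod>s\<in>{1..<t i}. num_factor r (Y s) (\<kappa> i s)) =
      K * (\<Prod>i\<in>?I. \<Prod>s\<in>{m' + 1 - i..<t i}. num_factor r (Y s) (\<kappa> i s))"
    unfolding K_def prod.distrib[symmetric]
  proof (rule prod.cong)
    fix i assume i: "i \<in> ?I"
    have "(\<Prod>s\<in>{1..<m' + 1 - i}. num_factor r (Y s) i) = (\<Prod>s\<in>{1..<m' + 1 - i}. num_factor r (Y s) (\<kappa> i s))"
      using frozen[OF i] by (intro prod.cong) auto
    then show "(\<Prod>s\<in>{1..<t i}. num_factor r (Y s) (\<kappa> i s)) =
      (\<Prod>s\<in>{1..<m' + 1 - i}. num_factor r (Y s) i) * (\<Prod>s\<in>{m' + 1 - i..<t i}. num_factor r (Y s) (\<kappa> i s))"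
      using prod.atLeastLessThan_concat[OF t_ge[OF i], of "\<lambda>s. num_factor r (Y s) (\<kappa> i s)"] by simp
  qed simp
  have den_split: "(\<Prod>i\<in>?I. \<Prod>s\<in>{0..<t i}. den_factor (Y (Suc s)) (\<kappa> i s)) =
      K * (\<Prod>i\<in>?I. \<Prod>s\<in>{m' + 1 - i..<t i}. den_factor (Y (Suc s)) (\<kappa> i s))"
    unfolding K_def prod_rearrange[OF r] prod.distrib[symmetric]
  proof (rule prod.cong)
    fix i assume i: "i \<in> ?I"
    have "(\<Prod>s\<in>{0..<m' + 1 - i}. den_factor (Y (Suc s)) i) = (\<Prod>s\<in>{0..<m' + 1 - i}. den_factor (Y (Suc s)) (\<kappa> i s))"
      using frozen[OF i] by (intro prod.cong) auto
    then show "(\<Prod>s\<in>{0..<t i}. den_factor (Y (Suc s)) (\<kappa> i s)) =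
      (\<Prod>s\<in>{0..<m' + 1 - i}. den_factor (Y (Suc s)) i) * (\<Prod>s\<in>{m' + 1 - i..<t i}. den_factor (Y (Suc s)) (\<kappa> i s))"
      using prod.atLeastLessThan_concat[OF le0 t_ge(2)[OF i], of "\<lambda>s. den_factor (Y (Suc s)) (\<kappa> i s)"] by simp
  qed simp
  have K: "K \<noteq> 0"
  proof -
    have "num_factor r (Y s) i \<noteq> 0" if "i \<in> ?I" "s \<in> {1..<m' + 1 - i}" for i s
    proof -
      have "s \<in> {1..m}" using t_ge(2)[OF that(1)] D(7)[OF that(1)] that(2) by simp
      then show ?thesis using nz[of s i] nz[of s r] that(1) r by (auto simp: num_factor_def)
    qed
    then show ?thesis unfolding K_def by (simp del: One_nat_def)
  qed
  have bars: "(\<Prod>s\<in>{1..m}. (\<Prod>d\<in>S s. num_factor r (Y s) d) / (\<Prod>d\<in>S (s - 1). den_factor (Y s) d)) =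
      (\<Prod>i\<in>?I. \<Prod>s\<in>{m' + 1 - i..<t i}. B_bar r Y s (\<kappa> i s))"
  proof -
    have "B_bar r Y s (\<kappa> i s) = num_factor r (Y s) (\<kappa> i s) / den_factor (Y (Suc s)) (\<kappa> i s)"
      if "i \<in> ?I" "s \<in> {m' + 1 - i..<t i}" for i s
      using D(9)[OF that(1), of s] that by (auto simp: B_bar_def num_factor_def den_factor_def Y_ext_def)
    then have "(\<Prod>i\<in>?I. \<Prod>s\<in>{m' + 1 - i..<t i}. B_bar r Y s (\<kappa> i s)) =
      (\<Prod>i\<in>?I. \<Prod>s\<in>{m' + 1 - i..<t i}. num_factor r (Y s) (\<kappa> i s) / den_factor (Y (Suc s)) (\<kappa> i s))"
      by (intro prod.cong refl) auto
    then show ?thesis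
      unfolding prod_dividef nums dens num_split den_split using K by simp
  qed
  have lasts: "(\<Prod>s\<in>{1..m}. if card (S (s - 1)) = card (S s) then 1 / Y s r else 1) =
      (\<Prod>i = 1..m' + 1. \<Prod>s\<in>{t i<..<t (i - 1)}. B_last r Y s)"
  proof -
    have card: "card (S s) = card {i \<in> ?I. s < t i}" for s
      unfolding Ss by (rule card_image[OF C(5)])
    have eq_iff: "card (S (s - 1)) = card (S s) \<longleftrightarrow> s \<notin> t ` ?I" if s: "s \<in> {1..m}" for s
    proof -
      let ?A = "{i \<in> ?I. s < t i}" and ?B = "{i \<in> ?I. s - 1 < t i}"
      have sub: "?A \<subseteq> ?B"
      proof
        fix i assume "i \<in> ?A"
        then show "i \<in> ?B" using less_imp_diff_less[of s "t i" 1] by blast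
      qed
      have "card ?B = card ?A \<longleftrightarrow> ?A = ?B"
      proof
        assume eq: "card ?B = card ?A"
        have "finite ?B" by simp
        then show "?A = ?B" by (rule card_subset_eq[OF _ sub eq[symmetric]])
      next
        assume "?A = ?B"
        then show "card ?B = card ?A" by (simp only:)
      qed
      then have "card (S (s - 1)) = card (S s) \<longleftrightarrow> ?A = ?B" unfolding card .
      also have "\<dots> \<longleftrightarrow> (\<forall>i\<in>?I. s < t i \<longleftrightarrow> s - 1 < t i)" by blast
      also have "\<dots> \<longleftrightarrow> (\<forall>i\<in>?I. s \<noteq> t i)"
      proof (rule ball_cong[OF HOL.refl])
        fix i show "(s < t i \<longleftrightarrow> s - 1 < t i) \<longleftrightarrow> s \<noteq> t i" using s by auto
      qed
      finally show ?thesis by blast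
    qed
    have dec: "t (Suc i) < t i" if "i \<le> m'" for i
    proof (cases "i = 0")
      case True then show ?thesis using D(1) D(7)[of 1] r by simp
    next
      case False
      then show ?thesis using D(8)[of i] D(2)[of "Suc i"] D(6)[of i] that by (cases "i = m'") auto
    qed
    have "(\<Prod>s\<in>{1..m}. if card (S (s - 1)) = card (S s) then 1 / Y s r else 1) =
        (\<Prod>s\<in>{1..m}. if s \<notin> t ` ?I then B_last r Y s else 1)"
      by (rule prod.cong) (use eq_iff in \<open>simp_all add: B_last_def\<close>)
    also have "\<dots> = (\<Prod>s\<in>{t (m' + 1)<..<t 0} - t ` ?I. B_last r Y s)"
    proof -
      have "{t (m' + 1)<..<t 0} = {1..m}" using D(1) D(2)[of "m' + 1"] by auto
      then have "{t (m' + 1)<..<t 0} - t ` ?I = {s \<in> {1..m}. s \<notin> t ` ?I}" by blast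
      then show ?thesis by (simp only: prod.inter_filter finite_atLeastAtMost)
    qed
    also have "\<dots> = (\<Prod>i = 1..m' + 1. \<Prod>s\<in>{t i<..<t (i - 1)}. B_last r Y s)"
      by (rule prod_gaps[symmetric]) (rule dec)
    finally show ?thesis .
  qed
  have top: "(\<Prod>i = 1..m' + 1. \<Prod>s\<in>{m' + 1 - i..<t i}. B_bar r Y s (\<kappa> i s)) =
      (\<Prod>i\<in>?I. \<Prod>s\<in>{m' + 1 - i..<t i}. B_bar r Y s (\<kappa> i s))"
    using D(2)[of "m' + 1"] by simp
  show ?thesis
    unfolding cycle_weight_def prod.distrib bars lasts top ..
qed

theorem theorem5p7:
  fixes r m m' k :: nat and js :: "nat list" and Y :: "nat \<Rightarrow> nat \<Rightarrow> complex"
  assumes "1 \<le> m'" and "m' \<le> m" and "m \<le> r"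
    and "k = m' * r"
    and "js = cyclic_word r m"
    and "\<And>s j. s \<in> {1..m} \<Longrightarrow> j \<in> {1..r} \<Longrightarrow> Y s j \<noteq> 0"
  shows "DeltaL r k js (Y_list r m Y) =
    (\<Sum>(t, \<kappa>) \<in> index_pairs r m m'.
      \<Prod>i = 1..m' + 1.
        (\<Prod>s \<in> {m' + 1 - i..<t i}. B_bar r Y s (\<kappa> i s)) *
        (\<Prod>s \<in> {t i<..<t (i - 1)}. B_last r Y s))"
proof -
  let ?B = "\<lambda>(t, \<kappa>). \<Prod>i = 1..m' + 1.
    (\<Prod>s \<in> {m' + 1 - i..<t i}. B_bar r Y s (\<kappa> i s)) * (\<Prod>s \<in> {t i<..<t (i - 1)}. B_last r Y s)"
  have r: "1 \<le> r" "m' \<le> r" using assms(1-3) by simp_all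
  have sub: "{1..m'} \<subseteq> {1..r}" using r by auto
  let ?X = "{S \<in> chains r {1..m'} m. S m = {}}"
  have "DeltaL r k js (Y_list r m Y) =
      evolve_word r (concat (map (\<lambda>s. cycle_letters r (Y s) 1) [1..<Suc m]))
        (\<lambda>A. if A = {} then 1 else 0) {1..m'}"
    unfolding assms(4,5) by (rule DeltaL_eq[OF assms(1-3)]) (rule assms(6))
  also have "\<dots> = (\<Sum>S\<in>chains r {1..m'} m. chain_weight r Y m S * (if S m = {} then 1 else 0))"
    by (rule evolve_cycles[OF r(1) sub]) (rule assms(6))
  also have "\<dots> = (\<Sum>S\<in>chains r {1..m'} m. if S m = {} then chain_weight r Y m S else 0)"
    by (rule sum.cong) simp_all
  also have "\<dots> = (\<Sum>S\<in>?X. chain_weight r Y m S)"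
    by (rule sum.inter_filter[OF finite_chains[OF sub], symmetric])
  also have "\<dots> = (\<Sum>p\<in>index_pairs r m m'. ?B p)"
  proof (rule sum.reindex_bij_witness[of _ "to_chain m'" "from_chain m m'"])
    fix S assume S: "S \<in> ?X"
    show "to_chain m' (from_chain m m' S) = S"
      by (rule to_chain_from_chain[of S r m' m]) (use S r in auto)
    show ip: "from_chain m m' S \<in> index_pairs r m m'"
      by (rule from_chain_index_pairs) (use S r assms(1,2) in auto)
    obtain t \<kappa> where tk: "from_chain m m' S = (t, \<kappa>)" by (cases "from_chain m m' S") auto
    have "chain_weight r Y m (to_chain m' (t, \<kappa>)) = ?B (t, \<kappa>)"
      unfolding prod.case by (rule chain_weight_to_chain[OF ip[unfolded tk] assms(1) r(2)]) (rule assms(6))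
    then show "?B (from_chain m m' S) = chain_weight r Y m S"
      using \<open>to_chain m' (from_chain m m' S) = S\<close>
      unfolding tk prod.case by (simp only:)
  next
    fix p assume "p \<in> index_pairs r m m'"
    then obtain t \<kappa> where p: "p = (t, \<kappa>)" "(t, \<kappa>) \<in> index_pairs r m m'" by (cases p) auto
    show "from_chain m m' (to_chain m' p) = p"
      unfolding p(1) by (rule from_chain_to_chain[OF p(2) assms(1) r(2)])
    show "to_chain m' p \<in> ?X"
      unfolding p(1) using to_chain_chains[OF p(2) assms(1) r(2)] by blast
  qed
  finally show ?thesis .
qed

end
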